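(* In the clustered-data framework described in the context, suppose that $\widehat\theta_n^w\to\theta$ in probability as $n\to\infty$ and that: (a) $\lim_{n\to\infty}\sum_{i=1}^n\Big(\frac{\sum_{j=1}^{m_i}w_{ij}}{N_n}\Big)=1$ and $\lim_{n\to\infty}\frac1{N_n}\sum_{i=1}^n\sum_{j=1}^{m_i}w_{ij}^2=c_w<\infty$; (b) $\lim_{n\to\infty}\frac1{N_n}\sum_{i=1}^n\sum_{j=1}^{m_i}\sum_{j'\ne j}w_{ij}w_{ij'}C_{\theta,i}=C_\theta^w$, where $C_{\theta,i}=\mathbb{E}_\theta\,\psi(X_{ij},\theta)\psi^{T}(X_{ij'},\theta)$ ($j\neq j'$); (c) $\mathbb{E}_\theta(\|\psi(X_{11},\theta)\|^{2+\eta})<\infty$ for some $\eta>0$ and $\lim_{n\to\infty}\frac1{N_n^{1+\eta/2}}\sum_{i=1}^n\big(\sum_{j=1}^{m_i}w_{ij}\big)^{2+\eta}=0$; (d) for some $\delta>0$, $\mathbb{E}_\theta\big(\|\dot\psi(X_{11},\theta)\|^{1+\delta}\big)<\infty$ (matrix norm), and there are $\lambda\in(0,1]$ and a measurable $k:\mathbb{R}^d\to[0,\infty)$ with $\|\dot\psi(x,a_2)-\dot\psi(x,a_1)\|\le k(x)\|a_2-a_1\|^\lambda$ for all $x\in\mathbb{R}^d$ and $a_1,a_2\in U$, $\mathbb{E}_\theta(k^{1+\delta}(X_{11}))<\infty$, and $\lim_{n\to\infty}\sum_{i=1}^n\Big(\frac{\sum_{j=1}^{m_i}w_{ij}}{N_n}\Big)^{1+\delta}=0$.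 Also assume that $V_\theta:=\mathbb{E}_\theta(\dot\psi(X_{11},\theta))$ is invertible. Then $$\sqrt{N_n}\,(\widehat\theta_n^w-\theta)\ \xrightarrow[n\to\infty]{d}\ N(0,\Sigma_\theta^w),\qquad \Sigma_\theta^w=V_\theta^{-1}\big(c_wB_\theta+C_\theta^w\big)V_\theta^{-1},$$ where $B_\theta:=\mathbb{E}_\theta\,\psi(X_{11},\theta)\psi^{T}(X_{11},\theta)$.
   Context: Framework. $X_1,X_2,\dots$ are independent clusters; cluster $X_i$ consists of $m_i\ge1$ random variables $X_{i1},\dots,X_{im_i}$ with values in $\mathbb{R}^d$. All $X_{ij}$ have the same distribution $\mathbb{P}_\theta$, with $\theta\in\Theta\subset\mathbb{R}^d$, where $\Theta$ is a convex bounded set with non-empty interior; $\mathbb{E}_\theta$ denotes the corresponding expectation. Within each cluster $i$, $(X_{i1},X_{i2})$ and $(X_{ik},X_{ik'})$ have the same distribution for all $k\ne k'$ in $\{1,\dots,m_i\}$ (variables of the same cluster may be dependent). $N_n:=\sum_{i=1}^n m_i$ and $\lim_{n\to\infty}N_n/n=\ell\in[1,\infty)$. $\rho:\mathbb{R}^d\times\mathbb{R}^d\to\mathbb{R}$ is such that $x\mapsto\rho(x,a)$ is measurable for every $a$, and $\theta=\arg\min_{a\in\Theta}\mathbb{E}_\theta(\rho(X_{11},a))$. The function $a\mapsto\rho(x,a)$ is twice differentiable on a convex open neighbourhood $U\subset\mathbb{R}^d$ of $\theta$, for all $x$; $\psi(x,a)=\big(\frac{\partial\rho}{\partial a_1},\dots,\frac{\partial\rho}{\partial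 a_d}\big)^T(x,a)$ is its gradient in $a$ and $\dot\psi(x,a)$ its Hessian in $a$. One has $\mathbb{E}_\theta(\psi(X_{11},\theta))=0$. The weights $w_{ij}$ are non-random positive numbers. The weighted M-estimator is $\widehat\theta_n^w=\arg\min_{a\in\Theta}\frac1{N_n}\sum_{i=1}^n\sum_{j=1}^{m_i}w_{ij}\rho(X_{ij},a)$; in the differentiable case it is equivalently defined as the value $a=\widehat\theta_n^w$ satisfying $\sum_{i=1}^n\sum_{j=1}^{m_i}w_{ij}\psi(X_{ij},a)=0$ (whenever $\widehat\theta_n^w\in U$), and this estimating equation is taken to hold. Sums over $j'\ne j$ run over $j'\in\{1,\dots,m_i\}\setminus\{j\}$. *)

theory Defs
  imports "HOL-Probability.Probability"
begin

definition outer_prod :: "real^'d \<Rightarrow> real^'d \<Rightarrow> real^'d^'d" where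
  "outer_prod u v = (\<chi> i. \<chi> j. u $ i * v $ j)"

text \<open>Clusters and the variables inside a cluster are numbered from 1; \<open>m i\<close> is the size of
  cluster \<open>i\<close>.\<close>

definition total_size :: "(nat \<Rightarrow> nat) \<Rightarrow> nat \<Rightarrow> real" where
  "total_size m n = real (\<Sum>i=1..n. m i)"

definition converges_in_probability ::
    "'w measure \<Rightarrow> (nat \<Rightarrow> 'w \<Rightarrow> 'a::metric_space) \<Rightarrow> 'a \<Rightarrow> bool" where
  "converges_in_probability M Y c \<longleftrightarrow>
     (\<forall>\<epsilon>>0. (\<lambda>n. measure M {\<omega> \<in> space M. dist (Y n \<omega>) c > \<epsilon>}) \<longlonglongrightarrow> 0)"

text \<open>The library's \<open>weak_conv_m\<close> is stated through distribution functions and covers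
  real-valued variables only; vectors are handled through bounded continuous test functions.\<close>

definition converges_in_distribution ::
    "'w measure \<Rightarrow> (nat \<Rightarrow> 'w \<Rightarrow> 'a::metric_space) \<Rightarrow> 'a measure \<Rightarrow> bool" where
  "converges_in_distribution M Y \<mu> \<longleftrightarrow>
     (\<forall>f :: 'a \<Rightarrow> real. continuous_on UNIV f \<longrightarrow> bounded (range f) \<longrightarrow>
        (\<lambda>n. \<integral>\<omega>. f (Y n \<omega>) \<partial>M) \<longlonglongrightarrow> (\<integral>x. f x \<partial>\<mu>))"

text \<open>The univariate normal law with mean \<open>c\<close> and variance \<open>v \<ge> 0\<close>; for \<open>v = 0\<close> it is the
  point mass at \<open>c\<close>.\<close>

definition normal_law :: "real \<Rightarrow> real \<Rightarrow> real measure" where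
  "normal_law c v =
     (if v = 0 then return borel c else density lborel (\<lambda>x. ennreal (normal_density c (sqrt v) x)))"

text \<open>\<open>N(c, S)\<close>, with \<open>S\<close> possibly singular: every linear functional is univariate normal with
  the matching mean and variance.\<close>

definition multivariate_normal :: "(real^'d) measure \<Rightarrow> real^'d \<Rightarrow> real^'d^'d \<Rightarrow> bool" where
  "multivariate_normal \<mu> c S \<longleftrightarrow>
     prob_space \<mu> \<and> sets \<mu> = sets borel \<and>
     transpose S = S \<and> (\<forall>t. 0 \<le> t \<bullet> (S *v t)) \<and>
     (\<forall>t. distr \<mu> borel (\<lambda>x. t \<bullet> x) = normal_law (t \<bullet> c) (t \<bullet> (S *v t)))"

end

theory Submission
  imports Defs
begin

text \<open>
  Write \<open>N\<close> for the number of observations, \<open>T = sqrt N (est - \<theta>)\<close>,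
  \<open>S\<close> for the weighted sum of the gradients \<open>\<psi> (X i j) \<theta>\<close> divided
  by \<open>sqrt N\<close>, and \<open>A\<close> for the weighted mean of the Hessians \<open>\<psi>' (X
  i j) \<theta>\<close>. Expanding the estimating equation around \<open>\<theta>\<close> gives \<open>0
  = S + A T + r\<close>, where the Hoelder condition bounds \<open>r\<close> by \<open>K |est -
  \<theta>|^lam |T|\<close> with \<open>K\<close> the weighted mean of \<open>k\<close>. By a law of
  large numbers \<open>A\<close> tends to \<open>V\<close> and \<open>K\<close> is bounded in
  probability, and the estimator is consistent, so \<open>r\<close> and \<open>(A - V) T\<close> are
  vanishing multiples of \<open>T\<close>. As \<open>V\<close> is invertible they can be absorbed, and
  \<open>T = - V^{-1} S + o(1)\<close> in probability: this is \<open>asymptotic_linearity\<close>, and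
  all that remains is a central limit theorem for \<open>S\<close>.

  The score \<open>S\<close> is a sum of independent centred contributions, one for each cluster. The
  variance of \<open>u \<bullet> S\<close> splits into the diagonal part, which involves
  \<open>B\<close> and the squared weights, and the part from pairs inside a cluster, which involves the
  \<open>C i\<close>; its limit is \<open>u \<bullet> (cw B + Cw) u\<close>. Convexity of \<open>x powr
  p\<close> bounds the \<open>p\<close>-th absolute moment of a cluster sum by the \<open>p\<close>-th
  power of its total weight times the \<open>p\<close>-th moment of one summand, whatever the dependence
  inside the cluster; hence condition (c) implies Lyapunov's condition, and
  \<open>cluster_central_limit\<close> gives the limit of the characteristic function of every
  projection of \<open>S\<close>.

  The law of large numbers (\<open>weighted_law_of_large_numbers\<close>) is proved by truncation: the
  bounded part has variance at most a multiple of the sum of squared cluster weights, which tends to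
  zero by (d), and the rest is small in mean.

  Three facts connect these limits with the conclusion. Convergence of the expectations of all
  \<open>cos (t \<bullet> x + b)\<close> together with tightness implies convergence in distribution
  (\<open>converges_in_distribution_if_cosines_converge\<close>): each test function is folded
  periodically by a triangle wave, which leaves it unchanged on a large box and makes one Weierstrass
  approximation valid uniformly on the whole space. Every positive semidefinite matrix is the covariance
  of a Gaussian law (\<open>ex_multivariate_normal\<close>), built by splitting off rank-one parts.
  Finally Hessians are symmetric (\<open>symmetric_second_derivative\<close>), hence so are
  \<open>V\<close> and its inverse; without this the covariance of \<open>V^{-1} S\<close> would carry a
  transpose on one of its factors.
\<close>

section \<open>Boundedness and convergence to zero in probability\<close>

text \<open>Tightness, asked for eventually only: the first few laws of the sequence do not matter for limits.\<close>

definition stochastically_bounded :: "'w measure \<Rightarrow> (nat \<Rightarrow> 'w \<Rightarrow> 'a::real_normed_vector) \<Rightarrow> bool" where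
  "stochastically_bounded M Y \<longleftrightarrow>
     (\<forall>e>0. \<exists>K. \<forall>\<^sub>F n in sequentially. measure M {x \<in> space M. norm (Y n x) > K} \<le> e)"

lemma tendsto_normI:
  fixes f :: "'x \<Rightarrow> 'a::real_normed_vector"
  assumes "\<And>r. 0 < r \<Longrightarrow> \<forall>\<^sub>F x in F. norm (f x - l) < r"
  shows "(f \<longlongrightarrow> l) F"
  by (rule tendstoI) (simp add: dist_norm assms)

lemma converges_in_probability_zero_iff:
  fixes Y :: "nat \<Rightarrow> 'w \<Rightarrow> 'a::real_normed_vector"
  shows "converges_in_probability M Y 0 \<longleftrightarrow>
    (\<forall>\<epsilon>>0. (\<lambda>n. measure M {x \<in> space M. norm (Y n x) > \<epsilon>}) \<longlonglongrightarrow> 0)"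
  by (simp add: converges_in_probability_def dist_norm)

context prob_space
begin

lemma measure_le_by_cover:
  assumes "B \<in> sets M" "C \<in> sets M" "A \<subseteq> B \<union> C"
  shows "measure M A \<le> measure M B + measure M C"
proof -
  have "measure M A \<le> measure M (B \<union> C)" by (rule finite_measure_mono[OF assms(3)]) (use assms in auto)
  also have "\<dots> \<le> measure M B + measure M C" by (rule measure_Un_le[OF assms(1,2)])
  finally show ?thesis .
qed

lemma measure_tendsto_zero_by_cover:
  assumes "\<And>n. B n \<in> sets M" "\<And>n. C n \<in> sets M" "\<And>n. A n \<subseteq> B n \<union> C n"
    and "(\<lambda>n. measure M (B n)) \<longlonglongrightarrow> 0" "(\<lambda>n. measure M (C n)) \<longlonglongrightarrow> 0"
  shows "(\<lambda>n. measure M (A n)) \<longlonglongrightarrow> 0"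
proof (rule tendsto_sandwich[OF _ _ tendsto_const])
  show "(\<lambda>n. measure M (B n) + measure M (C n)) \<longlonglongrightarrow> 0"
    using tendsto_add[OF assms(4,5)] by simp
  show "\<forall>\<^sub>F n in sequentially. measure M (A n) \<le> measure M (B n) + measure M (C n)"
    by (intro always_eventually allI measure_le_by_cover assms(1-3))
qed auto

text \<open>Markov's inequality for a dominating function, so that the norm itself need not be shown integrable.\<close>

lemma measure_norm_gt_le:
  fixes Y :: "'a \<Rightarrow> 'b::real_normed_vector"
  assumes [measurable]: "Y \<in> borel_measurable M" and g: "integrable M g"
    and le: "\<And>x. x \<in> space M \<Longrightarrow> norm (Y x) \<le> g x" and c: "0 < c"
  shows "measure M {x \<in> space M. norm (Y x) > c} \<le> expectation g / c"
proof -
  have [measurable]: "g \<in> borel_measurable M" using g by auto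
  have "measure M {x \<in> space M. norm (Y x) > c} \<le> measure M {x \<in> space M. c \<le> g x}"
    by (rule finite_measure_mono) (use le in force, measurable)
  also have "\<dots> \<le> expectation g / c"
    by (rule integral_Markov_inequality_measure[where A = "{}"])
       (use g c le in \<open>auto intro!: AE_I2 order_trans[OF norm_ge_zero]\<close>)
  finally show ?thesis .
qed

lemma converges_in_probability_zero_if_mean:
  fixes Y :: "nat \<Rightarrow> 'a \<Rightarrow> 'b::real_normed_vector"
  assumes "\<And>n. Y n \<in> borel_measurable M" "\<And>n. integrable M (g n)"
    and "\<And>n x. x \<in> space M \<Longrightarrow> norm (Y n x) \<le> g n x" "(\<lambda>n. expectation (g n)) \<longlonglongrightarrow> 0"
  shows "converges_in_probability M Y 0"
  unfolding converges_in_probability_zero_iff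
proof (intro allI impI)
  fix \<epsilon> :: real assume "0 < \<epsilon>"
  show "(\<lambda>n. measure M {x \<in> space M. norm (Y n x) > \<epsilon>}) \<longlonglongrightarrow> 0"
  proof (rule tendsto_sandwich[OF _ _ tendsto_const])
    show "(\<lambda>n. expectation (g n) / \<epsilon>) \<longlonglongrightarrow> 0" by (rule tendsto_divide_zero[OF assms(4)])
    show "\<forall>\<^sub>F n in sequentially. measure M {x \<in> space M. norm (Y n x) > \<epsilon>} \<le> expectation (g n) / \<epsilon>"
      by (intro always_eventually allI measure_norm_gt_le assms(1-3) \<open>0 < \<epsilon>\<close>)
  qed auto
qed

lemma stochastically_bounded_if_mean:
  fixes Y :: "nat \<Rightarrow> 'a \<Rightarrow> 'b::real_normed_vector"
  assumes "\<And>n. Y n \<in> borel_measurable M" "\<And>n. integrable M (g n)"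
    and "\<And>n x. x \<in> space M \<Longrightarrow> norm (Y n x) \<le> g n x" "(\<lambda>n. expectation (g n)) \<longlonglongrightarrow> L"
  shows "stochastically_bounded M Y"
  unfolding stochastically_bounded_def
proof (intro allI impI)
  fix e :: real assume e: "0 < e"
  have "0 \<le> expectation (g n)" for n
    using assms(3) by (intro integral_nonneg_AE AE_I2) (rule order_trans[OF norm_ge_zero])
  then have L: "0 \<le> L" by (intro LIMSEQ_le_const[OF assms(4)]) auto
  define K where "K = (L + 1) / e"
  have K: "0 < K" using L e by (simp add: K_def)
  have "\<forall>\<^sub>F n in sequentially. expectation (g n) < L + 1"
    by (rule order_tendstoD(2)[OF assms(4)]) simp
  then have "\<forall>\<^sub>F n in sequentially. measure M {x \<in> space M. norm (Y n x) > K} \<le> e"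
  proof eventually_elim
    case (elim n)
    have "measure M {x \<in> space M. norm (Y n x) > K} \<le> expectation (g n) / K"
      by (intro measure_norm_gt_le assms(1-3) K)
    also have "\<dots> \<le> (L + 1) / K" using elim K by (intro divide_right_mono) auto
    also have "\<dots> = e" using L e by (simp add: K_def)
    finally show ?case .
  qed
  then show "\<exists>K. \<forall>\<^sub>F n in sequentially. measure M {x \<in> space M. norm (Y n x) > K} \<le> e" ..
qed

lemma converges_in_probability_zero_add:
  fixes Y Z :: "nat \<Rightarrow> 'a \<Rightarrow> real"
  assumes [measurable]: "\<And>n. Y n \<in> borel_measurable M" "\<And>n. Z n \<in> borel_measurable M"
    and "converges_in_probability M Y 0" "converges_in_probability M Z 0"
  shows "converges_in_probability M (\<lambda>n x. Y n x + Z n x) 0"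
  unfolding converges_in_probability_zero_iff
proof (intro allI impI)
  fix \<epsilon> :: real assume "0 < \<epsilon>"
  then have e: "0 < \<epsilon> / 2" by simp
  show "(\<lambda>n. measure M {x \<in> space M. norm (Y n x + Z n x) > \<epsilon>}) \<longlonglongrightarrow> 0"
  proof (rule measure_tendsto_zero_by_cover)
    show "(\<lambda>n. measure M {x \<in> space M. norm (Y n x) > \<epsilon> / 2}) \<longlonglongrightarrow> 0"
      "(\<lambda>n. measure M {x \<in> space M. norm (Z n x) > \<epsilon> / 2}) \<longlonglongrightarrow> 0"
      using assms(3,4) e unfolding converges_in_probability_zero_iff by blast+
  qed auto
qed

text \<open>The factor that is bounded in probability is at most \<open>K\<close> outside a small event, and
  there the product can only be large if the vanishing factor exceeds \<open>\<epsilon> / K\<close>.\<close>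

lemma converges_in_probability_zero_mult:
  fixes Y Z :: "nat \<Rightarrow> 'a \<Rightarrow> real"
  assumes [measurable]: "\<And>n. Y n \<in> borel_measurable M" "\<And>n. Z n \<in> borel_measurable M"
    and Y: "stochastically_bounded M Y" and Z: "converges_in_probability M Z 0"
  shows "converges_in_probability M (\<lambda>n x. Y n x * Z n x) 0"
  unfolding converges_in_probability_zero_iff
proof (intro allI impI tendsto_normI)
  fix \<epsilon> r :: real assume "0 < \<epsilon>" "0 < r"
  then obtain K0 where K0: "\<forall>\<^sub>F n in sequentially. measure M {x \<in> space M. norm (Y n x) > K0} \<le> r / 2"
    using Y unfolding stochastically_bounded_def by (meson half_gt_zero)
  define K where "K = max 1 K0"
  have K: "0 < K" "K0 \<le> K" by (auto simp: K_def)
  have "(\<lambda>n. measure M {x \<in> space M. norm (Z n x) > \<epsilon> / K}) \<longlonglongrightarrow> 0"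
    using Z \<open>0 < \<epsilon>\<close> K(1) unfolding converges_in_probability_zero_iff by simp
  then have "\<forall>\<^sub>F n in sequentially. measure M {x \<in> space M. norm (Z n x) > \<epsilon> / K} < r / 2"
    by (rule order_tendstoD(2)) (use \<open>0 < r\<close> in simp)
  with K0 show "\<forall>\<^sub>F n in sequentially. norm (measure M {x \<in> space M. norm (Y n x * Z n x) > \<epsilon>} - 0) < r"
  proof eventually_elim
    case (elim n)
    let ?B = "{x \<in> space M. norm (Y n x) > K0}" and ?C = "{x \<in> space M. norm (Z n x) > \<epsilon> / K}"
    have "{x \<in> space M. norm (Y n x * Z n x) > \<epsilon>} \<subseteq> ?B \<union> ?C"
    proof (rule subsetI, rule ccontr)
      fix x assume x: "x \<in> {x \<in> space M. norm (Y n x * Z n x) > \<epsilon>}" "x \<notin> ?B \<union> ?C"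
      then have "norm (Y n x) \<le> K" "norm (Z n x) \<le> \<epsilon> / K" using K by auto
      then have "norm (Y n x) * norm (Z n x) \<le> K * (\<epsilon> / K)" using K by (intro mult_mono) auto
      then show False using x(1) K(1) by (simp add: abs_mult)
    qed
    then have "measure M {x \<in> space M. norm (Y n x * Z n x) > \<epsilon>} \<le> measure M ?B + measure M ?C"
      by (rule measure_le_by_cover[rotated 2]) measurable
    then show ?case using elim by simp
  qed
qed

lemma converges_in_probability_zero_powr:
  fixes Y :: "nat \<Rightarrow> 'a \<Rightarrow> 'b::real_normed_vector"
  assumes "converges_in_probability M Y 0" and p: "0 < p"
  shows "converges_in_probability M (\<lambda>n x. norm (Y n x) powr p) 0"
  unfolding converges_in_probability_zero_iff
proof (intro allI impI)
  fix \<epsilon> :: real assume e: "0 < \<epsilon>"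
  have "norm (norm (Y n x) powr p) > \<epsilon> \<longleftrightarrow> norm (Y n x) > \<epsilon> powr (1 / p)" for n x
  proof -
    have "norm (Y n x) powr p > (\<epsilon> powr (1 / p)) powr p \<longleftrightarrow> norm (Y n x) > \<epsilon> powr (1 / p)"
    proof (cases "norm (Y n x) > \<epsilon> powr (1 / p)")
      case True
      then show ?thesis using p by (simp add: powr_less_mono2)
    next
      case False
      then have "norm (Y n x) powr p \<le> (\<epsilon> powr (1 / p)) powr p" using p by (intro powr_mono2) auto
      with False show ?thesis by simp
    qed
    then show ?thesis using p e by (simp add: powr_powr)
  qed
  then show "(\<lambda>n. measure M {x \<in> space M. norm (norm (Y n x) powr p) > \<epsilon>}) \<longlonglongrightarrow> 0"
    using assms(1) e unfolding converges_in_probability_zero_iff by simp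
qed

lemma stochastically_bounded_add:
  fixes Y Z :: "nat \<Rightarrow> 'a \<Rightarrow> 'b::{real_normed_vector, second_countable_topology}"
  assumes [measurable]: "\<And>n. Y n \<in> borel_measurable M" "\<And>n. Z n \<in> borel_measurable M"
    and Y: "stochastically_bounded M Y" and Z: "converges_in_probability M Z 0"
  shows "stochastically_bounded M (\<lambda>n x. Y n x + Z n x)"
  unfolding stochastically_bounded_def
proof (intro allI impI)
  fix e :: real assume e: "0 < e"
  then obtain K where K: "\<forall>\<^sub>F n in sequentially. measure M {x \<in> space M. norm (Y n x) > K} \<le> e / 2"
    using Y unfolding stochastically_bounded_def by (meson half_gt_zero)
  have "(\<lambda>n. measure M {x \<in> space M. norm (Z n x) > 1}) \<longlonglongrightarrow> 0"
    using Z unfolding converges_in_probability_zero_iff by simp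
  then have "\<forall>\<^sub>F n in sequentially. measure M {x \<in> space M. norm (Z n x) > 1} < e / 2"
    by (rule order_tendstoD(2)) (use e in simp)
  with K have "\<forall>\<^sub>F n in sequentially. measure M {x \<in> space M. norm (Y n x + Z n x) > K + 1} \<le> e"
  proof eventually_elim
    case (elim n)
    let ?B = "{x \<in> space M. norm (Y n x) > K}" and ?C = "{x \<in> space M. norm (Z n x) > 1}"
    have "{x \<in> space M. norm (Y n x + Z n x) > K + 1} \<subseteq> ?B \<union> ?C"
    proof (rule subsetI)
      fix x assume "x \<in> {x \<in> space M. norm (Y n x + Z n x) > K + 1}"
      then show "x \<in> ?B \<union> ?C" using norm_triangle_ineq[of "Y n x" "Z n x"] by auto
    qed
    then have "measure M {x \<in> space M. norm (Y n x + Z n x) > K + 1} \<le> measure M ?B + measure M ?C"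
      by (rule measure_le_by_cover[rotated 2]) measurable
    then show ?case using elim by linarith
  qed
  then show "\<exists>K. \<forall>\<^sub>F n in sequentially. measure M {x \<in> space M. norm (Y n x + Z n x) > K} \<le> e" ..
qed

lemma stochastically_bounded_dominated:
  fixes Y :: "nat \<Rightarrow> 'a \<Rightarrow> 'b::{real_normed_vector, second_countable_topology}"
    and Z :: "nat \<Rightarrow> 'a \<Rightarrow> 'c::real_normed_vector"
  assumes [measurable]: "\<And>n. Y n \<in> borel_measurable M" and Y: "stochastically_bounded M Y"
    and le: "\<And>n x. norm (Z n x) \<le> c * norm (Y n x)" and c: "0 \<le> c"
  shows "stochastically_bounded M Z"
  unfolding stochastically_bounded_def
proof (intro allI impI)
  fix e :: real assume "0 < e"
  then obtain K where K: "\<forall>\<^sub>F n in sequentially. measure M {x \<in> space M. norm (Y n x) > K} \<le> e"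
    using Y unfolding stochastically_bounded_def by blast
  then have "\<forall>\<^sub>F n in sequentially. measure M {x \<in> space M. norm (Z n x) > c * K} \<le> e"
  proof eventually_elim
    case (elim n)
    have "norm (Z n x) \<le> c * K" if "norm (Y n x) \<le> K" for x
      using le[of n x] mult_left_mono[OF that c] by linarith
    then have "{x \<in> space M. norm (Z n x) > c * K} \<subseteq> {x \<in> space M. norm (Y n x) > K}"
      by (auto simp flip: not_le)
    then have "measure M {x \<in> space M. norm (Z n x) > c * K} \<le> measure M {x \<in> space M. norm (Y n x) > K}"
      by (rule finite_measure_mono) measurable
    with elim show ?case by linarith
  qed
  then show "\<exists>K. \<forall>\<^sub>F n in sequentially. measure M {x \<in> space M. norm (Z n x) > K} \<le> e" ..
qed

end

section \<open>Convergence in distribution through cosine test functions\<close>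

text \<open>Real trigonometric polynomials with arbitrary real frequencies. The phase \<open>b\<close> covers
  sines as well.\<close>

inductive trigonometric :: "('a::real_inner \<Rightarrow> real) \<Rightarrow> bool" where
  cosine: "trigonometric (\<lambda>x. c * cos (t \<bullet> x + b))"
| add: "trigonometric f \<Longrightarrow> trigonometric g \<Longrightarrow> trigonometric (\<lambda>x. f x + g x)"

lemma trigonometric_const: "trigonometric (\<lambda>x. c)"
  using trigonometric.cosine[of c 0 0] by simp

text \<open>The product-to-sum formula keeps products inside the class.\<close>

lemma trigonometric_cosine_mult:
  assumes "trigonometric g"
  shows "trigonometric (\<lambda>x. c * cos (t \<bullet> x + b) * g x)"
  using assms
proof induction
  case (cosine d s a)
  have "(\<lambda>x. c * cos (t \<bullet> x + b) * (d * cos (s \<bullet> x + a))) =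
      (\<lambda>x. (c * d / 2) * cos ((t - s) \<bullet> x + (b - a)) + (c * d / 2) * cos ((t + s) \<bullet> x + (b + a)))"
  proof
    fix x
    have e: "(t - s) \<bullet> x + (b - a) = (t \<bullet> x + b) - (s \<bullet> x + a)"
      "(t + s) \<bullet> x + (b + a) = (t \<bullet> x + b) + (s \<bullet> x + a)"
      by (auto simp: inner_diff_left inner_add_left)
    show "c * cos (t \<bullet> x + b) * (d * cos (s \<bullet> x + a)) =
      (c * d / 2) * cos ((t - s) \<bullet> x + (b - a)) + (c * d / 2) * cos ((t + s) \<bullet> x + (b + a))"
      unfolding e cos_diff cos_add by (simp add: field_simps)
  qed
  then show ?case by (auto intro!: trigonometric.intros simp only:)
next
  case (add f g)
  from trigonometric.add[OF add.IH] show ?case by (simp add: ring_distribs)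
qed

lemma trigonometric_mult:
  assumes "trigonometric f" "trigonometric g"
  shows "trigonometric (\<lambda>x. f x * g x)"
  using assms(1)
proof induction
  case (cosine c t b)
  show ?case by (rule trigonometric_cosine_mult[OF assms(2)])
next
  case (add f f')
  from trigonometric.add[OF add.IH] show ?case by (simp add: ring_distribs)
qed

lemma trigonometric_sum:
  assumes "finite I" "\<And>i. i \<in> I \<Longrightarrow> trigonometric (f i)"
  shows "trigonometric (\<lambda>x. \<Sum>i\<in>I. f i x)"
  using assms by (induction I rule: finite_induct) (auto intro: trigonometric_const trigonometric.add)

lemma trigonometric_polynomial_in_sines:
  fixes p :: "real^'d \<Rightarrow> real"
  assumes "real_polynomial_function p"
  shows "trigonometric (\<lambda>x::real^'d. p (\<chi> i. sin (\<alpha> * x $ i)))"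
  using assms
proof induction
  case (linear f)
  interpret bounded_linear f by fact
  define a where "a i = f (axis i 1)" for i
  have f_eq: "f v = (\<Sum>i\<in>UNIV. a i * v $ i)" for v
  proof -
    have "f v = f (\<Sum>i\<in>UNIV. v $ i *\<^sub>R axis i 1)"
      using basis_expansion[of v] by (simp add: scalar_mult_eq_scaleR)
    also have "\<dots> = (\<Sum>i\<in>UNIV. a i * v $ i)" by (simp add: sum scaleR mult.commute a_def)
    finally show ?thesis .
  qed
  have sines_eq: "(\<lambda>x::real^'d. f (\<chi> i. sin (\<alpha> * x $ i))) =
      (\<lambda>x. \<Sum>i\<in>UNIV. a i * cos ((\<alpha> *\<^sub>R axis i 1) \<bullet> x + - (pi/2)))"
    by (simp add: f_eq inner_axis inner_commute[of "axis _ _"] cos_diff fun_eq_iff)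
  show ?case unfolding sines_eq
    by (rule trigonometric_sum, rule finite, rule trigonometric.cosine)
qed (auto intro: trigonometric_const trigonometric.add trigonometric_mult)

text \<open>The map taking each coordinate \<open>x $ i\<close> to \<open>arcsin (sin (\<alpha> * x $ i)) /
  \<alpha>\<close> is a triangle wave that is the identity for \<open>\<bar>x $ i\<bar> \<le>
  L\<close>. Composing \<open>f\<close> with it gives a continuous function of the sines, which range
  over the compact cube of vectors with entries in \<open>[-1, 1]\<close>. A polynomial in the sines
  that is close to it there is close to it on the whole space, and up to \<open>e\<close> it inherits
  the global bound of \<open>f\<close>.\<close>

lemma trigonometric_approximation_on_box:
  fixes f :: "real^'d \<Rightarrow> real"
  assumes f: "continuous_on UNIV f" "\<And>x. \<bar>f x\<bar> \<le> B" and "L > 0" "e > 0"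
  obtains g where "trigonometric g" "\<And>x. \<bar>g x\<bar> \<le> B + e"
    "\<And>x. norm x \<le> L \<Longrightarrow> \<bar>f x - g x\<bar> \<le> e"
proof -
  define \<alpha> where "\<alpha> = pi / (2 * L)"
  have \<alpha>: "\<alpha> > 0" using \<open>L > 0\<close> by (simp add: \<alpha>_def)
  define F where "F s = f (\<chi> i. arcsin (s $ i) / \<alpha>)" for s :: "real^'d"
  let ?C = "{s::real^'d. \<forall>i. s $ i \<in> {-1..1}}"
  have C_cbox: "?C = cbox (\<chi> i. -1) (\<chi> i. 1)" by (auto simp: mem_box_cart)
  have "continuous_on ?C F"
    unfolding F_def
    by (rule continuous_on_compose2[OF f(1)]) (use \<alpha> in \<open>auto intro!: continuous_intros\<close>)
  moreover have "compact ?C" unfolding C_cbox by (rule compact_cbox)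
  ultimately obtain p where p: "real_polynomial_function p" "\<And>s. s \<in> ?C \<Longrightarrow> \<bar>F s - p s\<bar> < e"
    using Stone_Weierstrass_real_polynomial_function[of ?C F e] \<open>e > 0\<close> by auto
  define g where "g x = p (\<chi> i. sin (\<alpha> * x $ i))" for x :: "real^'d"
  have close: "\<bar>F (\<chi> i. sin (\<alpha> * x $ i)) - g x\<bar> < e" for x
    unfolding g_def by (rule p(2)) auto
  have "\<bar>g x\<bar> \<le> B + e" for x
    using close[of x] f(2)[of "\<chi> i. arcsin ((\<chi> i. sin (\<alpha> * x $ i)) $ i) / \<alpha>"] unfolding F_def by linarith
  moreover have "\<bar>f x - g x\<bar> \<le> e" if "norm x \<le> L" for x
  proof -
    have "arcsin (sin (\<alpha> * x $ i)) = \<alpha> * x $ i" for i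
    proof (rule arcsin_sin)
      have "\<bar>x $ i\<bar> \<le> L" using component_le_norm_cart[of x i] that by linarith
      then have "\<alpha> * \<bar>x $ i\<bar> \<le> \<alpha> * L" using \<alpha> by (intro mult_left_mono) auto
      also have "\<alpha> * L = pi / 2" using \<open>L > 0\<close> by (simp add: \<alpha>_def)
      finally have "\<bar>\<alpha> * x $ i\<bar> \<le> pi / 2" using \<alpha> by (simp add: abs_mult)
      then show "- (pi / 2) \<le> \<alpha> * x $ i" "\<alpha> * x $ i \<le> pi / 2" by linarith+
    qed
    then have "F (\<chi> i. sin (\<alpha> * x $ i)) = f x"
      using \<alpha> by (simp add: F_def)
    then show ?thesis using close[of x] by simp
  qed
  ultimately show ?thesis
    using that[of g] trigonometric_polynomial_in_sines[OF p(1), of \<alpha>] unfolding g_def by blast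
qed

lemma continuous_on_trigonometric:
  "trigonometric g \<Longrightarrow> continuous_on UNIV g"
  by (induction rule: trigonometric.induct) (auto intro!: continuous_intros)

lemma bounded_trigonometric:
  "trigonometric g \<Longrightarrow> \<exists>K. \<forall>x. \<bar>g x\<bar> \<le> K"
proof (induction rule: trigonometric.induct)
  case (cosine c t b)
  have "\<bar>c * cos (t \<bullet> x + b)\<bar> \<le> \<bar>c\<bar>" for x
    using mult_left_mono[OF abs_cos_le_one, of "\<bar>c\<bar>"] by (simp add: abs_mult)
  then show ?case by blast
next
  case (add f g)
  then obtain K K' where K: "\<And>x. \<bar>f x\<bar> \<le> K" "\<And>x. \<bar>g x\<bar> \<le> K'" by blast
  have "\<bar>f x + g x\<bar> \<le> K + K'" for x using K(1)[of x] K(2)[of x] by linarith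
  then show ?case by blast
qed

text \<open>Outside the ball only the bounds on \<open>f\<close> and \<open>g\<close> are available, but that
  event has probability at most \<open>e\<close>.\<close>

lemma (in prob_space) expectation_close_if_close_on_ball:
  fixes f g :: "'b::real_normed_vector \<Rightarrow> real"
  assumes Y: "Y \<in> borel_measurable M"
    and fm: "f \<in> borel_measurable borel" and gm: "g \<in> borel_measurable borel"
    and fB: "\<And>x. \<bar>f x\<bar> \<le> B" and gB: "\<And>x. \<bar>g x\<bar> \<le> B + e"
    and fg: "\<And>x. norm x \<le> L \<Longrightarrow> \<bar>f x - g x\<bar> \<le> e"
    and e: "0 < e" and small: "measure M {x \<in> space M. norm (Y x) > L} \<le> e"
  shows "\<bar>(\<integral>x. f (Y x) \<partial>M) - (\<integral>x. g (Y x) \<partial>M)\<bar> \<le> e + (2 * B + e) * e"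
proof -
  note [measurable] = Y fm gm
  have B: "0 \<le> B" using fB[of undefined] by linarith
  let ?A = "{x \<in> space M. norm (Y x) > L}"
  have A[measurable]: "?A \<in> sets M" by measurable
  have if': "integrable M (\<lambda>x. f (Y x))"
    by (rule integrable_const_bound[of _ B]) (use fB in auto)
  have ig: "integrable M (\<lambda>x. g (Y x))"
    by (rule integrable_const_bound[of _ "B+e"]) (use gB in auto)
  have iA: "integrable M (indicator ?A :: _ \<Rightarrow> real)"
    by (rule integrable_const_bound[of _ 1]) (auto simp: indicator_def)
  have "\<bar>(\<integral>x. f (Y x) \<partial>M) - (\<integral>x. g (Y x) \<partial>M)\<bar> = \<bar>\<integral>x. f (Y x) - g (Y x) \<partial>M\<bar>"
    using if' ig by simp
  also have "\<dots> \<le> (\<integral>x. \<bar>f (Y x) - g (Y x)\<bar> \<partial>M)" by (rule integral_abs_bound)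
  also have "\<dots> \<le> (\<integral>x. e + (2 * B + e) * indicator ?A x \<partial>M)"
  proof (rule integral_mono)
    show "\<bar>f (Y x) - g (Y x)\<bar> \<le> e + (2 * B + e) * indicator ?A x" if "x \<in> space M" for x
      using fg[of "Y x"] fB[of "Y x"] gB[of "Y x"] e that
      by (cases "norm (Y x) > L") (auto simp: indicator_def)
  qed (use if' ig iA in auto)
  also have "\<dots> = e + (2 * B + e) * measure M ?A"
    using iA by (subst Bochner_Integration.integral_add) (auto simp: prob_space)
  also have "\<dots> \<le> e + (2 * B + e) * e"
    using small B e by (intro add_left_mono mult_left_mono) auto
  finally show ?thesis .
qed

lemma (in prob_space) ex_ball_of_almost_full_measure:
  fixes Y :: "'a \<Rightarrow> 'b::real_normed_vector"
  assumes [measurable]: "Y \<in> borel_measurable M" and e: "0 < e"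
  shows "\<exists>K. measure M {x \<in> space M. norm (Y x) > K} \<le> e"
proof -
  have "(\<lambda>n. measure M {x \<in> space M. norm (Y x) > real n}) \<longlonglongrightarrow>
      measure M (\<Inter>n. {x \<in> space M. norm (Y x) > real n})"
    by (rule finite_Lim_measure_decseq) (auto simp: decseq_def)
  moreover have "(\<Inter>n. {x \<in> space M. norm (Y x) > real n}) = {}"
  proof -
    have "norm y \<le> real (nat \<lceil>norm y\<rceil>)" for y :: 'b by (rule real_nat_ceiling_ge)
    then have "\<not> (\<forall>n. norm y > real n)" for y :: 'b by (metis not_less)
    then show ?thesis by blast
  qed
  ultimately have "(\<lambda>n. measure M {x \<in> space M. norm (Y x) > real n}) \<longlonglongrightarrow> 0" by simp
  from order_tendstoD(2)[OF this e] show ?thesis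
    by (auto simp: eventually_sequentially intro: less_imp_le)
qed

text \<open>A multivariate continuity theorem. On a ball that carries almost all the mass of the limit and of
  the sequence, a bounded continuous function is replaced by a trigonometric polynomial, whose
  expectations converge by hypothesis; the two replacement errors are controlled by tightness.\<close>

theorem (in prob_space) converges_in_distribution_if_cosines_converge:
  fixes Y :: "nat \<Rightarrow> 'a \<Rightarrow> real^'d" and \<mu> :: "(real^'d) measure"
  assumes Y: "\<And>n. Y n \<in> borel_measurable M"
    and \<mu>: "prob_space \<mu>" "sets \<mu> = sets borel"
    and tight: "stochastically_bounded M Y"
    and cosines: "\<And>t b. (\<lambda>n. \<integral>x. cos (t \<bullet> Y n x + b) \<partial>M) \<longlonglongrightarrow> (\<integral>x. cos (t \<bullet> x + b) \<partial>\<mu>)"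
  shows "converges_in_distribution M Y \<mu>"
  unfolding converges_in_distribution_def
proof (intro allI impI)
  fix f :: "real^'d \<Rightarrow> real"
  assume cont: "continuous_on UNIV f" and bdd: "bounded (range f)"
  interpret \<mu>: prob_space \<mu> by fact
  have meas_\<mu>: "h \<in> borel_measurable \<mu>" if "h \<in> borel_measurable borel" for h :: "real^'d \<Rightarrow> 'c::topological_space"
    using that by (subst measurable_cong_sets[OF \<mu>(2) refl])
  obtain B where B: "\<And>x. \<bar>f x\<bar> \<le> B" using bdd by (auto simp: bounded_iff)
  then have B0: "0 \<le> B" using abs_ge_zero order_trans by blast
  have trig_conv: "(\<lambda>n. \<integral>x. g (Y n x) \<partial>M) \<longlonglongrightarrow> (\<integral>x. g x \<partial>\<mu>)" if "trigonometric g" for g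
    using that
  proof induction
    case (cosine c t b)
    show ?case using tendsto_mult_left[OF cosines[of t b], of c] by simp
  next
    case (add f g)
    have int: "integrable M (\<lambda>x. h (Y n x))" "integrable \<mu> h"
      if h: "trigonometric h" for h :: "real^'d \<Rightarrow> real" and n
    proof -
      obtain K where K: "\<And>x. \<bar>h x\<bar> \<le> K" using bounded_trigonometric[OF h] by blast
      have [measurable]: "h \<in> borel_measurable borel"
        by (rule borel_measurable_continuous_onI[OF continuous_on_trigonometric[OF h]])
      note [measurable] = Y
      show "integrable M (\<lambda>x. h (Y n x))"
        by (rule integrable_const_bound[of _ K]) (use K in auto)
      show "integrable \<mu> h"
        by (rule \<mu>.integrable_const_bound[of _ K]) (use K in \<open>auto intro: meas_\<mu>\<close>)
    qed
    show ?case
      using tendsto_add[OF add.IH] int[OF add.hyps(1)] int[OF add.hyps(2)] by simp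
  qed
  show "(\<lambda>n. \<integral>x. f (Y n x) \<partial>M) \<longlonglongrightarrow> (\<integral>x. f x \<partial>\<mu>)"
  proof (rule tendsto_normI)
    fix r :: real assume r: "r > 0"
    \<comment> \<open>The total error will be at most \<open>2 * (e + (2 * B + e) * e) + e\<close>, which is below
      \<open>e * (4 * B + 6)\<close> as soon as \<open>e \<le> 1\<close>.\<close>
    define e where "e = min 1 (r / (4 * B + 6))"
    have e: "0 < e" "e \<le> 1" using r B0 by (auto simp: e_def)
    have "e * (4 * B + 6) \<le> r"
    proof -
      have "e \<le> r / (4 * B + 6)" by (simp add: e_def)
      then show ?thesis using B0 by (simp add: field_simps)
    qed
    moreover have "e * e \<le> e" using mult_left_mono[of e 1 e] e by simp
    moreover have "2 * (e + (2 * B + e) * e) + e = e * (4 * B + 6) - 3 * e + 2 * (e * e)"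
      by (simp add: algebra_simps)
    ultimately have er: "2 * (e + (2 * B + e) * e) + e < r" using e by linarith
    obtain K1 where K1: "\<forall>\<^sub>F n in sequentially. measure M {x \<in> space M. norm (Y n x) > K1} \<le> e"
      using tight e by (auto simp: stochastically_bounded_def)
    obtain K2 where K2: "measure \<mu> {x \<in> space \<mu>. norm x > K2} \<le> e"
      using \<mu>.ex_ball_of_almost_full_measure[OF meas_\<mu>[OF measurable_ident] e(1)] by auto
    define L where "L = max 1 (max K1 K2)"
    have L: "L > 0" "K1 \<le> L" "K2 \<le> L" by (auto simp: L_def)
    obtain g where g: "trigonometric g" "\<And>x. \<bar>g x\<bar> \<le> B + e" "\<And>x. norm x \<le> L \<Longrightarrow> \<bar>f x - g x\<bar> \<le> e"
      using trigonometric_approximation_on_box[OF cont B L(1) e(1)] by blast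
    have fm: "f \<in> borel_measurable borel" and gm: "g \<in> borel_measurable borel"
      by (auto intro: borel_measurable_continuous_onI continuous_on_trigonometric g cont)
    have "measure \<mu> {x \<in> space \<mu>. norm x > L} \<le> measure \<mu> {x \<in> space \<mu>. norm x > K2}"
    proof (rule \<mu>.finite_measure_mono)
      show "{x \<in> space \<mu>. norm x > L} \<subseteq> {x \<in> space \<mu>. norm x > K2}" using L(3) by auto
      have [measurable]: "(\<lambda>x. x) \<in> borel_measurable \<mu>" by (rule meas_\<mu>) simp
      show "{x \<in> space \<mu>. norm x > K2} \<in> sets \<mu>" by measurable
    qed
    with K2 have "measure \<mu> {x \<in> space \<mu>. norm x > L} \<le> e" by linarith
    then have 2: "\<bar>(\<integral>x. f x \<partial>\<mu>) - (\<integral>x. g x \<partial>\<mu>)\<bar> \<le> e + (2 * B + e) * e"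
      using \<mu>.expectation_close_if_close_on_ball[where Y = "\<lambda>x. x",
          OF meas_\<mu>[OF measurable_ident[unfolded id_def]] fm gm B g(2,3) e(1)] by simp
    have 1: "\<forall>\<^sub>F n in sequentially. \<bar>(\<integral>x. f (Y n x) \<partial>M) - (\<integral>x. g (Y n x) \<partial>M)\<bar> \<le> e + (2 * B + e) * e"
      using K1
    proof eventually_elim
      case (elim n)
      note [measurable] = Y
      have "measure M {x \<in> space M. norm (Y n x) > L} \<le> measure M {x \<in> space M. norm (Y n x) > K1}"
        using L by (intro finite_measure_mono) auto
      with elim have "measure M {x \<in> space M. norm (Y n x) > L} \<le> e" by linarith
      then show ?case using expectation_close_if_close_on_ball[OF Y fm gm B g(2,3) e(1)] by simp
    qed
    from trig_conv[OF g(1)] have "\<forall>\<^sub>F n in sequentially. dist (\<integral>x. g (Y n x) \<partial>M) (\<integral>x. g x \<partial>\<mu>) < e"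
      using e(1) by (rule tendstoD)
    with 1 show "\<forall>\<^sub>F n in sequentially. norm ((\<integral>x. f (Y n x) \<partial>M) - (\<integral>x. f x \<partial>\<mu>)) < r"
    proof eventually_elim
      case (elim n)
      have "\<bar>a - b\<bar> < r" if "\<bar>a - a'\<bar> \<le> D" "\<bar>a' - b'\<bar> < e" "\<bar>b - b'\<bar> \<le> D" "2 * D + e < r"
        for a a' b b' D :: real using that by linarith
      from this[OF elim(1) elim(2)[unfolded dist_real_def] 2 er] show ?case by simp
    qed
  qed
qed

lemma (in prob_space) expectation_cos_shift:
  assumes [measurable]: "Y \<in> borel_measurable M"
  shows "(\<integral>x. cos (Y x + b) \<partial>M) = Re (iexp b * (CLINT x|M. iexp (Y x)))"
proof -
  have int: "complex_integrable M (\<lambda>x. iexp (Y x))"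
    by (rule integrable_const_bound[of _ 1]) auto
  have "Re (iexp b * (CLINT x|M. iexp (Y x))) = Re (CLINT x|M. iexp b * iexp (Y x))"
    by simp
  also have "\<dots> = (\<integral>x. Re (iexp b * iexp (Y x)) \<partial>M)"
    by (intro integral_Re[symmetric] integrable_mult_right int)
  also have "\<dots> = (\<integral>x. cos (Y x + b) \<partial>M)"
    by (intro Bochner_Integration.integral_cong refl) (simp add: cos_add Re_exp Im_exp)
  finally show ?thesis by simp
qed

text \<open>Slutsky's theorem for the test functions in use: cosine is Lipschitz and bounded, so a perturbation
  that vanishes in probability does not change the limit.\<close>

lemma (in prob_space) expectation_cos_slutsky:
  fixes Y Z :: "nat \<Rightarrow> 'a \<Rightarrow> 'b::euclidean_space"
  assumes [measurable]: "\<And>n. Y n \<in> borel_measurable M" "\<And>n. Z n \<in> borel_measurable M"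
    and Z: "converges_in_probability M Z 0"
    and lim: "(\<lambda>n. \<integral>x. cos (t \<bullet> Y n x + b) \<partial>M) \<longlonglongrightarrow> L"
  shows "(\<lambda>n. \<integral>x. cos (t \<bullet> (Y n x + Z n x) + b) \<partial>M) \<longlonglongrightarrow> L"
proof -
  let ?c = "\<lambda>y. cos (t \<bullet> y + b)"
  have lipschitz: "\<bar>cos x - cos y\<bar> \<le> \<bar>x - y\<bar>" for x y :: real
  proof -
    have "norm (cos x - cos y) \<le> 1 * norm (x - y)"
      by (rule field_differentiable_bound[of UNIV cos "\<lambda>x. - sin x"])
         (auto intro!: derivative_eq_intros)
    then show ?thesis by simp
  qed
  have int: "integrable M (\<lambda>x. ?c (Y n x + Z n x))" "integrable M (\<lambda>x. ?c (Y n x))" for n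
    by (rule integrable_const_bound[of _ 1]; simp)+
  have "(\<lambda>n. (\<integral>x. ?c (Y n x + Z n x) \<partial>M) - (\<integral>x. ?c (Y n x) \<partial>M)) \<longlonglongrightarrow> 0"
  proof (rule tendsto_normI)
    fix r :: real assume r: "0 < r"
    define d where "d = r / (2 * (norm t + 1))"
    have nt: "0 < norm t + 1" by (simp add: add_nonneg_pos)
    have d: "0 < d" "norm t * d < r / 2"
      using r nt by (auto simp: d_def field_simps)
    have "(\<lambda>n. measure M {x \<in> space M. norm (Z n x) > d}) \<longlonglongrightarrow> 0"
      using Z d unfolding converges_in_probability_zero_iff by simp
    then have "\<forall>\<^sub>F n in sequentially. measure M {x \<in> space M. norm (Z n x) > d} < r / 4"
      by (rule order_tendstoD(2)) (use r in simp)
    then show "\<forall>\<^sub>F n in sequentially. norm ((\<integral>x. ?c (Y n x + Z n x) \<partial>M) - (\<integral>x. ?c (Y n x) \<partial>M) - 0) < r"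
    proof eventually_elim
      case (elim n)
      let ?A = "{x \<in> space M. norm (Z n x) > d}"
      have A: "?A \<in> sets M" by measurable
      have iA: "integrable M (\<lambda>x. norm t * d + 2 * indicator ?A x :: real)"
        using A by (intro Bochner_Integration.integrable_add integrable_mult_right integrable_real_indicator)
          (auto simp: emeasure_eq_measure)
      have "\<bar>(\<integral>x. ?c (Y n x + Z n x) \<partial>M) - (\<integral>x. ?c (Y n x) \<partial>M)\<bar> = \<bar>\<integral>x. ?c (Y n x + Z n x) - ?c (Y n x) \<partial>M\<bar>"
        using int by simp
      also have "\<dots> \<le> (\<integral>x. \<bar>?c (Y n x + Z n x) - ?c (Y n x)\<bar> \<partial>M)" by (rule integral_abs_bound)
      also have "\<dots> \<le> (\<integral>x. norm t * d + 2 * indicator ?A x \<partial>M)"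
      proof (rule integral_mono[OF _ iA])
        show "integrable M (\<lambda>x. \<bar>?c (Y n x + Z n x) - ?c (Y n x)\<bar>)"
          using int by simp
        fix x assume x: "x \<in> space M"
        show "\<bar>?c (Y n x + Z n x) - ?c (Y n x)\<bar> \<le> norm t * d + 2 * indicator ?A x"
        proof (cases "x \<in> ?A")
          case True
          have "\<bar>?c (Y n x + Z n x)\<bar> \<le> 1" "\<bar>?c (Y n x)\<bar> \<le> 1" by (rule abs_cos_le_one)+
          then have "\<bar>?c (Y n x + Z n x) - ?c (Y n x)\<bar> \<le> 2" by linarith
          moreover have "0 \<le> norm t * d" using d by simp
          moreover have "indicator ?A x = (1::real)" using True by (rule indicator_simps)
          ultimately show ?thesis by linarith
        next
          case False
          have "\<bar>?c (Y n x + Z n x) - ?c (Y n x)\<bar> \<le> \<bar>t \<bullet> Z n x\<bar>"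
            using lipschitz[of "t \<bullet> (Y n x + Z n x) + b" "t \<bullet> Y n x + b"] by (simp add: inner_add_right)
          also have "\<dots> \<le> norm t * norm (Z n x)" by (rule Cauchy_Schwarz_ineq2)
          also have "\<dots> \<le> norm t * d" using False x by (intro mult_left_mono) auto
          finally show ?thesis using False by simp
        qed
      qed
      also have "\<dots> = norm t * d + 2 * measure M ?A"
        using A by (subst Bochner_Integration.integral_add) (auto simp: prob_space emeasure_eq_measure)
      finally show ?case using elim d by simp
    qed
  qed
  from tendsto_add[OF this lim] show ?thesis by simp
qed

section \<open>Gaussian measures with a given covariance form\<close>

lemma CLINT_iexp_scaled_std_normal:
  "(CLINT z|std_normal_distribution. iexp (s * z)) = exp (- (s\<^sup>2) / 2)"
  using fun_cong[OF char_std_normal_distribution, of s] by (simp add: char_def)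

text \<open>Induction on the number of basis vectors with nonzero diagonal entry. If \<open>q b b\<close> is
  positive, subtracting the square of \<open>r x = q x b / sqrt (q b b)\<close> leaves a form that is
  still positive semidefinite, by Cauchy-Schwarz for \<open>q\<close>, and has a zero entry at
  \<open>b\<close>. The sum of a law for the remaining form and an independent standard normal
  multiple of the vector representing \<open>r\<close> has the required characteristic function. A
  positive semidefinite form with zero diagonal vanishes and belongs to the point mass at the origin.\<close>

lemma ex_gaussian_measure_of_bilinear_form:
  fixes q :: "'a::euclidean_space \<Rightarrow> 'a \<Rightarrow> real"
  assumes "bilinear q" "\<And>x y. q x y = q y x" "\<And>x. 0 \<le> q x x"
  shows "\<exists>\<mu>::'a measure. prob_space \<mu> \<and> sets \<mu> = sets borel \<and>
    (\<forall>t. (CLINT x|\<mu>. iexp (t \<bullet> x)) = exp (- (q t t) / 2))"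
  using assms
proof (induction "card {b \<in> Basis. q b b \<noteq> 0}" arbitrary: q rule: less_induct)
  case less
  note sym = less.prems(2) and pos = less.prems(3)
  have lin: "linear (\<lambda>x. q x y)" for y using less.prems(1) by (simp add: bilinear_def)
  note q_simps = bilinear_ladd[OF less.prems(1)] bilinear_radd[OF less.prems(1)]
    bilinear_lsub[OF less.prems(1)] bilinear_rsub[OF less.prems(1)]
    bilinear_lmul[OF less.prems(1)] bilinear_rmul[OF less.prems(1)]
  show ?case
  proof (cases "\<exists>b\<in>Basis. q b b \<noteq> 0")
    case False
    have "q b c = (\<lambda>_ _. 0) b c" if bc: "b \<in> Basis" "c \<in> Basis" for b c
    proof -
      have "0 \<le> q (b + c) (b + c)" "0 \<le> q (b - c) (b - c)" by (rule pos)+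
      moreover have "q b b = 0" "q c c = 0" using False bc by auto
      ultimately show ?thesis using sym[of b c] by (simp add: q_simps)
    qed
    moreover have "bilinear (\<lambda>(_::'a) (_::'a). 0::real)"
      by (simp add: bilinear_def linear_iff)
    ultimately have "q = (\<lambda>_ _. 0)"
      using bilinear_eq_stdbasis[OF less.prems(1), of "\<lambda>_ _. 0"] by simp
    moreover have "(CLINT x|return borel (0::'a). iexp (t \<bullet> x)) = 1" for t
      by (subst integral_return) auto
    ultimately show ?thesis
      by (intro exI[of _ "return borel 0"]) (auto intro: prob_space_return)
  next
    case True
    then obtain b where b: "b \<in> Basis" "q b b \<noteq> 0" by blast
    then have qbb: "q b b > 0" using pos[of b] by linarith
    define r where "r x = q x b / sqrt (q b b)" for x
    have r2: "(r x)\<^sup>2 = q x b * q x b / q b b" for x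
      using qbb by (simp add: r_def power2_eq_square)
    define q' where "q' x y = q x y - r x * r y" for x y
    have "linear r" unfolding r_def
      using linear_compose[OF lin[of b], of "\<lambda>u. u / sqrt (q b b)"]
      by (simp add: o_def linear_iff add_divide_distrib)
    then have r_simps: "r (x + y) = r x + r y" "r (c *\<^sub>R x) = c * r x" for x y c
      by (simp_all add: linear_iff)
    have "bilinear q'"
      by (auto simp: bilinear_def linear_iff q'_def q_simps r_simps algebra_simps)
    moreover have "q' x y = q' y x" for x y using sym[of x y] by (simp add: q'_def)
    moreover have q'_pos: "0 \<le> q' x x" for x
    proof -
      define c where "c = q x b / q b b"
      have "q (x - c *\<^sub>R b) (x - c *\<^sub>R b) = q x x - 2 * c * q x b + c * c * q b b"
        using sym[of b x] by (simp add: q_simps algebra_simps)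
      also have "\<dots> = q' x x"
        using qbb r2[of x] by (simp add: q'_def c_def power2_eq_square)
      finally show ?thesis using pos[of "x - c *\<^sub>R b"] by simp
    qed
    moreover have "card {c \<in> Basis. q' c c \<noteq> 0} < card {c \<in> Basis. q c c \<noteq> 0}"
    proof (rule psubset_card_mono)
      have "q' c c = 0" if "q c c = 0" for c
        using q'_pos[of c] that by (auto simp: q'_def mult_le_0_iff)
      moreover have "q' b b = 0" using r2[of b] qbb by (simp add: q'_def power2_eq_square)
      ultimately show "{c \<in> Basis. q' c c \<noteq> 0} \<subset> {c \<in> Basis. q c c \<noteq> 0}"
        using b by blast
    qed simp
    ultimately obtain \<mu>' where \<mu>': "prob_space \<mu>'" "sets \<mu>' = sets borel"
      "\<And>t. (CLINT x|\<mu>'. iexp (t \<bullet> x)) = exp (- (q' t t) / 2)"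
      using less.hyps[of q'] by blast
    define v where "v = adjoint r 1"
    have v: "t \<bullet> v = r t" for t
      using adjoint_works[OF \<open>linear r\<close>, of t 1] by (simp add: v_def)
    interpret \<mu>': prob_space \<mu>' by fact
    interpret Z: real_distribution std_normal_distribution by (rule real_dist_normal_dist)
    interpret PP: pair_prob_space std_normal_distribution \<mu>' ..
    let ?P = "std_normal_distribution \<Otimes>\<^sub>M \<mu>'"
    let ?f = "\<lambda>(z, x). z *\<^sub>R v + x"
    have sets_P: "sets ?P = sets (borel \<Otimes>\<^sub>M borel)"
      by (rule sets_pair_measure_cong) (simp_all add: \<mu>'(2))
    have f: "?f \<in> borel_measurable ?P"
      by (subst measurable_cong_sets[OF sets_P refl]) measurable
    have "(CLINT x|distr ?P borel ?f. iexp (t \<bullet> x)) = exp (- (q t t) / 2)" for t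
    proof -
      have g: "(\<lambda>y. iexp (t \<bullet> ?f y)) \<in> borel_measurable ?P"
        using f by measurable
      have "(CLINT x|distr ?P borel ?f. iexp (t \<bullet> x)) = (CLINT y|?P. iexp (t \<bullet> ?f y))"
        by (rule integral_distr[OF f]) simp
      also have "\<dots> = (CLINT z|std_normal_distribution. CLINT x|\<mu>'. iexp (t \<bullet> ?f (z, x)))"
        by (rule PP.integral_fst'[symmetric], rule PP.integrable_const_bound[of _ 1], simp, rule g)
      also have "\<dots> = (CLINT z|std_normal_distribution. CLINT x|\<mu>'. iexp (r t * z) * iexp (t \<bullet> x))"
        by (simp add: inner_add_right v exp_add ring_distribs mult.commute)
      also have "\<dots> = (CLINT z|std_normal_distribution. iexp (r t * z)) * (CLINT x|\<mu>'. iexp (t \<bullet> x))"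
        by (subst integral_mult_right_zero, subst integral_mult_left_zero, rule refl)
      also have "\<dots> = exp (- (r t)\<^sup>2 / 2) * exp (- (q' t t) / 2)"
        unfolding CLINT_iexp_scaled_std_normal \<mu>'(3) by simp
      also have "\<dots> = exp (- (q t t) / 2)"
        by (simp add: q'_def power2_eq_square diff_divide_distrib flip: exp_add of_real_mult)
      finally show ?thesis .
    qed
    moreover have "prob_space (distr ?P borel ?f)" using f by (rule PP.prob_space_distr)
    ultimately show ?thesis by (intro exI[of _ "distr ?P borel ?f"]) auto
  qed
qed

lemma real_distribution_normal_law:
  assumes "v \<ge> 0"
  shows "real_distribution (normal_law 0 v)"
proof -
  have "prob_space (normal_law 0 v)"
  proof (cases "v = 0")
    case True
    then show ?thesis by (simp add: normal_law_def prob_space_return)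
  next
    case False
    then show ?thesis using prob_space_normal_density[of "sqrt v" 0] assms by (simp add: normal_law_def)
  qed
  moreover have "sets (normal_law 0 v) = sets borel" by (simp add: normal_law_def)
  ultimately show ?thesis by (simp add: real_distribution_def real_distribution_axioms_def)
qed

text \<open>Covers the degenerate case \<open>v = 0\<close>, in which the law is a point mass.\<close>

lemma char_normal_law:
  assumes "v \<ge> 0"
  shows "char (normal_law 0 v) s = exp (- (s\<^sup>2 * v) / 2)"
proof (cases "v = 0")
  case True
  have "(CLINT x|return borel (0::real). iexp (s * x)) = 1"
    by (subst integral_return) auto
  with True show ?thesis by (simp add: normal_law_def char_def)
next
  case False
  then have v: "sqrt v > 0" using assms by simp
  interpret Z: real_distribution std_normal_distribution by (rule real_dist_normal_dist)
  have "distributed std_normal_distribution lborel (\<lambda>x. x) std_normal_density"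
    unfolding distributed_def by (auto intro!: measure_eqI simp: emeasure_distr)
  from Z.normal_density_affine[OF this, of "sqrt v" 0] v
  have d: "distributed std_normal_distribution lborel (\<lambda>x. sqrt v * x) (normal_density 0 (sqrt v))"
    by simp
  have "char (normal_law 0 v) s = (CLINT x|distr std_normal_distribution lborel (\<lambda>x. sqrt v * x). iexp (s * x))"
    using False distributed_distr_eq_density[OF d] by (simp add: normal_law_def char_def)
  also have "\<dots> = (CLINT x|std_normal_distribution. iexp ((s * sqrt v) * x))"
    by (subst integral_distr) (auto simp: ac_simps)
  also have "\<dots> = exp (- (s\<^sup>2 * v) / 2)"
    unfolding CLINT_iexp_scaled_std_normal using assms by (simp add: power_mult_distrib)
  finally show ?thesis .
qed

text \<open>Projections are identified with \<open>normal_law\<close> by uniqueness of characteristic functions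
  on the line.\<close>

theorem ex_multivariate_normal:
  fixes S :: "real^'d^'d"
  assumes "transpose S = S" "\<And>t. 0 \<le> t \<bullet> (S *v t)"
  obtains \<mu> where "multivariate_normal \<mu> 0 S"
    "\<And>t b. (\<integral>x. cos (t \<bullet> x + b) \<partial>\<mu>) = exp (- (t \<bullet> (S *v t)) / 2) * cos b"
proof -
  define q where "q x y = x \<bullet> (S *v y)" for x y
  have "bilinear q"
    by (auto simp: bilinear_def linear_iff q_def inner_add_left inner_add_right
        matrix_vector_right_distrib matrix_vector_mult_scaleR)
  moreover have "q x y = q y x" for x y
    using dot_lmul_matrix[of y S x] assms(1)
    by (simp add: q_def inner_commute flip: transpose_matrix_vector)
  ultimately obtain \<mu> where \<mu>: "prob_space \<mu>" "sets \<mu> = sets borel"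
    "\<And>t. (CLINT x|\<mu>. iexp (t \<bullet> x)) = exp (- (q t t) / 2)"
    using ex_gaussian_measure_of_bilinear_form[of q] assms(2) by (auto simp: q_def)
  interpret \<mu>: prob_space \<mu> by fact
  have meas[measurable]: "(\<lambda>x. t \<bullet> x) \<in> borel_measurable \<mu>" for t
    by (subst measurable_cong_sets[OF \<mu>(2) refl]) simp
  have "distr \<mu> borel (\<lambda>x. t \<bullet> x) = normal_law 0 (q t t)" for t
  proof (rule Levy_uniqueness)
    have qt: "q t t \<ge> 0" using assms(2) by (simp add: q_def)
    show "real_distribution (distr \<mu> borel (\<lambda>x. t \<bullet> x))" by (rule \<mu>.real_distribution_distr) simp
    show "real_distribution (normal_law 0 (q t t))" by (rule real_distribution_normal_law[OF qt])
    have "char (distr \<mu> borel (\<lambda>x. t \<bullet> x)) s = char (normal_law 0 (q t t)) s" for s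
    proof -
      have "char (distr \<mu> borel (\<lambda>x. t \<bullet> x)) s = (CLINT x|\<mu>. iexp (s * (t \<bullet> x)))"
        unfolding char_def by (rule integral_distr) auto
      also have "\<dots> = (CLINT x|\<mu>. iexp ((s *\<^sub>R t) \<bullet> x))" by simp
      also have "\<dots> = exp (- (s\<^sup>2 * q t t) / 2)"
        unfolding \<mu>(3) by (simp add: q_def matrix_vector_mult_scaleR power2_eq_square)
      finally show ?thesis by (simp add: char_normal_law[OF qt])
    qed
    then show "char (distr \<mu> borel (\<lambda>x. t \<bullet> x)) = char (normal_law 0 (q t t))" by blast
  qed
  then have "multivariate_normal \<mu> 0 S"
    using assms \<mu>(1,2) by (simp add: multivariate_normal_def q_def)
  moreover have "(\<integral>x. cos (t \<bullet> x + b) \<partial>\<mu>) = exp (- (t \<bullet> (S *v t)) / 2) * cos b" for t b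
    by (subst \<mu>.expectation_cos_shift[OF meas], subst \<mu>(3))
       (simp add: q_def Re_exp mult.commute)
  ultimately show ?thesis by (rule that)
qed

section \<open>A central limit theorem of Lyapunov type\<close>

text \<open>For \<open>\<bar>x\<bar> \<le> e\<close> one factor \<open>\<bar>x\<bar>\<close> is estimated by
  \<open>e\<close>; otherwise \<open>(\<bar>x\<bar> / e) powr \<eta>\<close> is at least
  \<open>1\<close>. Treating the two cases in one bound admits every \<open>\<eta> > 0\<close>, also
  above \<open>1\<close> where third moments would be the natural choice.\<close>

lemma lyapunov_truncation:
  fixes x :: real
  assumes "0 < e" "0 < \<eta>"
  shows "min (x\<^sup>2) (\<bar>x\<bar> ^ 3) \<le> e * x\<^sup>2 + \<bar>x\<bar> powr (2 + \<eta>) / e powr \<eta>" (is ?A)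
    and "x\<^sup>2 \<le> e\<^sup>2 + \<bar>x\<bar> powr (2 + \<eta>) / e powr \<eta>" (is ?B)
proof -
  have nonneg: "0 \<le> \<bar>x\<bar> powr (2 + \<eta>) / e powr \<eta>" "0 \<le> e * x\<^sup>2" using assms by simp_all
  consider "\<bar>x\<bar> \<le> e" | "e < \<bar>x\<bar>" by linarith
  then have "?A \<and> ?B"
  proof cases
    case 1
    have "\<bar>x\<bar> ^ 3 = \<bar>x\<bar> * x\<^sup>2" by (simp add: power3_eq_cube power2_eq_square)
    also have "\<dots> \<le> e * x\<^sup>2" using 1 by (intro mult_right_mono) auto
    finally have "min (x\<^sup>2) (\<bar>x\<bar> ^ 3) \<le> e * x\<^sup>2" by linarith
    moreover have "x\<^sup>2 \<le> e\<^sup>2" using power_mono[OF 1, of 2] by simp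
    ultimately show ?thesis using nonneg by linarith
  next
    case 2
    then have x: "\<bar>x\<bar> > 0" using assms by linarith
    have "e powr \<eta> \<le> \<bar>x\<bar> powr \<eta>" using 2 assms by (intro powr_mono2) auto
    then have "x\<^sup>2 * e powr \<eta> \<le> x\<^sup>2 * \<bar>x\<bar> powr \<eta>" by (intro mult_left_mono) auto
    also have "\<dots> = \<bar>x\<bar> powr (2 + \<eta>)" using x by (simp add: powr_add)
    finally have "x\<^sup>2 \<le> \<bar>x\<bar> powr (2 + \<eta>) / e powr \<eta>" using assms by (simp add: field_simps)
    then show ?thesis using nonneg zero_le_power2[of e] by linarith
  qed
  then show ?A ?B by auto
qed

lemma exp_minus_linear_approx:
  fixes y :: real
  assumes "0 \<le> y"
  shows "\<bar>1 - y - exp (- y)\<bar> \<le> y\<^sup>2"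
proof -
  have "1 \<le> 1 + y ^ 3" using assms by simp
  also have "\<dots> = (1 + y) * (1 - y + y\<^sup>2)" by (simp add: algebra_simps power2_eq_square power3_eq_cube)
  also have "\<dots> \<le> exp y * (1 - y + y\<^sup>2)"
  proof (intro mult_right_mono exp_ge_add_one_self)
    have "0 \<le> (1 - y)\<^sup>2 + y" using assms by simp
    then show "0 \<le> 1 - y + y\<^sup>2" by (simp add: power2_eq_square algebra_simps)
  qed
  finally have "exp (- y) \<le> 1 - y + y\<^sup>2" by (simp add: exp_minus field_simps)
  moreover have "1 - y \<le> exp (- y)" using exp_ge_add_one_self[of "- y"] by simp
  ultimately show ?thesis by linarith
qed

text \<open>Both the characteristic function and the Gaussian factor \<open>exp (- s / 2)\<close> are compared
  with the quadratic Taylor polynomial \<open>1 - s / 2\<close>. The second error is of order \<open>s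
  * s\<close>, and one factor \<open>s\<close> is small by the truncation bound.\<close>

lemma (in prob_space) char_lyapunov_bound:
  fixes Y :: "'a \<Rightarrow> real"
  assumes Y[measurable]: "Y \<in> borel_measurable M"
    and sq: "integrable M (\<lambda>x. (Y x)\<^sup>2)" and mean: "expectation Y = 0"
    and mom: "integrable M (\<lambda>x. \<bar>Y x\<bar> powr (2 + \<eta>))"
    and e: "0 < e" "0 < \<eta>"
  defines "s \<equiv> expectation (\<lambda>x. (Y x)\<^sup>2)" and "r \<equiv> expectation (\<lambda>x. \<bar>Y x\<bar> powr (2 + \<eta>)) / e powr \<eta>"
  shows "cmod (char (distr M borel Y) 1 - exp (- s / 2)) \<le> (e * s + r) + s * (e\<^sup>2 + r)"
proof -
  have int_min: "integrable M (\<lambda>x. min (6 * (Y x)\<^sup>2) (\<bar>Y x\<bar> ^ 3))"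
    by (rule Bochner_Integration.integrable_bound[OF integrable_mult_right[OF sq, of 6]]) auto
  have s0: "0 \<le> s" by (simp add: s_def)
  have "cmod (char (distr M borel Y) 1 - (1 - s / 2)) \<le> (1 / 6) * expectation (\<lambda>x. min (6 * (Y x)\<^sup>2) (\<bar>Y x\<bar> ^ 3))"
    using char_approx3'[OF Y square_integrable_imp_integrable[OF Y sq] sq mean _ refl, of s 1] mean
    by (simp add: s_def)
  also have "\<dots> \<le> (1 / 6) * expectation (\<lambda>x. 6 * (e * (Y x)\<^sup>2 + \<bar>Y x\<bar> powr (2 + \<eta>) / e powr \<eta>))"
  proof (intro mult_left_mono integral_mono int_min)
    show "integrable M (\<lambda>x. 6 * (e * (Y x)\<^sup>2 + \<bar>Y x\<bar> powr (2 + \<eta>) / e powr \<eta>))"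
      using sq mom by simp
    fix x
    have "min (6 * a) b \<le> 6 * min a b" if "0 \<le> a" "0 \<le> b" for a b :: real
      using that unfolding min_def by auto
    then have "min (6 * (Y x)\<^sup>2) (\<bar>Y x\<bar> ^ 3) \<le> 6 * min ((Y x)\<^sup>2) (\<bar>Y x\<bar> ^ 3)" by simp
    also have "\<dots> \<le> 6 * (e * (Y x)\<^sup>2 + \<bar>Y x\<bar> powr (2 + \<eta>) / e powr \<eta>)"
      by (intro mult_left_mono lyapunov_truncation(1) e) auto
    finally show "min (6 * (Y x)\<^sup>2) (\<bar>Y x\<bar> ^ 3) \<le> 6 * (e * (Y x)\<^sup>2 + \<bar>Y x\<bar> powr (2 + \<eta>) / e powr \<eta>)" .
  qed auto
  also have "\<dots> = e * s + r"
    using sq mom by (simp add: s_def r_def)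
  finally have 1: "cmod (char (distr M borel Y) 1 - (1 - s / 2)) \<le> e * s + r" .
  have "s \<le> expectation (\<lambda>x. e\<^sup>2 + \<bar>Y x\<bar> powr (2 + \<eta>) / e powr \<eta>)"
    unfolding s_def using mom by (intro integral_mono sq lyapunov_truncation(2) e) auto
  also have "\<dots> = e\<^sup>2 + r" using mom by (simp add: r_def prob_space)
  finally have "s * s \<le> s * (e\<^sup>2 + r)" using s0 by (rule mult_left_mono)
  moreover have "(s / 2)\<^sup>2 \<le> s * s" by (simp add: power2_eq_square)
  moreover have "\<bar>1 - s / 2 - exp (- (s / 2))\<bar> \<le> (s / 2)\<^sup>2"
    using s0 by (intro exp_minus_linear_approx) auto
  ultimately have "\<bar>1 - s / 2 - exp (- (s / 2))\<bar> \<le> s * (e\<^sup>2 + r)" by linarith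
  then have 2: "cmod ((1 - s / 2) - exp (- s / 2)) \<le> s * (e\<^sup>2 + r)"
    by (subst (asm) norm_of_real[where 'a=complex, symmetric]) simp
  show ?thesis
    using norm_triangle_ineq[of "char (distr M borel Y) 1 - (1 - s / 2)" "(1 - s / 2) - complex_of_real (exp (- s / 2))"] 1 2
    by simp
qed

text \<open>The characteristic function of the sum is a product, as is \<open>exp (- v / 2)\<close> up to a
  vanishing error; products of numbers in the unit disc differ by at most the sum of the differences
  of their factors. The limit variance may be zero.\<close>

theorem (in prob_space) lyapunov_central_limit:
  fixes \<xi> :: "nat \<Rightarrow> nat \<Rightarrow> 'a \<Rightarrow> real"
  assumes indep: "\<And>n. indep_vars (\<lambda>_. borel) (\<xi> n) {1..n}"
    and sq: "\<And>n i. i \<in> {1..n} \<Longrightarrow> integrable M (\<lambda>x. (\<xi> n i x)\<^sup>2)"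
    and mean: "\<And>n i. i \<in> {1..n} \<Longrightarrow> expectation (\<xi> n i) = 0"
    and var: "(\<lambda>n. \<Sum>i=1..n. expectation (\<lambda>x. (\<xi> n i x)\<^sup>2)) \<longlonglongrightarrow> v"
    and eta: "0 < \<eta>"
    and mom: "\<And>n i. i \<in> {1..n} \<Longrightarrow> integrable M (\<lambda>x. \<bar>\<xi> n i x\<bar> powr (2 + \<eta>))"
    and lya: "(\<lambda>n. \<Sum>i=1..n. expectation (\<lambda>x. \<bar>\<xi> n i x\<bar> powr (2 + \<eta>))) \<longlonglongrightarrow> 0"
  shows "(\<lambda>n. CLINT x|M. iexp (\<Sum>i=1..n. \<xi> n i x)) \<longlonglongrightarrow> exp (- v / 2)"
proof -
  define s where "s n i = expectation (\<lambda>x. (\<xi> n i x)\<^sup>2)" for n i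
  define b where "b n i = expectation (\<lambda>x. \<bar>\<xi> n i x\<bar> powr (2 + \<eta>))" for n i
  define V where "V n = (\<Sum>i=1..n. s n i)" for n
  define L where "L n = (\<Sum>i=1..n. b n i)" for n
  define \<phi> where "\<phi> n = (CLINT x|M. iexp (\<Sum>i=1..n. \<xi> n i x))" for n
  have V: "V \<longlonglongrightarrow> v" and L: "L \<longlonglongrightarrow> 0"
    using var lya by (simp_all add: V_def[abs_def] L_def[abs_def] s_def b_def)
  have rv[measurable]: "\<xi> n i \<in> borel_measurable M" if "i \<in> {1..n}" for n i
    using indep[of n] that unfolding indep_vars_def2 by auto
  have s0: "0 \<le> s n i" and b0: "0 \<le> b n i" for n i by (simp_all add: s_def b_def)
  have \<phi>: "\<phi> n = (\<Prod>i=1..n. char (distr M borel (\<xi> n i)) 1)" for n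
  proof -
    have "(\<lambda>x. \<Sum>i=1..n. \<xi> n i x) \<in> borel_measurable M" by (intro borel_measurable_sum rv)
    then have "\<phi> n = char (distr M borel (\<lambda>x. \<Sum>i=1..n. \<xi> n i x)) 1"
      unfolding \<phi>_def char_def by (subst integral_distr) auto
    then show ?thesis using char_distr_sum[OF indep[of n], of 1] by simp
  qed
  have bound: "cmod (\<phi> n - exp (- V n / 2)) \<le> (e + e\<^sup>2) * V n + (1 + V n) * L n / e powr \<eta>" if e: "0 < e" for n e
  proof -
    have exp_V: "complex_of_real (exp (- V n / 2)) = (\<Prod>i=1..n. complex_of_real (exp (- s n i / 2)))"
      by (simp add: V_def sum_divide_distrib exp_sum sum_negf[symmetric] del: of_real_exp)
    have "cmod (\<phi> n - exp (- V n / 2)) \<le>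
        (\<Sum>i=1..n. cmod (char (distr M borel (\<xi> n i)) 1 - complex_of_real (exp (- s n i / 2))))"
      unfolding \<phi> exp_V
    proof (rule norm_prod_diff)
      fix i assume i: "i \<in> {1..n}"
      interpret D: real_distribution "distr M borel (\<xi> n i)"
        using rv[OF i] by (rule real_distribution_distr)
      show "cmod (char (distr M borel (\<xi> n i)) 1) \<le> 1" by (rule D.cmod_char_le_1)
      show "cmod (complex_of_real (exp (- s n i / 2))) \<le> 1" using s0[of n i] by (simp del: of_real_exp)
    qed
    also have "\<dots> \<le> (\<Sum>i=1..n. (e * s n i + b n i / e powr \<eta>) + s n i * (e\<^sup>2 + L n / e powr \<eta>))"
    proof (rule sum_mono)
      fix i assume i: "i \<in> {1..n}"
      have "b n i \<le> L n" unfolding L_def using i b0 by (intro member_le_sum) auto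
      then have "s n i * (e\<^sup>2 + b n i / e powr \<eta>) \<le> s n i * (e\<^sup>2 + L n / e powr \<eta>)"
        using s0[of n i] e by (intro mult_left_mono add_left_mono divide_right_mono) auto
      with char_lyapunov_bound[OF rv[OF i] sq[OF i] mean[OF i] mom[OF i] e eta]
      show "cmod (char (distr M borel (\<xi> n i)) 1 - complex_of_real (exp (- s n i / 2)))
        \<le> (e * s n i + b n i / e powr \<eta>) + s n i * (e\<^sup>2 + L n / e powr \<eta>)"
        by (simp add: s_def b_def)
    qed
    also have "\<dots> = (e * V n + L n / e powr \<eta>) + V n * (e\<^sup>2 + L n / e powr \<eta>)"
      by (simp add: sum.distrib V_def L_def sum_distrib_left sum_distrib_right sum_divide_distrib)
    also have "\<dots> = (e + e\<^sup>2) * V n + (1 + V n) * L n / e powr \<eta>"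
      by (simp add: algebra_simps add_divide_distrib)
    finally show ?thesis .
  qed
  have "(\<lambda>n. \<phi> n - exp (- V n / 2)) \<longlonglongrightarrow> 0"
  proof (rule tendsto_normI)
    fix r :: real assume r: "r > 0"
    \<comment> \<open>The error bound tends to \<open>(e + e\<^sup>2) * v\<close> as \<open>n\<close> grows, which this
      choice makes smaller than \<open>r\<close>.\<close>
    define e where "e = min 1 (r / (2 * (\<bar>v\<bar> + 1)))"
    have e: "0 < e" "e \<le> 1" using r by (auto simp: e_def)
    have "e * (2 * (\<bar>v\<bar> + 1)) \<le> r / (2 * (\<bar>v\<bar> + 1)) * (2 * (\<bar>v\<bar> + 1))"
      unfolding e_def by (intro mult_right_mono) auto
    then have "e * (2 * (\<bar>v\<bar> + 1)) \<le> r" by simp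
    moreover have "e * v \<le> e * \<bar>v\<bar>" using e by (intro mult_left_mono) auto
    moreover have "e\<^sup>2 * v \<le> e * \<bar>v\<bar>"
    proof -
      have "e\<^sup>2 * v \<le> e\<^sup>2 * \<bar>v\<bar>" by (intro mult_left_mono) auto
      also have "\<dots> \<le> e * \<bar>v\<bar>"
        using e mult_left_le[of e e] by (intro mult_right_mono) (auto simp: power2_eq_square)
      finally show ?thesis .
    qed
    moreover have "e * (2 * (\<bar>v\<bar> + 1)) = 2 * (e * \<bar>v\<bar>) + 2 * e" "(e + e\<^sup>2) * v = e * v + e\<^sup>2 * v"
      by (simp_all add: algebra_simps)
    ultimately have "(e + e\<^sup>2) * v < r" using e by linarith
    have "(\<lambda>n. (e + e\<^sup>2) * V n + (1 + V n) * L n / e powr \<eta>) \<longlonglongrightarrow> (e + e\<^sup>2) * v + (1 + v) * 0 / e powr \<eta>"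
      using e by (intro tendsto_intros V L) auto
    then have "\<forall>\<^sub>F n in sequentially. (e + e\<^sup>2) * V n + (1 + V n) * L n / e powr \<eta> < r"
      using \<open>(e + e\<^sup>2) * v < r\<close> by (intro order_tendstoD(2)) auto
    then show "\<forall>\<^sub>F n in sequentially. cmod ((\<phi> n - exp (- V n / 2)) - 0) < r"
    proof eventually_elim
      case (elim n)
      then show ?case using bound[OF e(1), of n] by simp
    qed
  qed
  moreover have "(\<lambda>n. complex_of_real (exp (- V n / 2))) \<longlonglongrightarrow> complex_of_real (exp (- v / 2))"
    by (intro tendsto_intros V) simp
  ultimately have "(\<lambda>n. (\<phi> n - exp (- V n / 2)) + complex_of_real (exp (- V n / 2))) \<longlonglongrightarrow> 0 + complex_of_real (exp (- v / 2))"
    by (rule tendsto_add)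
  then show ?thesis by (simp add: \<phi>_def[abs_def])
qed

section \<open>Samples of independent clusters\<close>

text \<open>Jensen's inequality with the weights normalised to total one. Zero entries are discarded first
  because the convexity of \<open>x powr p\<close> is used on the open half-line; this only decreases
  the total weight.\<close>

lemma powr_weighted_sum_le:
  fixes a z :: "'i \<Rightarrow> real"
  assumes J: "finite J" and a: "\<And>j. j \<in> J \<Longrightarrow> 0 < a j" and z: "\<And>j. j \<in> J \<Longrightarrow> 0 \<le> z j" and p: "1 \<le> p"
  shows "(\<Sum>j\<in>J. a j * z j) powr p \<le> (\<Sum>j\<in>J. a j) powr (p - 1) * (\<Sum>j\<in>J. a j * z j powr p)"
proof -
  define J' where "J' = {j\<in>J. 0 < z j}"
  have J': "finite J'" "J' \<subseteq> J" using J by (auto simp: J'_def)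
  have z0: "z j = 0" if "j \<in> J - J'" for j using z[of j] that by (auto simp: J'_def)
  have eq: "(\<Sum>j\<in>J. a j * z j) = (\<Sum>j\<in>J'. a j * z j)"
    "(\<Sum>j\<in>J. a j * z j powr p) = (\<Sum>j\<in>J'. a j * z j powr p)"
    by (rule sum.mono_neutral_right; use J J' z0 in auto)+
  show ?thesis
  proof (cases "J' = {}")
    case True
    then show ?thesis unfolding eq by simp
  next
    case False
    define W where "W = (\<Sum>j\<in>J'. a j)"
    have W: "0 < W" unfolding W_def using J' False a by (intro sum_pos) auto
    have "(\<Sum>j\<in>J'. (a j / W) *\<^sub>R z j) powr p \<le> (\<Sum>j\<in>J'. (a j / W) * z j powr p)"
    proof (rule convex_on_sum[OF J'(1) False powr_convex[OF p]])
      show "(\<Sum>j\<in>J'. a j / W) = 1" using W by (simp add: W_def flip: sum_divide_distrib)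
      show "0 \<le> a j / W" if "j \<in> J'" for j using a[of j] that J' W by (auto intro: less_imp_le)
    qed (auto simp: J'_def)
    then have "W powr p * ((\<Sum>j\<in>J'. a j * z j) / W) powr p \<le> W powr p * ((\<Sum>j\<in>J'. a j * z j powr p) / W)"
      by (intro mult_left_mono) (auto simp: sum_divide_distrib)
    also have "W powr p * ((\<Sum>j\<in>J'. a j * z j powr p) / W) = W powr (p - 1) * (\<Sum>j\<in>J'. a j * z j powr p)"
      using W by (simp add: powr_diff)
    also have "\<dots> \<le> (\<Sum>j\<in>J. a j) powr (p - 1) * (\<Sum>j\<in>J'. a j * z j powr p)"
    proof (intro mult_right_mono powr_mono2)
      show "W \<le> (\<Sum>j\<in>J. a j)" unfolding W_def using J J' a by (intro sum_mono2) (auto intro: less_imp_le)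
      show "0 \<le> (\<Sum>j\<in>J'. a j * z j powr p)" using a J'(2) by (intro sum_nonneg mult_nonneg_nonneg) (auto intro: less_imp_le)
    qed (use W p in auto)
    also have "W powr p * ((\<Sum>j\<in>J'. a j * z j) / W) powr p = (\<Sum>j\<in>J'. a j * z j) powr p"
    proof -
      have "0 \<le> (\<Sum>j\<in>J'. a j * z j)" using a z J'(2) by (intro sum_nonneg mult_nonneg_nonneg) (auto intro: less_imp_le)
      then show ?thesis using W by (simp add: powr_divide)
    qed
    finally show ?thesis unfolding eq .
  qed
qed

lemma integrable_mult_if_square_integrable:
  fixes f g :: "'a \<Rightarrow> real"
  assumes [measurable]: "f \<in> borel_measurable M" "g \<in> borel_measurable M"
    and "integrable M (\<lambda>x. (f x)\<^sup>2)" "integrable M (\<lambda>x. (g x)\<^sup>2)"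
  shows "integrable M (\<lambda>x. f x * g x)"
proof (rule Bochner_Integration.integrable_bound[OF Bochner_Integration.integrable_add[OF assms(3,4)]])
  have "\<bar>u * v\<bar> \<le> u\<^sup>2 + v\<^sup>2" for u v :: real
  proof -
    have "2 * \<bar>u * v\<bar> \<le> u\<^sup>2 + v\<^sup>2"
      using sum_squares_bound[of "\<bar>u\<bar>" "\<bar>v\<bar>"] by (simp add: abs_mult mult.assoc)
    then show ?thesis using abs_ge_zero[of "u * v"] by linarith
  qed
  then show "AE x in M. norm (f x * g x) \<le> norm ((f x)\<^sup>2 + (g x)\<^sup>2)" by simp
qed simp

text \<open>Orthogonality of independent centred variables, by adding one variable at a time.\<close>

lemma (in prob_space) second_moment_sum_indep:
  fixes Y :: "'i \<Rightarrow> 'a \<Rightarrow> real"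
  assumes "finite I" "indep_vars (\<lambda>_. borel) Y I"
    and "\<And>i. i \<in> I \<Longrightarrow> integrable M (\<lambda>\<omega>. (Y i \<omega>)\<^sup>2)" "\<And>i. i \<in> I \<Longrightarrow> expectation (Y i) = 0"
  shows "integrable M (\<lambda>\<omega>. (\<Sum>i\<in>I. Y i \<omega>)\<^sup>2) \<and>
    expectation (\<lambda>\<omega>. (\<Sum>i\<in>I. Y i \<omega>)\<^sup>2) = (\<Sum>i\<in>I. expectation (\<lambda>\<omega>. (Y i \<omega>)\<^sup>2))"
  using assms
proof (induction I rule: finite_induct)
  case (insert i I)
  have rv[measurable]: "Y j \<in> borel_measurable M" if "j \<in> insert i I" for j
    using insert.prems(1) that unfolding indep_vars_def2 by auto
  define S where "S \<omega> = (\<Sum>i\<in>I. Y i \<omega>)" for \<omega>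
  have S[measurable]: "S \<in> borel_measurable M" unfolding S_def[abs_def] using rv by (intro borel_measurable_sum) auto
  have Yi[measurable]: "Y i \<in> borel_measurable M" by (rule rv) simp
  have IH: "integrable M (\<lambda>\<omega>. (S \<omega>)\<^sup>2)" "expectation (\<lambda>\<omega>. (S \<omega>)\<^sup>2) = (\<Sum>i\<in>I. expectation (\<lambda>\<omega>. (Y i \<omega>)\<^sup>2))"
    using insert.IH insert.prems indep_vars_subset[OF insert.prems(1), of I] unfolding S_def by auto
  have sq: "integrable M (\<lambda>\<omega>. (Y i \<omega>)\<^sup>2)" by (rule insert.prems) simp
  have iY: "integrable M (Y i)" and iS: "integrable M S"
    by (rule square_integrable_imp_integrable[OF Yi sq], rule square_integrable_imp_integrable[OF S IH(1)])
  have "indep_var borel (Y i) borel S"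
    unfolding S_def by (rule indep_vars_sum) (use insert in auto)
  then have "expectation (\<lambda>\<omega>. Y i \<omega> * S \<omega>) = expectation (Y i) * expectation S"
    using iY iS by (rule indep_var_lebesgue_integral)
  also have "\<dots> = 0" using insert.prems(3)[of i] by simp
  finally have cross: "expectation (\<lambda>\<omega>. Y i \<omega> * S \<omega>) = 0" .
  have icross: "integrable M (\<lambda>\<omega>. Y i \<omega> * S \<omega>)"
    by (rule integrable_mult_if_square_integrable[OF Yi S sq IH(1)])
  have eq: "(\<lambda>\<omega>. (\<Sum>i\<in>insert i I. Y i \<omega>)\<^sup>2) = (\<lambda>\<omega>. (Y i \<omega>)\<^sup>2 + 2 * (Y i \<omega> * S \<omega>) + (S \<omega>)\<^sup>2)"
    using insert.hyps by (simp add: S_def fun_eq_iff power2_sum)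
  show ?case
    unfolding eq using sq icross IH cross insert.hyps by simp
qed simp

text \<open>Clusters are independent as whole vectors; inside a cluster only the joint law of two distinct
  members is prescribed. Since the pair \<open>(j, j')\<close> may be exchanged, this law is
  symmetric.\<close>

locale clustered_sample = prob_space M for M :: "'w measure" +
  fixes m :: "nat \<Rightarrow> nat" and X :: "nat \<Rightarrow> nat \<Rightarrow> 'w \<Rightarrow> 'b::topological_space"
  assumes m_pos: "\<And>i. i \<ge> 1 \<Longrightarrow> m i \<ge> 1"
    and X_rv: "\<And>i j. i \<ge> 1 \<Longrightarrow> j \<in> {1..m i} \<Longrightarrow> X i j \<in> borel_measurable M"
    and X_indep: "indep_vars (\<lambda>i. Pi\<^sub>M {1..m i} (\<lambda>_. borel)) (\<lambda>i \<omega>. \<lambda>j\<in>{1..m i}. X i j \<omega>) {1..}"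
    and X_law: "\<And>i j. i \<ge> 1 \<Longrightarrow> j \<in> {1..m i} \<Longrightarrow> distr M borel (X i j) = distr M borel (X 1 1)"
    and X_pairs: "\<And>i j j'. i \<ge> 1 \<Longrightarrow> j \<in> {1..m i} \<Longrightarrow> j' \<in> {1..m i} \<Longrightarrow> j \<noteq> j' \<Longrightarrow>
                    distr M (borel \<Otimes>\<^sub>M borel) (\<lambda>\<omega>. (X i j \<omega>, X i j' \<omega>)) =
                    distr M (borel \<Otimes>\<^sub>M borel) (\<lambda>\<omega>. (X i 1 \<omega>, X i 2 \<omega>))"
begin

lemma X_rv_11 [measurable]: "X 1 1 \<in> borel_measurable M"
  using m_pos[of 1] by (intro X_rv) auto

lemmas X_rv_Suc [measurable] = X_rv_11[unfolded One_nat_def]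

lemma integrable_X_iff:
  fixes h :: "'b \<Rightarrow> 'c::{banach, second_countable_topology}"
  assumes "h \<in> borel_measurable borel" "i \<ge> 1" "j \<in> {1..m i}"
  shows "integrable M (\<lambda>\<omega>. h (X i j \<omega>)) \<longleftrightarrow> integrable M (\<lambda>\<omega>. h (X 1 1 \<omega>))"
  using integrable_distr_eq[OF X_rv[OF assms(2,3)] assms(1)] integrable_distr_eq[OF X_rv_11 assms(1)]
  unfolding X_law[OF assms(2,3)] by simp

lemma integrable_X:
  fixes h :: "'b \<Rightarrow> 'c::{banach, second_countable_topology}"
  assumes "h \<in> borel_measurable borel" "integrable M (\<lambda>\<omega>. h (X 1 1 \<omega>))" "i \<ge> 1" "j \<in> {1..m i}"
  shows "integrable M (\<lambda>\<omega>. h (X i j \<omega>))"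
  using integrable_X_iff[OF assms(1,3,4)] assms(2) by blast

lemma expectation_X:
  fixes h :: "'b \<Rightarrow> 'c::{banach, second_countable_topology}"
  assumes "h \<in> borel_measurable borel" "i \<ge> 1" "j \<in> {1..m i}"
  shows "(\<integral>\<omega>. h (X i j \<omega>) \<partial>M) = (\<integral>\<omega>. h (X 1 1 \<omega>) \<partial>M)"
  using integral_distr[OF X_rv[OF assms(2,3)] assms(1)] integral_distr[OF X_rv_11 assms(1)]
  unfolding X_law[OF assms(2,3)] by simp

text \<open>For a cluster with a single member there are no distinct \<open>j\<close> and \<open>j'\<close>, so
  index \<open>2\<close> on the right always refers to an existing member.\<close>

lemma expectation_X_pair:
  fixes g h :: "'b \<Rightarrow> real"
  assumes [measurable]: "g \<in> borel_measurable borel" "h \<in> borel_measurable borel"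
    and i: "i \<ge> 1" "j \<in> {1..m i}" "j' \<in> {1..m i}" "j \<noteq> j'"
  shows "(\<integral>\<omega>. g (X i j \<omega>) * h (X i j' \<omega>) \<partial>M) = (\<integral>\<omega>. g (X i 1 \<omega>) * h (X i 2 \<omega>) \<partial>M)"
proof -
  have 12: "1 \<in> {1..m i}" "2 \<in> {1..m i}" using i by auto
  have f: "(\<lambda>(x, y). g x * h y) \<in> borel_measurable (borel \<Otimes>\<^sub>M borel)" by measurable
  have P: "(\<lambda>\<omega>. (X i k \<omega>, X i k' \<omega>)) \<in> M \<rightarrow>\<^sub>M borel \<Otimes>\<^sub>M borel"
    if "k \<in> {1..m i}" "k' \<in> {1..m i}" for k k'
    using X_rv[OF i(1) that(1)] X_rv[OF i(1) that(2)] by (rule measurable_Pair)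
  have "(\<integral>\<omega>. g (X i j \<omega>) * h (X i j' \<omega>) \<partial>M) =
      (\<integral>z. (case z of (x, y) \<Rightarrow> g x * h y) \<partial>distr M (borel \<Otimes>\<^sub>M borel) (\<lambda>\<omega>. (X i j \<omega>, X i j' \<omega>)))"
    by (simp add: integral_distr[OF P[OF i(2,3)] f])
  also have "\<dots> = (\<integral>\<omega>. g (X i 1 \<omega>) * h (X i 2 \<omega>) \<partial>M)"
    unfolding X_pairs[OF i] by (subst integral_distr[OF P[OF 12] f]) simp
  finally show ?thesis .
qed

definition cluster_sum :: "(nat \<Rightarrow> nat \<Rightarrow> real) \<Rightarrow> ('b \<Rightarrow> real) \<Rightarrow> nat \<Rightarrow> 'w \<Rightarrow> real" where
  "cluster_sum a h i \<omega> = (\<Sum>j=1..m i. a i j * h (X i j \<omega>))"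

lemma cluster_sum_rv:
  assumes [measurable]: "h \<in> borel_measurable borel" and i: "i \<ge> 1"
  shows "cluster_sum a h i \<in> borel_measurable M"
proof -
  have "(\<lambda>\<omega>. a i j * h (X i j \<omega>)) \<in> borel_measurable M" if "j \<in> {1..m i}" for j
    using X_rv[OF i that] by measurable
  then show ?thesis unfolding cluster_sum_def[abs_def] by (rule borel_measurable_sum)
qed

lemma indep_cluster_sum:
  assumes [measurable]: "h \<in> borel_measurable borel"
  shows "indep_vars (\<lambda>_. borel) (cluster_sum a h) {1..n}"
proof -
  have "indep_vars (\<lambda>_. borel) (\<lambda>i \<omega>. \<Sum>j=1..m i. a i j * h ((\<lambda>j\<in>{1..m i}. X i j \<omega>) j)) {1..n}"
  proof (rule indep_vars_compose2[where Y = "\<lambda>i x. \<Sum>j=1..m i. a i j * h (x j)"])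
    show "indep_vars (\<lambda>i. Pi\<^sub>M {1..m i} (\<lambda>_. borel)) (\<lambda>i \<omega>. \<lambda>j\<in>{1..m i}. X i j \<omega>) {1..n}"
      by (rule indep_vars_subset[OF X_indep]) auto
    show "(\<lambda>x. \<Sum>j=1..m i. a i j * h (x j)) \<in> borel_measurable (Pi\<^sub>M {1..m i} (\<lambda>_. borel))" for i
    proof (intro borel_measurable_sum borel_measurable_times borel_measurable_const)
      fix j assume "j \<in> {1..m i}"
      then show "(\<lambda>x. h (x j)) \<in> borel_measurable (Pi\<^sub>M {1..m i} (\<lambda>_. borel))"
        by (rule measurable_compose[OF measurable_component_singleton[where M = "\<lambda>_. borel"] assms])
    qed
  qed
  also have "(\<lambda>i \<omega>. \<Sum>j=1..m i. a i j * h ((\<lambda>j\<in>{1..m i}. X i j \<omega>) j)) = cluster_sum a h"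
    unfolding cluster_sum_def[abs_def] by (intro ext sum.cong refl) simp
  finally show ?thesis .
qed

lemma integrable_cluster_sum:
  assumes "h \<in> borel_measurable borel" "integrable M (\<lambda>\<omega>. h (X 1 1 \<omega>))" "i \<ge> 1"
  shows "integrable M (cluster_sum a h i)"
  unfolding cluster_sum_def[abs_def]
  by (intro Bochner_Integration.integrable_sum integrable_mult_right integrable_X[OF assms])

lemma expectation_cluster_sum:
  assumes "h \<in> borel_measurable borel" "integrable M (\<lambda>\<omega>. h (X 1 1 \<omega>))" "i \<ge> 1"
  shows "expectation (cluster_sum a h i) = (\<Sum>j=1..m i. a i j) * (\<integral>\<omega>. h (X 1 1 \<omega>) \<partial>M)"
proof -
  have "expectation (cluster_sum a h i) = (\<Sum>j=1..m i. a i j * (\<integral>\<omega>. h (X i j \<omega>) \<partial>M))"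
    unfolding cluster_sum_def[abs_def]
    by (subst Bochner_Integration.integral_sum)
       (auto intro!: integrable_mult_right integrable_X[OF assms] simp del: One_nat_def)
  also have "\<dots> = (\<Sum>j=1..m i. a i j * (\<integral>\<omega>. h (X 1 1 \<omega>) \<partial>M))"
    by (intro sum.cong refl) (simp only: expectation_X[OF assms(1,3)])
  finally show ?thesis by (simp add: sum_distrib_right)
qed

lemma expectation_abs_cluster_sum_le:
  assumes h: "h \<in> borel_measurable borel" and int: "integrable M (\<lambda>\<omega>. h (X 1 1 \<omega>))" and i: "i \<ge> 1"
    and a: "\<And>j. j \<in> {1..m i} \<Longrightarrow> 0 \<le> a i j"
  shows "expectation (\<lambda>\<omega>. \<bar>cluster_sum a h i \<omega>\<bar>) \<le> (\<Sum>j=1..m i. a i j) * (\<integral>\<omega>. \<bar>h (X 1 1 \<omega>)\<bar> \<partial>M)"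
proof -
  have h': "(\<lambda>x. \<bar>h x\<bar>) \<in> borel_measurable borel" using h by measurable
  have int': "integrable M (\<lambda>\<omega>. \<bar>h (X 1 1 \<omega>)\<bar>)" using int by (rule integrable_abs)
  have "expectation (\<lambda>\<omega>. \<bar>cluster_sum a h i \<omega>\<bar>) \<le> expectation (cluster_sum a (\<lambda>x. \<bar>h x\<bar>) i)"
  proof (intro integral_mono integrable_abs integrable_cluster_sum h h' int int' i)
    fix \<omega>
    have "\<bar>cluster_sum a h i \<omega>\<bar> \<le> (\<Sum>j=1..m i. \<bar>a i j * h (X i j \<omega>)\<bar>)"
      unfolding cluster_sum_def by (rule sum_abs)
    also have "\<dots> = cluster_sum a (\<lambda>x. \<bar>h x\<bar>) i \<omega>"
      unfolding cluster_sum_def by (intro sum.cong refl) (simp add: abs_mult a)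
    finally show "\<bar>cluster_sum a h i \<omega>\<bar> \<le> cluster_sum a (\<lambda>x. \<bar>h x\<bar>) i \<omega>" .
  qed
  also have "\<dots> = (\<Sum>j=1..m i. a i j) * (\<integral>\<omega>. \<bar>h (X 1 1 \<omega>)\<bar> \<partial>M)"
    by (rule expectation_cluster_sum[OF h' int' i])
  finally show ?thesis .
qed

text \<open>Expanding the square leaves diagonal terms, which depend on the marginal law alone, and terms from
  pairs inside the cluster, which all share one covariance.\<close>

lemma square_integrable_cluster_sum:
  assumes h[measurable]: "h \<in> borel_measurable borel" and sq: "integrable M (\<lambda>\<omega>. (h (X 1 1 \<omega>))\<^sup>2)" and i: "i \<ge> 1"
  shows "integrable M (\<lambda>\<omega>. (cluster_sum a h i \<omega>)\<^sup>2)"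
    and "expectation (\<lambda>\<omega>. (cluster_sum a h i \<omega>)\<^sup>2) =
      (\<Sum>j=1..m i. (a i j)\<^sup>2) * (\<integral>\<omega>. (h (X 1 1 \<omega>))\<^sup>2 \<partial>M) +
      (\<Sum>j=1..m i. \<Sum>j'\<in>{1..m i} - {j}. a i j * a i j' * (\<integral>\<omega>. h (X i 1 \<omega>) * h (X i 2 \<omega>) \<partial>M))"
proof -
  let ?s = "\<integral>\<omega>. (h (X 1 1 \<omega>))\<^sup>2 \<partial>M" and ?c = "\<integral>\<omega>. h (X i 1 \<omega>) * h (X i 2 \<omega>) \<partial>M"
  let ?e = "\<lambda>j j'. \<integral>\<omega>. h (X i j \<omega>) * h (X i j' \<omega>) \<partial>M"
  have h2: "(\<lambda>x. (h x)\<^sup>2) \<in> borel_measurable borel" by measurable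
  have sq': "integrable M (\<lambda>\<omega>. (h (X i j \<omega>))\<^sup>2)" if "j \<in> {1..m i}" for j
    using integrable_X_iff[OF h2 i that] sq by simp
  have rv: "(\<lambda>\<omega>. h (X i j \<omega>)) \<in> borel_measurable M" if "j \<in> {1..m i}" for j
    using X_rv[OF i that] by measurable
  have prod: "integrable M (\<lambda>\<omega>. h (X i j \<omega>) * h (X i j' \<omega>))" if "j \<in> {1..m i}" "j' \<in> {1..m i}" for j j'
    by (intro integrable_mult_if_square_integrable rv sq' that)
  have expand: "(cluster_sum a h i \<omega>)\<^sup>2 =
      (\<Sum>j=1..m i. \<Sum>j'=1..m i. a i j * a i j' * (h (X i j \<omega>) * h (X i j' \<omega>)))" for \<omega>
    by (simp add: cluster_sum_def power2_eq_square sum_product mult_ac)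
  have int: "integrable M (\<lambda>\<omega>. a i j * a i j' * (h (X i j \<omega>) * h (X i j' \<omega>)))"
    if "j \<in> {1..m i}" "j' \<in> {1..m i}" for j j' using prod[OF that] by simp
  show "integrable M (\<lambda>\<omega>. (cluster_sum a h i \<omega>)\<^sup>2)"
    unfolding expand by (intro Bochner_Integration.integrable_sum int)
  have "expectation (\<lambda>\<omega>. (cluster_sum a h i \<omega>)\<^sup>2) =
      (\<Sum>j=1..m i. \<Sum>j'=1..m i. a i j * a i j' * ?e j j')"
    unfolding expand using int
    by (subst Bochner_Integration.integral_sum, intro Bochner_Integration.integrable_sum, simp)
       (intro sum.cong refl, subst Bochner_Integration.integral_sum, auto)
  also have "\<dots> = (\<Sum>j=1..m i. (a i j)\<^sup>2 * ?s +
      (\<Sum>j'\<in>{1..m i} - {j}. a i j * a i j' * ?c))"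
  proof (intro sum.cong refl)
    fix j assume j: "j \<in> {1..m i}"
    have "?e j j = ?s"
      using expectation_X[OF h2 i j] by (simp add: power2_eq_square)
    moreover have "(\<Sum>j'\<in>{1..m i} - {j}. a i j * a i j' * ?e j j') =
        (\<Sum>j'\<in>{1..m i} - {j}. a i j * a i j' * ?c)"
    proof (intro sum.cong refl)
      fix j' assume "j' \<in> {1..m i} - {j}"
      then have "?e j j' = ?c"
        by (intro expectation_X_pair h i j) auto
      then show "a i j * a i j' * ?e j j' =
        a i j * a i j' * ?c" by simp
    qed
    ultimately show "(\<Sum>j'=1..m i. a i j * a i j' * ?e j j') =
      (a i j)\<^sup>2 * ?s +
      (\<Sum>j'\<in>{1..m i} - {j}. a i j * a i j' * ?c)"
      by (subst sum.remove[OF finite_atLeastAtMost j]) (simp add: power2_eq_square)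
  qed
  finally show "expectation (\<lambda>\<omega>. (cluster_sum a h i \<omega>)\<^sup>2) =
      (\<Sum>j=1..m i. (a i j)\<^sup>2) * ?s +
      (\<Sum>j=1..m i. \<Sum>j'\<in>{1..m i} - {j}. a i j * a i j' * ?c)"
    by (simp add: sum.distrib sum_distrib_right)
qed

text \<open>Valid under arbitrary dependence inside the cluster, since it rests on a pointwise convexity bound.\<close>

lemma powr_moment_cluster_sum:
  assumes h[measurable]: "h \<in> borel_measurable borel" and int: "integrable M (\<lambda>\<omega>. \<bar>h (X 1 1 \<omega>)\<bar> powr p)"
    and i: "i \<ge> 1" and a: "\<And>j. j \<in> {1..m i} \<Longrightarrow> 0 < a i j" and p: "1 \<le> p"
  shows "integrable M (\<lambda>\<omega>. \<bar>cluster_sum a h i \<omega>\<bar> powr p)"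
    and "expectation (\<lambda>\<omega>. \<bar>cluster_sum a h i \<omega>\<bar> powr p) \<le>
      (\<Sum>j=1..m i. a i j) powr p * (\<integral>\<omega>. \<bar>h (X 1 1 \<omega>)\<bar> powr p \<partial>M)"
proof -
  let ?W = "\<Sum>j=1..m i. a i j"
  let ?g = "\<lambda>x. \<bar>h x\<bar> powr p"
  have g: "?g \<in> borel_measurable borel" by measurable
  have W: "0 < ?W" using m_pos[OF i] a by (intro sum_pos) auto
  have bound: "\<bar>cluster_sum a h i \<omega>\<bar> powr p \<le> ?W powr (p - 1) * cluster_sum a ?g i \<omega>" for \<omega>
  proof -
    have "\<bar>cluster_sum a h i \<omega>\<bar> \<le> (\<Sum>j=1..m i. \<bar>a i j * h (X i j \<omega>)\<bar>)"
      unfolding cluster_sum_def by (rule sum_abs)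
    also have "\<dots> = (\<Sum>j=1..m i. a i j * \<bar>h (X i j \<omega>)\<bar>)"
      by (intro sum.cong refl) (simp add: abs_mult a less_imp_le)
    finally have "\<bar>cluster_sum a h i \<omega>\<bar> powr p \<le> (\<Sum>j=1..m i. a i j * \<bar>h (X i j \<omega>)\<bar>) powr p"
      using p by (intro powr_mono2) auto
    also have "\<dots> \<le> ?W powr (p - 1) * (\<Sum>j=1..m i. a i j * ?g (X i j \<omega>))"
      by (rule powr_weighted_sum_le) (use a p in auto)
    finally show ?thesis unfolding cluster_sum_def .
  qed
  have ig: "integrable M (\<lambda>\<omega>. ?W powr (p - 1) * cluster_sum a ?g i \<omega>)"
    by (intro integrable_mult_right integrable_cluster_sum g int i)
  note [measurable] = cluster_sum_rv[OF h i]
  show int': "integrable M (\<lambda>\<omega>. \<bar>cluster_sum a h i \<omega>\<bar> powr p)"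
  proof (rule Bochner_Integration.integrable_bound[OF ig])
    show "AE \<omega> in M. norm (\<bar>cluster_sum a h i \<omega>\<bar> powr p) \<le> norm (?W powr (p - 1) * cluster_sum a ?g i \<omega>)"
      by (intro AE_I2) (use order_trans[OF bound abs_ge_self] in simp)
  qed measurable
  have "expectation (\<lambda>\<omega>. \<bar>cluster_sum a h i \<omega>\<bar> powr p) \<le> expectation (\<lambda>\<omega>. ?W powr (p - 1) * cluster_sum a ?g i \<omega>)"
    by (intro integral_mono int' ig bound)
  also have "\<dots> = ?W powr (p - 1) * (?W * (\<integral>\<omega>. ?g (X 1 1 \<omega>) \<partial>M))"
    using expectation_cluster_sum[OF g int i, of a] by simp
  also have "\<dots> = ?W powr p * (\<integral>\<omega>. ?g (X 1 1 \<omega>) \<partial>M)"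
    using W by (simp add: powr_diff)
  finally show "expectation (\<lambda>\<omega>. \<bar>cluster_sum a h i \<omega>\<bar> powr p) \<le> ?W powr p * (\<integral>\<omega>. ?g (X 1 1 \<omega>) \<partial>M)" .
qed

text \<open>The Lyapunov theorem applied to the independent cluster sums with weights \<open>w i j / sqrt (N
  n)\<close>.\<close>

theorem cluster_central_limit:
  fixes h :: "'b \<Rightarrow> real" and w :: "nat \<Rightarrow> nat \<Rightarrow> real" and N :: "nat \<Rightarrow> real"
  assumes h[measurable]: "h \<in> borel_measurable borel" and mean: "(\<integral>\<omega>. h (X 1 1 \<omega>) \<partial>M) = 0"
    and eta: "0 < \<eta>" and mom: "integrable M (\<lambda>\<omega>. \<bar>h (X 1 1 \<omega>)\<bar> powr (2 + \<eta>))"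
    and w: "\<And>i j. i \<ge> 1 \<Longrightarrow> j \<in> {1..m i} \<Longrightarrow> 0 < w i j" and N: "\<And>n. n \<ge> 1 \<Longrightarrow> 0 < N n"
    and var: "(\<lambda>n. (1 / N n) * (\<Sum>i=1..n. \<Sum>j=1..m i. (w i j)\<^sup>2) * (\<integral>\<omega>. (h (X 1 1 \<omega>))\<^sup>2 \<partial>M) +
        (1 / N n) * (\<Sum>i=1..n. \<Sum>j=1..m i. \<Sum>j'\<in>{1..m i} - {j}.
          w i j * w i j' * (\<integral>\<omega>. h (X i 1 \<omega>) * h (X i 2 \<omega>) \<partial>M))) \<longlonglongrightarrow> v"
    and lya: "(\<lambda>n. (1 / N n powr (1 + \<eta> / 2)) * (\<Sum>i=1..n. (\<Sum>j=1..m i. w i j) powr (2 + \<eta>))) \<longlonglongrightarrow> 0"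
  defines "S \<equiv> \<lambda>n \<omega>. (1 / sqrt (N n)) * (\<Sum>i=1..n. cluster_sum w h i \<omega>)"
  shows "(\<lambda>n. CLINT \<omega>|M. iexp (S n \<omega>)) \<longlonglongrightarrow> exp (- v / 2)"
    and "integrable M (\<lambda>\<omega>. (S n \<omega>)\<^sup>2)"
    and "(\<lambda>n. expectation (\<lambda>\<omega>. (S n \<omega>)\<^sup>2)) \<longlonglongrightarrow> v"
proof -
  define a where "a n i j = w i j / sqrt (N n)" for n i j
  define \<xi> where "\<xi> n = cluster_sum (a n) h" for n
  define b where "b n i = expectation (\<lambda>\<omega>. \<bar>\<xi> n i \<omega>\<bar> powr (2 + \<eta>))" for n i
  let ?s = "\<integral>\<omega>. (h (X 1 1 \<omega>))\<^sup>2 \<partial>M" and ?c = "\<lambda>i. \<integral>\<omega>. h (X i 1 \<omega>) * h (X i 2 \<omega>) \<partial>M"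
  let ?\<mu> = "\<integral>\<omega>. \<bar>h (X 1 1 \<omega>)\<bar> powr (2 + \<eta>) \<partial>M"
  let ?N = "\<lambda>n. 1 / N n powr (1 + \<eta> / 2)" and ?W = "\<lambda>i. (\<Sum>j=1..m i. w i j) powr (2 + \<eta>)"
  have S: "S n \<omega> = (\<Sum>i=1..n. \<xi> n i \<omega>)" for n \<omega>
    by (simp add: S_def \<xi>_def cluster_sum_def a_def sum_distrib_left)
  have apos: "0 < a n i j" if "i \<in> {1..n}" "j \<in> {1..m i}" for n i j
    using that w[of i j] N[of n] by (simp add: a_def)
  have sqh: "integrable M (\<lambda>\<omega>. (h (X 1 1 \<omega>))\<^sup>2)"
  proof (rule Bochner_Integration.integrable_bound[OF Bochner_Integration.integrable_add[OF integrable_const[of 1] mom]])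
    show "AE \<omega> in M. norm ((h (X 1 1 \<omega>))\<^sup>2) \<le> norm (1 + \<bar>h (X 1 1 \<omega>)\<bar> powr (2 + \<eta>))"
    proof (intro AE_I2)
      fix \<omega>
      have "x\<^sup>2 \<le> 1\<^sup>2 + \<bar>x\<bar> powr (2 + \<eta>) / 1 powr \<eta>" for x
        by (rule lyapunov_truncation(2)) (use eta in auto)
      then show "norm ((h (X 1 1 \<omega>))\<^sup>2) \<le> norm (1 + \<bar>h (X 1 1 \<omega>)\<bar> powr (2 + \<eta>))" by simp
    qed
  qed measurable
  have inth: "integrable M (\<lambda>\<omega>. h (X 1 1 \<omega>))"
    by (rule square_integrable_imp_integrable[OF _ sqh]) measurable
  have indep: "indep_vars (\<lambda>_. borel) (\<xi> n) {1..n}" for n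
    unfolding \<xi>_def by (rule indep_cluster_sum[OF h])
  have sq: "integrable M (\<lambda>\<omega>. (\<xi> n i \<omega>)\<^sup>2)" if "i \<in> {1..n}" for n i
    unfolding \<xi>_def by (rule square_integrable_cluster_sum(1)[OF h sqh]) (use that in simp)
  have mean0: "expectation (\<xi> n i) = 0" if "i \<in> {1..n}" for n i
    unfolding \<xi>_def using expectation_cluster_sum[OF h inth, of i "a n"] that mean by simp
  have Esq: "(\<Sum>i=1..n. expectation (\<lambda>\<omega>. (\<xi> n i \<omega>)\<^sup>2)) =
      (1 / N n) * (\<Sum>i=1..n. \<Sum>j=1..m i. (w i j)\<^sup>2) * ?s +
      (1 / N n) * (\<Sum>i=1..n. \<Sum>j=1..m i. \<Sum>j'\<in>{1..m i} - {j}.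
        w i j * w i j' * ?c i)" for n
  proof -
    have "expectation (\<lambda>\<omega>. (\<xi> n i \<omega>)\<^sup>2) =
      (1 / N n) * (\<Sum>j=1..m i. (w i j)\<^sup>2) * ?s +
      (1 / N n) * (\<Sum>j=1..m i. \<Sum>j'\<in>{1..m i} - {j}.
        w i j * w i j' * ?c i)" if i: "i \<in> {1..n}" for i
    proof -
      have "0 < N n" using i by (intro N) auto
      then have aa: "a n i j * a n i j' = (1 / N n) * (w i j * w i j')" for j j'
        by (simp add: a_def)
      then have a2: "(a n i j)\<^sup>2 = (1 / N n) * (w i j)\<^sup>2" for j by (simp add: power2_eq_square)
      have "1 \<le> i" using i by simp
      from square_integrable_cluster_sum(2)[OF h sqh this, of "a n"] show ?thesis
        unfolding \<xi>_def a2 aa by (simp only: sum_distrib_left mult.assoc)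
    qed
    then have "(\<Sum>i=1..n. expectation (\<lambda>\<omega>. (\<xi> n i \<omega>)\<^sup>2)) = (\<Sum>i=1..n.
      (1 / N n) * (\<Sum>j=1..m i. (w i j)\<^sup>2) * ?s +
      (1 / N n) * (\<Sum>j=1..m i. \<Sum>j'\<in>{1..m i} - {j}.
        w i j * w i j' * ?c i))" by (rule sum.cong[OF refl])
    then show ?thesis by (simp only: sum.distrib sum_distrib_left[symmetric] sum_distrib_right[symmetric])
  qed
  have momx: "integrable M (\<lambda>\<omega>. \<bar>\<xi> n i \<omega>\<bar> powr (2 + \<eta>))"
    "b n i \<le>
      ?N n * ?W i * ?\<mu>"
    if i: "i \<in> {1..n}" for n i
  proof -
    have i1: "1 \<le> i" and Nn: "0 < N n" using i N by auto
    have p: "1 \<le> 2 + \<eta>" using eta by simp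
    show "integrable M (\<lambda>\<omega>. \<bar>\<xi> n i \<omega>\<bar> powr (2 + \<eta>))"
      unfolding \<xi>_def by (rule powr_moment_cluster_sum(1)[OF h mom i1 _ p, where a = "a n"], rule apos[OF i])
    have "(\<Sum>j=1..m i. a n i j) = (\<Sum>j=1..m i. w i j) / sqrt (N n)"
      by (simp add: a_def sum_divide_distrib)
    moreover have "0 \<le> (\<Sum>j=1..m i. w i j)" using w[OF i1] by (intro sum_nonneg) (auto intro: less_imp_le)
    moreover have "sqrt (N n) powr (2 + \<eta>) = N n powr (1 + \<eta> / 2)"
      using Nn by (simp add: powr_powr flip: powr_half_sqrt) (simp add: add_divide_distrib)
    ultimately have "(\<Sum>j=1..m i. a n i j) powr (2 + \<eta>) = ?N n * ?W i"
      using Nn by (simp add: powr_divide)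
    with powr_moment_cluster_sum(2)[OF h mom i1 _ p, where a = "a n"] apos[OF i]
    show "b n i \<le>
      ?N n * ?W i * ?\<mu>"
      by (simp add: \<xi>_def b_def)
  qed
  have lya': "(\<lambda>n. \<Sum>i=1..n. b n i) \<longlonglongrightarrow> 0"
  proof (rule tendsto_sandwich[OF _ _ tendsto_const])
    show "(\<lambda>n. (?N n * (\<Sum>i=1..n. ?W i)) *
        ?\<mu>) \<longlonglongrightarrow> 0"
      by (rule tendsto_mult_left_zero[OF lya])
    show "\<forall>\<^sub>F n in sequentially. (\<Sum>i=1..n. b n i) \<le>
      (?N n * (\<Sum>i=1..n. ?W i)) *
        ?\<mu>"
    proof (intro always_eventually allI)
      fix n
      have "(\<Sum>i=1..n. b n i) \<le>
        (\<Sum>i=1..n. ?N n * ?W i * ?\<mu>)"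
        by (rule sum_mono) (rule momx(2))
      then show "(\<Sum>i=1..n. b n i) \<le>
        (?N n * (\<Sum>i=1..n. ?W i)) *
        ?\<mu>"
        by (simp only: sum_distrib_left[symmetric] sum_distrib_right[symmetric])
    qed
    show "\<forall>\<^sub>F n in sequentially. 0 \<le> (\<Sum>i=1..n. b n i)"
      unfolding b_def by (intro always_eventually allI sum_nonneg integral_nonneg_AE AE_I2) simp
  qed
  have var': "(\<lambda>n. \<Sum>i=1..n. expectation (\<lambda>\<omega>. (\<xi> n i \<omega>)\<^sup>2)) \<longlonglongrightarrow> v"
    unfolding Esq by (rule var)
  show "(\<lambda>n. CLINT \<omega>|M. iexp (S n \<omega>)) \<longlonglongrightarrow> exp (- v / 2)"
    unfolding S by (rule lyapunov_central_limit[OF indep sq mean0 var' eta momx(1) lya'[unfolded b_def]])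
  have S2: "integrable M (\<lambda>\<omega>. (S n \<omega>)\<^sup>2) \<and>
      expectation (\<lambda>\<omega>. (S n \<omega>)\<^sup>2) = (\<Sum>i=1..n. expectation (\<lambda>\<omega>. (\<xi> n i \<omega>)\<^sup>2))" for n
    unfolding S by (rule second_moment_sum_indep[OF finite_atLeastAtMost indep sq mean0])
  then show "integrable M (\<lambda>\<omega>. (S n \<omega>)\<^sup>2)" by blast
  show "(\<lambda>n. expectation (\<lambda>\<omega>. (S n \<omega>)\<^sup>2)) \<longlonglongrightarrow> v"
    using var' S2 by simp
qed

section \<open>A weighted law of large numbers for clusters\<close>

text \<open>The first moment is estimated by the second through \<open>\<bar>t\<bar> \<le> e + t\<^sup>2 /
  e\<close>, and the variance of a cluster sum by the square of its largest possible value.\<close>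

lemma expectation_abs_sum_le_variance:
  fixes h :: "'b \<Rightarrow> real"
  assumes h[measurable]: "h \<in> borel_measurable borel" and bounded: "\<And>x. \<bar>h x\<bar> \<le> K"
    and mean: "(\<integral>\<omega>. h (X 1 1 \<omega>) \<partial>M) = 0"
    and a: "\<And>i j. i \<ge> 1 \<Longrightarrow> j \<in> {1..m i} \<Longrightarrow> 0 < a i j" and e: "0 < e"
  shows "expectation (\<lambda>\<omega>. \<bar>\<Sum>i=1..n. cluster_sum a h i \<omega>\<bar>) \<le> e + K\<^sup>2 * (\<Sum>i=1..n. (\<Sum>j=1..m i. a i j)\<^sup>2) / e"
proof -
  let ?S = "\<lambda>\<omega>. \<Sum>i=1..n. cluster_sum a h i \<omega>"
  let ?A = "\<lambda>i. \<Sum>j=1..m i. a i j"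
  have int: "integrable M (\<lambda>\<omega>. h (X 1 1 \<omega>))"
    by (rule integrable_const_bound[of _ K]) (use bounded in auto)
  have sqb: "(h x)\<^sup>2 \<le> K\<^sup>2" for x
    using power_mono[OF bounded[of x] abs_ge_zero, of 2] by simp
  have sq: "integrable M (\<lambda>\<omega>. (h (X 1 1 \<omega>))\<^sup>2)"
    by (rule integrable_const_bound[of _ "K\<^sup>2"]) (use sqb in auto)
  have cs_sq: "integrable M (\<lambda>\<omega>. (cluster_sum a h i \<omega>)\<^sup>2)" if "i \<in> {1..n}" for i
    using that by (intro square_integrable_cluster_sum(1) h sq) auto
  have S2: "integrable M (\<lambda>\<omega>. (?S \<omega>)\<^sup>2)"
    "expectation (\<lambda>\<omega>. (?S \<omega>)\<^sup>2) = (\<Sum>i=1..n. expectation (\<lambda>\<omega>. (cluster_sum a h i \<omega>)\<^sup>2))"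
    using second_moment_sum_indep[OF _ indep_cluster_sum[OF h], of n a] cs_sq
      expectation_cluster_sum[OF h int] mean by auto
  have iS: "integrable M ?S"
    by (intro Bochner_Integration.integrable_sum integrable_cluster_sum h int) auto
  have "expectation (\<lambda>\<omega>. (cluster_sum a h i \<omega>)\<^sup>2) \<le> K\<^sup>2 * (?A i)\<^sup>2" if i: "i \<in> {1..n}" for i
  proof -
    have "(cluster_sum a h i \<omega>)\<^sup>2 \<le> K\<^sup>2 * (?A i)\<^sup>2" for \<omega>
    proof -
      have "\<bar>cluster_sum a h i \<omega>\<bar> \<le> (\<Sum>j=1..m i. \<bar>a i j * h (X i j \<omega>)\<bar>)"
        unfolding cluster_sum_def by (rule sum_abs)
      also have "\<dots> \<le> (\<Sum>j=1..m i. a i j * K)"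
      proof (rule sum_mono)
        fix j assume "j \<in> {1..m i}"
        then have "0 < a i j" using a i by auto
        then show "\<bar>a i j * h (X i j \<omega>)\<bar> \<le> a i j * K"
          using mult_left_mono[OF bounded[of "X i j \<omega>"], of "a i j"] by (simp add: abs_mult)
      qed
      also have "\<dots> = K * ?A i" by (simp add: sum_distrib_left mult.commute)
      finally show ?thesis using power_mono[of "\<bar>cluster_sum a h i \<omega>\<bar>" "K * ?A i" 2]
        by (simp add: power_mult_distrib)
    qed
    then have "expectation (\<lambda>\<omega>. (cluster_sum a h i \<omega>)\<^sup>2) \<le> expectation (\<lambda>\<omega>. K\<^sup>2 * (?A i)\<^sup>2)"
      by (intro integral_mono cs_sq i) auto
    then show ?thesis by (simp add: prob_space)
  qed
  then have ES2: "expectation (\<lambda>\<omega>. (?S \<omega>)\<^sup>2) \<le> K\<^sup>2 * (\<Sum>i=1..n. (?A i)\<^sup>2)"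
    unfolding S2(2) sum_distrib_left by (rule sum_mono)
  have "expectation (\<lambda>\<omega>. \<bar>?S \<omega>\<bar>) \<le> expectation (\<lambda>\<omega>. e + (?S \<omega>)\<^sup>2 / e)"
  proof (rule integral_mono)
    fix \<omega>
    have "\<bar>t\<bar> \<le> e + t\<^sup>2 / e" for t :: real
    proof -
      have "2 * (\<bar>t\<bar> * e) \<le> t\<^sup>2 + e * e"
        using sum_squares_bound[of "\<bar>t\<bar>" e] by (simp add: power2_eq_square mult.assoc)
      moreover have "0 \<le> \<bar>t\<bar> * e" using e by simp
      ultimately have "\<bar>t\<bar> * e \<le> t\<^sup>2 + e * e" by linarith
      then show ?thesis using e by (simp add: field_simps)
    qed
    then show "\<bar>?S \<omega>\<bar> \<le> e + (?S \<omega>)\<^sup>2 / e" .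
  qed (use iS S2(1) in auto)
  also have "\<dots> = e + expectation (\<lambda>\<omega>. (?S \<omega>)\<^sup>2) / e"
    using S2(1) by (simp add: prob_space)
  also have "\<dots> \<le> e + K\<^sup>2 * (\<Sum>i=1..n. (?A i)\<^sup>2) / e"
    using ES2 e by (intro add_left_mono divide_right_mono) auto
  finally show ?thesis .
qed

text \<open>A bound in mean that uses no cancellation; it serves for the unbounded remainder of a truncation.\<close>

lemma expectation_abs_sum_le:
  fixes h :: "'b \<Rightarrow> real"
  assumes h: "h \<in> borel_measurable borel" and int: "integrable M (\<lambda>\<omega>. h (X 1 1 \<omega>))"
    and a: "\<And>i j. i \<ge> 1 \<Longrightarrow> j \<in> {1..m i} \<Longrightarrow> 0 < a i j"
  shows "expectation (\<lambda>\<omega>. \<bar>\<Sum>i=1..n. cluster_sum a h i \<omega>\<bar>) \<le>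
    (\<Sum>i=1..n. \<Sum>j=1..m i. a i j) * (\<integral>\<omega>. \<bar>h (X 1 1 \<omega>)\<bar> \<partial>M)"
proof -
  have ic: "integrable M (cluster_sum a h i)" if "i \<in> {1..n}" for i
    using that by (intro integrable_cluster_sum h int) auto
  have "expectation (\<lambda>\<omega>. \<bar>\<Sum>i=1..n. cluster_sum a h i \<omega>\<bar>) \<le> expectation (\<lambda>\<omega>. \<Sum>i=1..n. \<bar>cluster_sum a h i \<omega>\<bar>)"
    by (intro integral_mono integrable_abs Bochner_Integration.integrable_sum ic sum_abs)
  also have "\<dots> = (\<Sum>i=1..n. expectation (\<lambda>\<omega>. \<bar>cluster_sum a h i \<omega>\<bar>))"
    by (intro Bochner_Integration.integral_sum integrable_abs ic)
  also have "\<dots> \<le> (\<Sum>i=1..n. (\<Sum>j=1..m i. a i j) * (\<integral>\<omega>. \<bar>h (X 1 1 \<omega>)\<bar> \<partial>M))"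
    by (intro sum_mono expectation_abs_cluster_sum_le h int) (use a in \<open>auto intro: less_imp_le\<close>)
  finally show ?thesis by (simp add: sum_distrib_right)
qed

lemma truncation_error_small:
  fixes h :: "'b \<Rightarrow> real"
  assumes [measurable]: "h \<in> borel_measurable borel" and int: "integrable M (\<lambda>\<omega>. h (X 1 1 \<omega>))" and e: "0 < e"
  obtains K :: nat where "(\<integral>\<omega>. \<bar>h (X 1 1 \<omega>) - (if \<bar>h (X 1 1 \<omega>)\<bar> \<le> real K then h (X 1 1 \<omega>) else 0)\<bar> \<partial>M) < e"
proof -
  let ?d = "\<lambda>K \<omega>. \<bar>h (X 1 1 \<omega>) - (if \<bar>h (X 1 1 \<omega>)\<bar> \<le> real K then h (X 1 1 \<omega>) else 0)\<bar>"
  have "(\<lambda>K. \<integral>\<omega>. ?d K \<omega> \<partial>M) \<longlonglongrightarrow> (\<integral>\<omega>. 0 \<partial>M)"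
  proof (rule integral_dominated_convergence[where w = "\<lambda>\<omega>. \<bar>h (X 1 1 \<omega>)\<bar>"])
    show "AE \<omega> in M. (\<lambda>K. ?d K \<omega>) \<longlonglongrightarrow> 0"
    proof (intro AE_I2)
      fix \<omega>
      have "\<forall>\<^sub>F K in sequentially. ?d K \<omega> = 0"
        using eventually_ge_at_top[of "nat \<lceil>\<bar>h (X 1 1 \<omega>)\<bar>\<rceil>"]
      proof eventually_elim
        case (elim K)
        then have "\<bar>h (X 1 1 \<omega>)\<bar> \<le> real K"
          using real_nat_ceiling_ge[of "\<bar>h (X 1 1 \<omega>)\<bar>"] by linarith
        then show ?case by simp
      qed
      then show "(\<lambda>K. ?d K \<omega>) \<longlonglongrightarrow> 0"
        by (rule tendsto_eventually)
    qed
  qed (use int in auto)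
  then have "\<forall>\<^sub>F K in sequentially. (\<integral>\<omega>. ?d K \<omega> \<partial>M) < e"
    by (intro order_tendstoD(2)) (use e in auto)
  then show ?thesis using that by (auto simp: eventually_sequentially)
qed

text \<open>Split \<open>h\<close> into a bounded part \<open>f\<close> and a remainder \<open>g\<close> that is
  small in mean, and centre both. The centred \<open>f\<close> is handled by its variance, the centred
  \<open>g\<close> by the triangle inequality. What is left over is the mean of \<open>h\<close> times
  the deviation of the total weight from one.\<close>

theorem weighted_law_of_large_numbers:
  fixes h :: "'b \<Rightarrow> real" and a :: "nat \<Rightarrow> nat \<Rightarrow> nat \<Rightarrow> real"
  assumes h[measurable]: "h \<in> borel_measurable borel" and int: "integrable M (\<lambda>\<omega>. h (X 1 1 \<omega>))"
    and a: "\<And>n i j. n \<ge> 1 \<Longrightarrow> i \<ge> 1 \<Longrightarrow> j \<in> {1..m i} \<Longrightarrow> 0 < a n i j"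
    and total: "(\<lambda>n. \<Sum>i=1..n. \<Sum>j=1..m i. a n i j) \<longlonglongrightarrow> 1"
    and negligible: "(\<lambda>n. \<Sum>i=1..n. (\<Sum>j=1..m i. a n i j)\<^sup>2) \<longlonglongrightarrow> 0"
  shows "(\<lambda>n. expectation (\<lambda>\<omega>. \<bar>(\<Sum>i=1..n. cluster_sum (a n) h i \<omega>) - (\<integral>\<omega>. h (X 1 1 \<omega>) \<partial>M)\<bar>)) \<longlonglongrightarrow> 0"
proof (rule tendsto_normI)
  fix r :: real assume r: "0 < r"
  define e where "e = r / 4"
  have e: "0 < e" "3 * e < r" using r by (simp_all add: e_def)
  define c where "c = (\<integral>\<omega>. h (X 1 1 \<omega>) \<partial>M)"
  define T where "T n = (\<Sum>i=1..n. \<Sum>j=1..m i. a n i j)" for n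
  define Q where "Q n = (\<Sum>i=1..n. (\<Sum>j=1..m i. a n i j)\<^sup>2)" for n
  obtain K :: nat where K: "(\<integral>\<omega>. \<bar>h (X 1 1 \<omega>) - (if \<bar>h (X 1 1 \<omega>)\<bar> \<le> real K then h (X 1 1 \<omega>) else 0)\<bar> \<partial>M) < e"
    using truncation_error_small[OF h int e(1)] by blast
  define f where "f x = (if \<bar>h x\<bar> \<le> real K then h x else 0)" for x
  define g where "g x = h x - f x" for x
  have f[measurable]: "f \<in> borel_measurable borel" unfolding f_def[abs_def] by measurable
  have g[measurable]: "g \<in> borel_measurable borel" unfolding g_def[abs_def] by measurable
  have fK: "\<bar>f x\<bar> \<le> K" for x by (simp add: f_def)
  have intf: "integrable M (\<lambda>\<omega>. f (X 1 1 \<omega>))"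
    by (rule integrable_const_bound[of _ K]) (use fK in auto)
  have intg: "integrable M (\<lambda>\<omega>. g (X 1 1 \<omega>))" unfolding g_def using int intf by simp
  define cf where "cf = (\<integral>\<omega>. f (X 1 1 \<omega>) \<partial>M)"
  define cg where "cg = (\<integral>\<omega>. g (X 1 1 \<omega>) \<partial>M)"
  define f0 where "f0 x = f x - cf" for x
  define g0 where "g0 x = g x - cg" for x
  have f0[measurable]: "f0 \<in> borel_measurable borel" unfolding f0_def[abs_def] by measurable
  have g0[measurable]: "g0 \<in> borel_measurable borel" unfolding g0_def[abs_def] by measurable
  have c: "c = cf + cg" unfolding c_def cf_def cg_def g_def using int intf by simp
  have cfK: "\<bar>cf\<bar> \<le> K"
  proof -
    have "\<bar>cf\<bar> \<le> (\<integral>\<omega>. \<bar>f (X 1 1 \<omega>)\<bar> \<partial>M)" unfolding cf_def by (rule integral_abs_bound)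
    also have "\<dots> \<le> (\<integral>\<omega>. real K \<partial>M)" using intf fK by (intro integral_mono) auto
    finally show ?thesis by (simp add: prob_space)
  qed
  have f0K: "\<bar>f0 x\<bar> \<le> 2 * real K" for x using fK[of x] cfK unfolding f0_def by linarith
  have f0_mean: "(\<integral>\<omega>. f0 (X 1 1 \<omega>) \<partial>M) = 0" unfolding f0_def using intf by (simp add: prob_space cf_def)
  have intg0: "integrable M (\<lambda>\<omega>. g0 (X 1 1 \<omega>))" unfolding g0_def using intg by simp
  have intf0: "integrable M (\<lambda>\<omega>. f0 (X 1 1 \<omega>))" unfolding f0_def using intf by simp
  have Eg: "(\<integral>\<omega>. \<bar>g (X 1 1 \<omega>)\<bar> \<partial>M) < e" using K by (simp only: g_def f_def)
  have Eg0: "(\<integral>\<omega>. \<bar>g0 (X 1 1 \<omega>)\<bar> \<partial>M) \<le> 2 * e"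
  proof -
    have "\<bar>cg\<bar> \<le> (\<integral>\<omega>. \<bar>g (X 1 1 \<omega>)\<bar> \<partial>M)" unfolding cg_def by (rule integral_abs_bound)
    moreover have "(\<integral>\<omega>. \<bar>g0 (X 1 1 \<omega>)\<bar> \<partial>M) \<le> (\<integral>\<omega>. \<bar>g (X 1 1 \<omega>)\<bar> + \<bar>cg\<bar> \<partial>M)"
      unfolding g0_def using intg by (intro integral_mono) auto
    moreover have "(\<integral>\<omega>. \<bar>g (X 1 1 \<omega>)\<bar> + \<bar>cg\<bar> \<partial>M) = (\<integral>\<omega>. \<bar>g (X 1 1 \<omega>)\<bar> \<partial>M) + \<bar>cg\<bar>"
      using intg by (simp add: prob_space)
    ultimately show ?thesis using Eg by linarith
  qed
  have cs_int: "integrable M (\<lambda>\<omega>. \<Sum>i=1..n. cluster_sum (a n) u i \<omega>)"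
    if "u \<in> borel_measurable borel" "integrable M (\<lambda>\<omega>. u (X 1 1 \<omega>))" for u n
    by (intro Bochner_Integration.integrable_sum integrable_cluster_sum that) auto
  have bound: "expectation (\<lambda>\<omega>. \<bar>(\<Sum>i=1..n. cluster_sum (a n) h i \<omega>) - c\<bar>) \<le>
      (e + (2 * real K)\<^sup>2 * Q n / e) + T n * (2 * e) + \<bar>c\<bar> * \<bar>T n - 1\<bar>" if n: "n \<ge> 1" for n
  proof -
    let ?F = "\<lambda>\<omega>. \<Sum>i=1..n. cluster_sum (a n) f0 i \<omega>" and ?G = "\<lambda>\<omega>. \<Sum>i=1..n. cluster_sum (a n) g0 i \<omega>"
    have split: "(\<Sum>i=1..n. cluster_sum (a n) h i \<omega>) - c = ?F \<omega> + ?G \<omega> + c * (T n - 1)" for \<omega>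
    proof -
      have "cluster_sum (a n) h i \<omega> = cluster_sum (a n) f0 i \<omega> + cluster_sum (a n) g0 i \<omega> + c * (\<Sum>j=1..m i. a n i j)" for i
        unfolding cluster_sum_def sum_distrib_left sum.distrib[symmetric]
        by (intro sum.cong refl) (simp add: f0_def g0_def g_def c algebra_simps)
      then show ?thesis by (simp add: sum.distrib T_def algebra_simps flip: sum_distrib_left)
    qed
    have "expectation (\<lambda>\<omega>. \<bar>(\<Sum>i=1..n. cluster_sum (a n) h i \<omega>) - c\<bar>) \<le>
        expectation (\<lambda>\<omega>. \<bar>?F \<omega>\<bar> + \<bar>?G \<omega>\<bar> + \<bar>c\<bar> * \<bar>T n - 1\<bar>)"
    proof (rule integral_mono)
      show "\<bar>(\<Sum>i=1..n. cluster_sum (a n) h i \<omega>) - c\<bar> \<le> \<bar>?F \<omega>\<bar> + \<bar>?G \<omega>\<bar> + \<bar>c\<bar> * \<bar>T n - 1\<bar>" for \<omega>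
        unfolding split abs_mult[symmetric] by linarith
    qed (use cs_int[OF h int] cs_int[OF f0 intf0] cs_int[OF g0 intg0] in auto)
    also have "\<dots> = expectation (\<lambda>\<omega>. \<bar>?F \<omega>\<bar>) + expectation (\<lambda>\<omega>. \<bar>?G \<omega>\<bar>) + \<bar>c\<bar> * \<bar>T n - 1\<bar>"
      using cs_int[OF f0 intf0, of n] cs_int[OF g0 intg0, of n] by (simp add: prob_space)
    also have "expectation (\<lambda>\<omega>. \<bar>?F \<omega>\<bar>) \<le> e + (2 * real K)\<^sup>2 * Q n / e"
      unfolding Q_def by (rule expectation_abs_sum_le_variance[OF f0 f0K f0_mean a[OF n] e(1)])
    also have "expectation (\<lambda>\<omega>. \<bar>?G \<omega>\<bar>) \<le> T n * (2 * e)"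
    proof -
      have "0 \<le> T n" unfolding T_def using a[OF n] by (intro sum_nonneg) (auto intro: less_imp_le)
      have "expectation (\<lambda>\<omega>. \<bar>?G \<omega>\<bar>) \<le> T n * (\<integral>\<omega>. \<bar>g0 (X 1 1 \<omega>)\<bar> \<partial>M)"
        unfolding T_def by (rule expectation_abs_sum_le[OF g0 intg0 a[OF n]])
      also have "\<dots> \<le> T n * (2 * e)" using Eg0 \<open>0 \<le> T n\<close> by (rule mult_left_mono)
      finally show ?thesis .
    qed
    finally show ?thesis by simp
  qed
  have "(\<lambda>n. (e + (2 * real K)\<^sup>2 * Q n / e) + T n * (2 * e) + \<bar>c\<bar> * \<bar>T n - 1\<bar>) \<longlonglongrightarrow>
      (e + (2 * real K)\<^sup>2 * 0 / e) + 1 * (2 * e) + \<bar>c\<bar> * \<bar>1 - 1\<bar>"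
    using total negligible e(1) unfolding T_def Q_def by (intro tendsto_intros) auto
  then have "\<forall>\<^sub>F n in sequentially. (e + (2 * real K)\<^sup>2 * Q n / e) + T n * (2 * e) + \<bar>c\<bar> * \<bar>T n - 1\<bar> < r"
    by (rule order_tendstoD(2)) (use e in simp)
  then show "\<forall>\<^sub>F n in sequentially. norm (expectation (\<lambda>\<omega>. \<bar>(\<Sum>i=1..n. cluster_sum (a n) h i \<omega>) - (\<integral>\<omega>. h (X 1 1 \<omega>) \<partial>M)\<bar>) - 0) < r"
    using eventually_ge_at_top[of 1]
  proof eventually_elim
    case (elim n)
    have "0 \<le> expectation (\<lambda>\<omega>. \<bar>(\<Sum>i=1..n. cluster_sum (a n) h i \<omega>) - c\<bar>)" by simp
    with bound[OF elim(2)] elim(1) show ?case by (simp add: c_def)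
  qed
qed

end

text \<open>If the sums of the powers vanish then so does the largest weight, and the sum of squares is at most
  the largest weight times the total weight.\<close>

lemma sum_squares_tendsto_zero:
  fixes A :: "nat \<Rightarrow> nat \<Rightarrow> real"
  assumes nonneg: "\<And>n i. i \<in> {1..n} \<Longrightarrow> 0 \<le> A n i" and d: "0 < \<delta>"
    and total: "(\<lambda>n. \<Sum>i=1..n. A n i) \<longlonglongrightarrow> L"
    and small: "(\<lambda>n. \<Sum>i=1..n. A n i powr (1 + \<delta>)) \<longlonglongrightarrow> 0"
  shows "(\<lambda>n. \<Sum>i=1..n. (A n i)\<^sup>2) \<longlonglongrightarrow> 0"
proof -
  have max: "\<forall>\<^sub>F n in sequentially. \<forall>i\<in>{1..n}. A n i \<le> e" if e: "0 < e" for e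
  proof -
    have "\<forall>\<^sub>F n in sequentially. (\<Sum>i=1..n. A n i powr (1 + \<delta>)) < e powr (1 + \<delta>)"
      by (rule order_tendstoD(2)[OF small]) (use e in simp)
    then show ?thesis
    proof eventually_elim
      case (elim n)
      show ?case
      proof (rule ballI, rule ccontr)
        fix i assume i: "i \<in> {1..n}" "\<not> A n i \<le> e"
        then have "e powr (1 + \<delta>) \<le> A n i powr (1 + \<delta>)" using e d by (intro powr_mono2) auto
        also have "\<dots> \<le> (\<Sum>i=1..n. A n i powr (1 + \<delta>))" using i by (intro member_le_sum) auto
        finally show False using elim by simp
      qed
    qed
  qed
  show ?thesis
  proof (rule tendsto_normI)
    fix r :: real assume r: "0 < r"
    have L: "0 \<le> L" using nonneg by (intro LIMSEQ_le_const[OF total]) (auto intro!: sum_nonneg)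
    define e where "e = r / (L + 2)"
    have e: "0 < e" "e * (L + 1) < r" using r L by (auto simp: e_def field_simps)
    have "\<forall>\<^sub>F n in sequentially. (\<Sum>i=1..n. A n i) < L + 1"
      by (rule order_tendstoD(2)[OF total]) simp
    with max[OF e(1)] show "\<forall>\<^sub>F n in sequentially. norm ((\<Sum>i=1..n. (A n i)\<^sup>2) - 0) < r"
    proof eventually_elim
      case (elim n)
      have "(\<Sum>i=1..n. (A n i)\<^sup>2) \<le> (\<Sum>i=1..n. e * A n i)"
        unfolding power2_eq_square using elim(1) nonneg by (intro sum_mono mult_right_mono) auto
      also have "\<dots> = e * (\<Sum>i=1..n. A n i)" by (simp add: sum_distrib_left)
      also have "\<dots> \<le> e * (L + 1)" using elim(2) e by (intro mult_left_mono) auto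
      finally have "(\<Sum>i=1..n. (A n i)\<^sup>2) < r" using e by simp
      then show ?case by (simp add: sum_nonneg)
    qed
  qed
qed

section \<open>Matrices\<close>

lemma norm_matrix_vector_mult_le:
  fixes A :: "real^'n^'k"
  shows "norm (A *v x) \<le> norm A * norm x"
proof -
  have "norm (A *v x) = L2_set (\<lambda>i. norm ((A *v x) $ i)) UNIV" by (simp add: norm_vec_def)
  also have "\<dots> \<le> L2_set (\<lambda>i. norm (A $ i) * norm x) UNIV"
    by (rule L2_set_mono) (auto simp: matrix_vector_mul_component Cauchy_Schwarz_ineq2)
  also have "\<dots> = norm A * norm x" by (simp add: norm_vec_def L2_set_left_distrib)
  finally show ?thesis .
qed

lemma matrix_inv_cancel:
  fixes V :: "real^'d^'d"
  assumes "invertible V"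
  shows "matrix_inv V ** V = mat 1" "V ** matrix_inv V = mat 1"
  using someI_ex[OF assms[unfolded invertible_def]] by (simp_all add: matrix_inv_def)

lemma transpose_matrix_inv:
  fixes V :: "real^'d^'d"
  assumes "invertible V" "transpose V = V"
  shows "transpose (matrix_inv V) = matrix_inv V"
proof -
  have "transpose (matrix_inv V) ** V = mat 1"
    using matrix_inv_cancel(2)[OF assms(1)] matrix_transpose_mul[of V "matrix_inv V"] assms(2)
    by (simp add: transpose_mat)
  then have "transpose (matrix_inv V) = transpose (matrix_inv V) ** (V ** matrix_inv V)"
    using matrix_inv_cancel(2)[OF assms(1)] by simp
  also have "\<dots> = matrix_inv V"
    using \<open>transpose (matrix_inv V) ** V = mat 1\<close> by (simp add: matrix_mul_assoc)
  finally show ?thesis .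
qed

lemma inner_matrix_symmetric:
  fixes A :: "real^'d^'d"
  assumes "transpose A = A"
  shows "x \<bullet> (A *v y) = (A *v x) \<bullet> y"
  using dot_lmul_matrix[of x A y] assms by (simp flip: transpose_matrix_vector)

text \<open>Multiplying the equation by the inverse of \<open>V\<close> shows that \<open>t\<close> differs from
  minus the image of \<open>s\<close> by at most \<open>c e |t|\<close>, where \<open>c\<close> is the
  norm of the inverse and \<open>e = norm (A - V) + q\<close>. Bounding \<open>|t|\<close> by that
  difference plus \<open>c |s|\<close>, the difference can be absorbed on the left because \<open>c e
  \<le> 1 / 2\<close>.\<close>

lemma linearised_equation_error:
  fixes A V :: "real^'d^'d"
  assumes V: "invertible V" and eq: "s + A *v t + r = 0" and r: "norm r \<le> q * norm t" and q: "0 \<le> q"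
    and small: "norm (matrix_inv V) * (norm (A - V) + q) \<le> 1 / 2"
  shows "norm (t + matrix_inv V *v s) \<le> 2 * (norm (matrix_inv V))\<^sup>2 * ((norm (A - V) + q) * norm s)"
proof -
  let ?W = "matrix_inv V"
  define c where "c = norm ?W"
  define e where "e = norm (A - V) + q"
  have c: "0 \<le> c" by (simp add: c_def)
  have "V *v t + s = - ((A - V) *v t + r)"
    using eq by (simp add: matrix_vector_mult_diff_rdistrib algebra_simps eq_neg_iff_add_eq_0)
  then have "?W *v (V *v t + s) = - (?W *v ((A - V) *v t + r))"
    by (simp only: linear_neg[OF matrix_vector_mul_linear])
  then have d: "t + ?W *v s = - (?W *v ((A - V) *v t + r))"
    using matrix_inv_cancel(1)[OF V] by (simp add: matrix_vector_right_distrib matrix_vector_mul_assoc)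
  have "norm (t + ?W *v s) \<le> c * norm ((A - V) *v t + r)"
    unfolding d norm_minus_cancel c_def by (rule norm_matrix_vector_mult_le)
  also have "\<dots> \<le> c * (e * norm t)"
  proof (rule mult_left_mono[OF _ c])
    have "norm ((A - V) *v t + r) \<le> norm (A - V) * norm t + q * norm t"
      using norm_triangle_le[OF add_mono[OF norm_matrix_vector_mult_le r]] .
    then show "norm ((A - V) *v t + r) \<le> e * norm t" by (simp add: e_def distrib_right)
  qed
  finally have 1: "norm (t + ?W *v s) \<le> (c * e) * norm t" by (simp add: mult.assoc)
  have ts: "norm t \<le> norm (t + ?W *v s) + c * norm s"
  proof -
    have "norm t \<le> norm (t + ?W *v s) + norm (?W *v s)"
      using norm_triangle_ineq4[of "t + ?W *v s" "?W *v s"] by simp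
    then show ?thesis using norm_matrix_vector_mult_le[of ?W s] by (simp add: c_def)
  qed
  have ce: "0 \<le> c * e" using c q by (simp add: e_def)
  have "norm (t + ?W *v s) \<le> (c * e) * (norm (t + ?W *v s) + c * norm s)"
    using 1 mult_left_mono[OF ts ce] by linarith
  also have "\<dots> = (c * e) * norm (t + ?W *v s) + c * c * (e * norm s)" by (simp add: algebra_simps)
  also have "(c * e) * norm (t + ?W *v s) \<le> 1 / 2 * norm (t + ?W *v s)"
    using small by (intro mult_right_mono) (auto simp: c_def e_def)
  finally have "norm (t + ?W *v s) \<le> 2 * (c * c * (e * norm s))" by linarith
  then show ?thesis by (simp add: c_def e_def power2_eq_square mult.assoc)
qed

lemma outer_prod_quadratic_form: "u \<bullet> (outer_prod x y *v u) = (u \<bullet> x) * (u \<bullet> y)"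
proof -
  have "outer_prod x y *v u = (u \<bullet> y) *\<^sub>R x"
    by (simp add: vec_eq_iff outer_prod_def matrix_vector_mult_def inner_vec_def sum_distrib_left sum_distrib_right mult_ac)
  then show ?thesis by simp
qed

lemma norm_outer_prod: "norm (outer_prod x y) = norm x * norm y"
proof -
  have "outer_prod x y $ i = (x $ i) *\<^sub>R y" for i by (simp add: outer_prod_def vec_eq_iff)
  then have "norm (outer_prod x y) = L2_set (\<lambda>i. norm (x $ i) * norm y) UNIV"
    by (simp add: norm_vec_def[of "outer_prod x y"])
  then show ?thesis by (simp add: norm_vec_def[of x] L2_set_left_distrib)
qed

lemma borel_measurable_outer_prod [measurable]:
  assumes [measurable]: "f \<in> borel_measurable M" "g \<in> borel_measurable M"
  shows "(\<lambda>x. outer_prod (f x) (g x)) \<in> borel_measurable M"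
proof (rule borel_measurable_continuous_Pair[OF assms])
  show "continuous_on UNIV (\<lambda>x. outer_prod (fst x) (snd x))"
    unfolding outer_prod_def by (intro continuous_intros)
qed

lemma integrable_outer_prod:
  fixes f g :: "'a \<Rightarrow> real^'d"
  assumes [measurable]: "f \<in> borel_measurable M" "g \<in> borel_measurable M"
    and "integrable M (\<lambda>x. (norm (f x))\<^sup>2)" "integrable M (\<lambda>x. (norm (g x))\<^sup>2)"
  shows "integrable M (\<lambda>x. outer_prod (f x) (g x))"
proof (rule Bochner_Integration.integrable_bound[OF Bochner_Integration.integrable_add[OF assms(3,4)]])
  have "norm (outer_prod u v) \<le> (norm u)\<^sup>2 + (norm v)\<^sup>2" for u v :: "real^'d"
  proof -
    have "2 * (norm u * norm v) \<le> (norm u)\<^sup>2 + (norm v)\<^sup>2"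
      using sum_squares_bound[of "norm u" "norm v"] by (simp add: mult.assoc)
    moreover have "0 \<le> norm u * norm v" by simp
    ultimately show ?thesis unfolding norm_outer_prod by linarith
  qed
  then show "AE x in M. norm (outer_prod (f x) (g x)) \<le> norm ((norm (f x))\<^sup>2 + (norm (g x))\<^sup>2)" by simp
qed measurable

lemma bounded_linear_quadratic_form: "bounded_linear (\<lambda>A :: real^'d^'d. u \<bullet> (A *v u))"
  unfolding linear_conv_bounded_linear[symmetric]
  by (simp add: linear_iff matrix_vector_mult_add_rdistrib inner_add_right scaleR_matrix_vector_assoc[symmetric])

lemma bounded_linear_matrix_entry: "bounded_linear (\<lambda>A :: real^'n^'k. A $ p $ q)"
  by (intro bounded_linear_compose[OF bounded_linear_vec_nth bounded_linear_vec_nth])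

lemma norm_matrix_le_entries: "norm (A :: real^'n^'k) \<le> (\<Sum>p\<in>UNIV. \<Sum>q\<in>UNIV. \<bar>A $ p $ q\<bar>)"
proof -
  have "norm A \<le> (\<Sum>p\<in>UNIV. norm (A $ p))" unfolding norm_vec_def by (rule L2_set_le_sum) simp
  also have "\<dots> \<le> (\<Sum>p\<in>UNIV. \<Sum>q\<in>UNIV. \<bar>A $ p $ q\<bar>)" by (intro sum_mono norm_le_l1_cart)
  finally show ?thesis .
qed

lemma transpose_eq_if_symmetric_form:
  fixes A :: "real^'d^'d"
  assumes "\<And>u v. v \<bullet> (A *v u) = u \<bullet> (A *v v)"
  shows "transpose A = A"
proof -
  have "A $ p $ q = A $ q $ p" for p q
    using assms[of "axis p 1" "axis q 1"] by (simp add: inner_axis' matrix_vector_mult_basis column_def)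
  then show ?thesis by (simp add: vec_eq_iff transpose_def)
qed

section \<open>Derivatives depending on a parameter\<close>

lemma has_derivative_directional_limit:
  fixes f :: "'a::real_normed_vector \<Rightarrow> 'b::real_normed_vector"
  assumes "(f has_derivative D) (at a)"
  shows "(\<lambda>n. real (Suc n) *\<^sub>R (f (a + inverse (real (Suc n)) *\<^sub>R v) - f a)) \<longlonglongrightarrow> D v"
proof (cases "v = 0")
  case True
  then show ?thesis using linear_0[OF has_derivative_linear[OF assms]] by simp
next
  case False
  let ?h = "\<lambda>n. inverse (real (Suc n)) *\<^sub>R v"
  have "filterlim ?h (at 0) sequentially"
    unfolding filterlim_at using tendsto_scaleR[OF LIMSEQ_inverse_real_of_nat tendsto_const[of v]] False by simp
  moreover have "((\<lambda>h. norm (f (a + h) - f a - D h) / norm h) \<longlongrightarrow> 0) (at 0)"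
    using assms by (simp add: has_derivative_at)
  ultimately have "(\<lambda>n. norm (f (a + ?h n) - f a - D (?h n)) / norm (?h n)) \<longlonglongrightarrow> 0"
    by (rule filterlim_compose[rotated])
  then have "(\<lambda>n. norm v * (norm (f (a + ?h n) - f a - D (?h n)) / norm (?h n))) \<longlonglongrightarrow> 0"
    by (rule tendsto_mult_right_zero)
  moreover have "norm v * (norm (f (a + ?h n) - f a - D (?h n)) / norm (?h n)) =
      norm (real (Suc n) *\<^sub>R (f (a + ?h n) - f a) - D v)" for n
  proof -
    have "real (Suc n) *\<^sub>R (f (a + ?h n) - f a) - D v = real (Suc n) *\<^sub>R (f (a + ?h n) - f a - D (?h n))"
      using linear_cmul[OF has_derivative_linear[OF assms], of "inverse (real (Suc n))" v]
      by (simp add: scaleR_diff_right del: of_nat_Suc)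
    then have "norm (real (Suc n) *\<^sub>R (f (a + ?h n) - f a) - D v) = real (Suc n) * norm (f (a + ?h n) - f a - D (?h n))"
      by simp
    then show ?thesis using False by (simp add: field_simps del: of_nat_Suc)
  qed
  ultimately show ?thesis by (simp only: tendsto_norm_zero_iff LIM_zero_iff)
qed

text \<open>A directional derivative is a limit of difference quotients along the sequence \<open>1 / (n +
  1)\<close>. Measurability is known only for base points in \<open>U\<close>, hence the value
  \<open>0\<close> for the finitely many quotients that leave \<open>U\<close>.\<close>

lemma borel_measurable_directional_derivative:
  fixes f :: "'x \<Rightarrow> 'a::real_normed_vector \<Rightarrow> 'b::{real_normed_vector, second_countable_topology}"
  assumes "open U" "a \<in> U"
    and meas: "\<And>b. b \<in> U \<Longrightarrow> (\<lambda>x. f x b) \<in> borel_measurable N"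
    and deriv: "\<And>x. (f x has_derivative D x) (at a)"
  shows "(\<lambda>x. D x v) \<in> borel_measurable N"
proof -
  let ?p = "\<lambda>n. a + inverse (real (Suc n)) *\<^sub>R v"
  define g where "g n x = (if ?p n \<in> U then real (Suc n) *\<^sub>R (f x (?p n) - f x a) else 0)" for n x
  have "?p \<longlonglongrightarrow> a"
    using tendsto_add[OF tendsto_const[of a] tendsto_scaleR[OF LIMSEQ_inverse_real_of_nat tendsto_const[of v]]] by simp
  then have ev: "\<forall>\<^sub>F n in sequentially. ?p n \<in> U"
    by (rule topological_tendstoD[OF _ \<open>open U\<close> \<open>a \<in> U\<close>])
  show ?thesis
  proof (rule borel_measurable_LIMSEQ_metric)
    show "g n \<in> borel_measurable N" for n
    proof (cases "?p n \<in> U")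
      case True
      show ?thesis unfolding g_def[abs_def]
        using True by (simp only: if_True) (intro borel_measurable_scaleR borel_measurable_diff borel_measurable_const meas True \<open>a \<in> U\<close>)
    qed (simp add: g_def[abs_def])
    show "(\<lambda>n. g n x) \<longlonglongrightarrow> D x v" for x
    proof (rule Lim_transform_eventually[OF has_derivative_directional_limit[OF deriv]])
      show "\<forall>\<^sub>F n in sequentially. real (Suc n) *\<^sub>R (f x (?p n) - f x a) = g n x"
        using ev by eventually_elim (simp add: g_def)
    qed
  qed
qed

text \<open>The mean value theorem in the direction \<open>v\<close> turns the second difference into
  \<open>s\<close> times a difference of gradients, which the derivative of the gradient at
  \<open>a\<close> approximates to first order.\<close>

lemma second_difference_approx:
  fixes g :: "'a::real_inner \<Rightarrow> real" and G :: "'a \<Rightarrow> 'a"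
  assumes U: "open U" "a \<in> U" and G: "\<And>b. b \<in> U \<Longrightarrow> GDERIV g b :> G b"
    and H: "(G has_derivative H) (at a)" and e: "0 < e"
  shows "\<exists>d>0. \<forall>s. 0 < s \<and> s < d \<longrightarrow>
    \<bar>g (a + s *\<^sub>R u + s *\<^sub>R v) - g (a + s *\<^sub>R v) - g (a + s *\<^sub>R u) + g a - s\<^sup>2 * (v \<bullet> H u)\<bar> \<le> e * s\<^sup>2"
proof -
  define c where "c = norm u + norm v + 1"
  have c: "0 < c" "norm u \<le> c" "norm v \<le> c" "norm u + norm v < c"
    by (auto simp: c_def add_nonneg_pos intro: order_trans)
  define e' where "e' = e / (2 * c * c)"
  have e': "0 < e'" "2 * c * c * e' = e" using e c by (auto simp: e'_def)
  obtain r where r: "0 < r" "ball a r \<subseteq> U" using U openE by blast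
  obtain d1 where d1: "0 < d1" "\<And>y. norm (y - a) < d1 \<Longrightarrow> norm (G y - G a - H (y - a)) \<le> e' * norm (y - a)"
    using H e'(1) unfolding has_derivative_at_alt by blast
  interpret H: bounded_linear H using H by (rule has_derivative_bounded_linear)
  define d where "d = min r d1 / c"
  have d: "0 < d" using r d1 c by (simp add: d_def)
  have "\<bar>g (a + s *\<^sub>R u + s *\<^sub>R v) - g (a + s *\<^sub>R v) - g (a + s *\<^sub>R u) + g a - s\<^sup>2 * (v \<bullet> H u)\<bar> \<le> e * s\<^sup>2"
    if s: "0 < s" "s < d" for s
  proof -
    have sc: "s * c < min r d1" using s c by (simp add: d_def field_simps)
    have small: "norm (p *\<^sub>R u + q *\<^sub>R v) \<le> s * c" if "0 \<le> p" "p \<le> s" "0 \<le> q" "q \<le> s" for p q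
    proof -
      have "norm (p *\<^sub>R u + q *\<^sub>R v) \<le> p * norm u + q * norm v"
        using norm_triangle_ineq[of "p *\<^sub>R u" "q *\<^sub>R v"] that by simp
      also have "\<dots> \<le> s * norm u + s * norm v" using that by (intro add_mono mult_right_mono) auto
      also have "\<dots> = s * (norm u + norm v)" by (simp add: algebra_simps)
      also have "\<dots> \<le> s * c" using c s by (intro mult_left_mono) auto
      finally show ?thesis .
    qed
    have inU: "a + p *\<^sub>R u + q *\<^sub>R v \<in> U" if "0 \<le> p" "p \<le> s" "0 \<le> q" "q \<le> s" for p q
    proof -
      have "dist (a + p *\<^sub>R u + q *\<^sub>R v) a = norm (p *\<^sub>R u + q *\<^sub>R v)"
        unfolding dist_norm by (rule arg_cong[of _ _ norm]) simp
      then show ?thesis using small[OF that] sc r(2) by (auto simp: dist_commute)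
    qed
    define \<phi> where "\<phi> q = g (a + s *\<^sub>R u + q *\<^sub>R v) - g (a + 0 *\<^sub>R u + q *\<^sub>R v)" for q
    have der: "((\<lambda>q. g (a + p *\<^sub>R u + q *\<^sub>R v)) has_derivative (\<lambda>h. h * (v \<bullet> G (a + p *\<^sub>R u + q *\<^sub>R v)))) (at q)"
      if "0 \<le> p" "p \<le> s" "0 \<le> q" "q \<le> s" for p q
    proof -
      have "((\<lambda>q. a + p *\<^sub>R u + q *\<^sub>R v) has_derivative (\<lambda>h. h *\<^sub>R v)) (at q)"
        by (auto intro!: derivative_eq_intros)
      from has_derivative_compose[OF this G[OF inU[OF that], unfolded gderiv_def]]
      show ?thesis by simp
    qed
    have "\<exists>q\<in>{0<..<s}. \<phi> s - \<phi> 0 = (s - 0) * (v \<bullet> G (a + s *\<^sub>R u + q *\<^sub>R v)) - (s - 0) * (v \<bullet> G (a + 0 *\<^sub>R u + q *\<^sub>R v))"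
    proof (rule mvt_simple[OF s(1)])
      fix q assume q: "0 \<le> q" "q \<le> s"
      show "(\<phi> has_derivative (\<lambda>h. h * (v \<bullet> G (a + s *\<^sub>R u + q *\<^sub>R v)) - h * (v \<bullet> G (a + 0 *\<^sub>R u + q *\<^sub>R v)))) (at q within {0..s})"
        unfolding \<phi>_def using q s
        by (intro has_derivative_at_withinI[OF has_derivative_diff[OF der der]]) auto
    qed
    then obtain q where q: "0 < q" "q < s"
      "\<phi> s - \<phi> 0 = s * (v \<bullet> (G (a + s *\<^sub>R u + q *\<^sub>R v) - G (a + q *\<^sub>R v)))"
      by (auto simp: inner_diff_right algebra_simps)
    define E where "E y = G (a + y) - G a - H y" for y
    have E: "norm (E y) \<le> e' * (s * c)" if "norm y \<le> s * c" for y
    proof -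
      have "norm (E y) \<le> e' * norm y" using d1(2)[of "a + y"] that sc by (simp add: E_def)
      also have "\<dots> \<le> e' * (s * c)" using that e' by (intro mult_left_mono) auto
      finally show ?thesis .
    qed
    have "G (a + s *\<^sub>R u + q *\<^sub>R v) - G (a + q *\<^sub>R v) = s *\<^sub>R H u + (E (s *\<^sub>R u + q *\<^sub>R v) - E (0 *\<^sub>R u + q *\<^sub>R v))"
      by (simp add: E_def H.add H.scaleR add.assoc)
    then have "\<phi> s - \<phi> 0 - s\<^sup>2 * (v \<bullet> H u) = s * (v \<bullet> (E (s *\<^sub>R u + q *\<^sub>R v) - E (0 *\<^sub>R u + q *\<^sub>R v)))"
      unfolding q(3) by (simp only: inner_add_right inner_scaleR_right power2_eq_square distrib_left mult.assoc)
    then have "\<bar>\<phi> s - \<phi> 0 - s\<^sup>2 * (v \<bullet> H u)\<bar> = s * \<bar>v \<bullet> (E (s *\<^sub>R u + q *\<^sub>R v) - E (0 *\<^sub>R u + q *\<^sub>R v))\<bar>"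
      using s by (simp add: abs_mult)
    also have "\<dots> \<le> s * (norm v * norm (E (s *\<^sub>R u + q *\<^sub>R v) - E (0 *\<^sub>R u + q *\<^sub>R v)))"
      using s by (intro mult_left_mono Cauchy_Schwarz_ineq2) auto
    also have "\<dots> \<le> s * (c * (e' * (s * c) + e' * (s * c)))"
    proof (intro mult_left_mono mult_mono)
      have "norm (E (s *\<^sub>R u + q *\<^sub>R v)) \<le> e' * (s * c)" "norm (E (0 *\<^sub>R u + q *\<^sub>R v)) \<le> e' * (s * c)"
        using q s by (intro E small; simp)+
      then show "norm (E (s *\<^sub>R u + q *\<^sub>R v) - E (0 *\<^sub>R u + q *\<^sub>R v)) \<le> e' * (s * c) + e' * (s * c)"
        by (meson add_mono norm_triangle_ineq4 order_trans)
    qed (use c s in auto)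
    also have "\<dots> = (2 * c * c * e') * s\<^sup>2" by (simp add: power2_eq_square algebra_simps)
    finally have "\<bar>\<phi> s - \<phi> 0 - s\<^sup>2 * (v \<bullet> H u)\<bar> \<le> e * s\<^sup>2" unfolding e'(2) .
    moreover have "\<phi> s - \<phi> 0 = g (a + s *\<^sub>R u + s *\<^sub>R v) - g (a + s *\<^sub>R v) - g (a + s *\<^sub>R u) + g a"
      by (simp add: \<phi>_def)
    ultimately show ?thesis by simp
  qed
  then show ?thesis using d by blast
qed

text \<open>The second difference is symmetric in \<open>u\<close> and \<open>v\<close>, so both values are
  limits of the same quotient.\<close>

theorem symmetric_second_derivative:
  fixes g :: "'a::real_inner \<Rightarrow> real" and G :: "'a \<Rightarrow> 'a"
  assumes U: "open U" "a \<in> U" and G: "\<And>b. b \<in> U \<Longrightarrow> GDERIV g b :> G b"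
    and H: "(G has_derivative H) (at a)"
  shows "v \<bullet> H u = u \<bullet> H v"
proof -
  have "\<bar>v \<bullet> H u - u \<bullet> H v\<bar> \<le> 2 * e" if e: "0 < e" for e
  proof -
    let ?D = "\<lambda>s u v. g (a + s *\<^sub>R u + s *\<^sub>R v) - g (a + s *\<^sub>R v) - g (a + s *\<^sub>R u) + g a"
    obtain d1 where d1: "0 < d1" "\<And>s. 0 < s \<Longrightarrow> s < d1 \<Longrightarrow> \<bar>?D s u v - s\<^sup>2 * (v \<bullet> H u)\<bar> \<le> e * s\<^sup>2"
      using second_difference_approx[OF U G H e, of u v] by blast
    obtain d2 where d2: "0 < d2" "\<And>s. 0 < s \<Longrightarrow> s < d2 \<Longrightarrow> \<bar>?D s v u - s\<^sup>2 * (u \<bullet> H v)\<bar> \<le> e * s\<^sup>2"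
      using second_difference_approx[OF U G H e, of v u] by blast
    define s where "s = min d1 d2 / 2"
    have s: "0 < s" "s < d1" "s < d2" using d1 d2 by (auto simp: s_def)
    have "?D s u v = ?D s v u" by (simp add: add.commute add.left_commute)
    then have "\<bar>s\<^sup>2 * (v \<bullet> H u) - s\<^sup>2 * (u \<bullet> H v)\<bar> \<le> e * s\<^sup>2 + e * s\<^sup>2"
      using d1(2)[OF s(1,2)] d2(2)[OF s(1,3)] by linarith
    moreover have "s\<^sup>2 * \<bar>v \<bullet> H u - u \<bullet> H v\<bar> = \<bar>s\<^sup>2 * (v \<bullet> H u) - s\<^sup>2 * (u \<bullet> H v)\<bar>"
      by (simp add: abs_mult flip: right_diff_distrib)
    ultimately have "s\<^sup>2 * \<bar>v \<bullet> H u - u \<bullet> H v\<bar> \<le> s\<^sup>2 * (2 * e)" by (simp add: algebra_simps)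
    then show ?thesis using s by (simp add: mult_le_cancel_left)
  qed
  from this[of "\<bar>v \<bullet> H u - u \<bullet> H v\<bar> / 4"] show ?thesis
    by (cases "v \<bullet> H u - u \<bullet> H v = 0") auto
qed

text \<open>The mean value inequality on the segment from \<open>x\<close> to \<open>y\<close> for
  \<open>f\<close> minus its linearisation at \<open>x\<close>, whose derivative is the increment of
  \<open>J\<close>.\<close>

lemma hoelder_taylor_remainder:
  fixes f :: "real^'d \<Rightarrow> real^'d" and J :: "real^'d \<Rightarrow> real^'d^'d"
  assumes U: "convex U" "x \<in> U" "y \<in> U"
    and J: "\<And>b. b \<in> U \<Longrightarrow> (f has_derivative (\<lambda>h. J b *v h)) (at b)"
    and hoelder: "\<And>b. b \<in> U \<Longrightarrow> norm (J b - J x) \<le> K * norm (b - x) powr r"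
    and "0 \<le> K" "0 < r"
  shows "norm (f y - f x - J x *v (y - x)) \<le> K * norm (y - x) powr r * norm (y - x)"
proof -
  let ?S = "closed_segment x y"
  have S: "?S \<subseteq> U" using U by (simp add: closed_segment_subset)
  have "norm ((f y - J x *v y) - (f x - J x *v x)) \<le> (K * norm (y - x) powr r) * norm (y - x)"
  proof (rule differentiable_bound[where S = ?S and f' = "\<lambda>b h. (J b - J x) *v h"])
    fix b assume b: "b \<in> ?S"
    have "((\<lambda>b. f b - J x *v b) has_derivative (\<lambda>h. J b *v h - J x *v h)) (at b within ?S)"
      using b S by (intro has_derivative_at_withinI[OF has_derivative_diff[OF J bounded_linear_imp_has_derivative]]) auto
    then show "((\<lambda>b. f b - J x *v b) has_derivative (\<lambda>h. (J b - J x) *v h)) (at b within ?S)"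
      by (simp add: matrix_vector_mult_diff_rdistrib)
    show "onorm (\<lambda>h. (J b - J x) *v h) \<le> K * norm (y - x) powr r"
    proof (rule onorm_le)
      fix h
      have "norm (b - x) \<le> norm (y - x)" using segment_bound1[OF b] .
      then have "norm (b - x) powr r \<le> norm (y - x) powr r" using \<open>0 < r\<close> by (intro powr_mono2) auto
      then have "norm (J b - J x) \<le> K * norm (y - x) powr r"
        using hoelder[of b] b S mult_left_mono[OF _ \<open>0 \<le> K\<close>] by (meson order_trans subsetD)
      then show "norm ((J b - J x) *v h) \<le> K * norm (y - x) powr r * norm h"
        using norm_matrix_vector_mult_le[of "J b - J x" h] mult_right_mono[OF _ norm_ge_zero] by (meson order_trans)
    qed
  qed auto
  then show ?thesis by (simp add: matrix_vector_mult_diff_distrib algebra_simps)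
qed

lemma borel_measurable_if_inner:
  fixes f :: "'a \<Rightarrow> 'b::euclidean_space"
  assumes "\<And>v. (\<lambda>x. v \<bullet> f x) \<in> borel_measurable M"
  shows "f \<in> borel_measurable M"
  using assms by (subst borel_measurable_euclidean_space) (simp add: inner_commute[of "f _"])

lemma borel_measurable_if_matrix_vector:
  fixes A :: "'a \<Rightarrow> real^'n^'k"
  assumes "\<And>v. (\<lambda>x. A x *v v) \<in> borel_measurable M"
  shows "A \<in> borel_measurable M"
proof -
  have entry: "(\<lambda>x. A x $ p $ q) \<in> borel_measurable M" for p q
  proof -
    have "(\<lambda>x. (A x *v axis q 1) $ p) \<in> borel_measurable M"
      by (rule measurable_compose[OF assms borel_measurable_continuous_onI]) (intro continuous_intros)
    then show ?thesis by (simp add: matrix_vector_mult_basis column_def)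
  qed
  show ?thesis
    by (subst borel_measurable_euclidean_space) (auto simp: Basis_vec_def inner_axis entry)
qed

section \<open>Weighted Z-estimators\<close>

lemma (in finite_measure) integrable_if_powr_integrable:
  fixes f :: "'a \<Rightarrow> 'b::{banach, second_countable_topology}"
  assumes [measurable]: "f \<in> borel_measurable M" and "integrable M (\<lambda>x. norm (f x) powr p)" and p: "1 \<le> p"
  shows "integrable M f"
proof (rule Bochner_Integration.integrable_bound[OF Bochner_Integration.integrable_add[OF integrable_const[of 1] assms(2)]])
  have "r \<le> 1 + r powr p" if "0 \<le> r" for r :: real
  proof (cases "r \<le> 1")
    case True
    then show ?thesis by (simp add: add_increasing2)
  next
    case False
    then show ?thesis using powr_mono[of 1 p r] p by simp
  qed
  then show "AE x in M. norm (f x) \<le> norm (1 + norm (f x) powr p)"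
    by (intro AE_I2) (auto intro: order_trans[OF _ abs_ge_self])
qed measurable

text \<open>A setting that speaks of the gradient \<open>\<psi>\<close> directly. When \<open>\<psi>\<close> is
  the gradient of a loss function, the measurability assumptions and the symmetry of
  \<open>\<psi>'\<close> at \<open>\<theta>\<close> follow from twice differentiability.\<close>

locale weighted_z_estimator = clustered_sample M m X
  for M :: "'w measure" and m :: "nat \<Rightarrow> nat" and X :: "nat \<Rightarrow> nat \<Rightarrow> 'w \<Rightarrow> real^'d" +
  fixes U :: "(real^'d) set" and \<theta> :: "real^'d"
    and \<psi> :: "real^'d \<Rightarrow> real^'d \<Rightarrow> real^'d" and \<psi>' :: "real^'d \<Rightarrow> real^'d \<Rightarrow> real^'d^'d"
    and w :: "nat \<Rightarrow> nat \<Rightarrow> real" and est :: "nat \<Rightarrow> 'w \<Rightarrow> real^'d"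
    and k :: "real^'d \<Rightarrow> real" and C :: "nat \<Rightarrow> real^'d^'d" and Cw B V :: "real^'d^'d"
    and cw \<eta> \<delta> lam :: real
  assumes U: "open U" "convex U" "\<theta> \<in> U"
    and psi_meas: "(\<lambda>x. \<psi> x \<theta>) \<in> borel_measurable borel"
    and psi'_meas: "(\<lambda>x. \<psi>' x \<theta>) \<in> borel_measurable borel"
    and psi': "\<And>x a. a \<in> U \<Longrightarrow> (\<psi> x has_derivative (\<lambda>h. \<psi>' x a *v h)) (at a)"
    and psi'_sym: "\<And>x. transpose (\<psi>' x \<theta>) = \<psi>' x \<theta>"
    and psi_centered: "(\<integral>\<omega>. \<psi> (X 1 1 \<omega>) \<theta> \<partial>M) = 0"
    and w_pos: "\<And>i j. i \<ge> 1 \<Longrightarrow> j \<in> {1..m i} \<Longrightarrow> w i j > 0"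
    and est_rv: "\<And>n. n \<ge> 1 \<Longrightarrow> est n \<in> borel_measurable M"
    and est_eq: "\<And>n \<omega>. n \<ge> 1 \<Longrightarrow> \<omega> \<in> space M \<Longrightarrow> est n \<omega> \<in> U \<Longrightarrow>
          (\<Sum>i=1..n. \<Sum>j=1..m i. w i j *\<^sub>R \<psi> (X i j \<omega>) (est n \<omega>)) = 0"
    and consistent: "converges_in_probability M est \<theta>"
    and total_weight: "(\<lambda>n. \<Sum>i=1..n. (\<Sum>j=1..m i. w i j) / total_size m n) \<longlonglongrightarrow> 1"
    and square_weight: "(\<lambda>n. (1 / total_size m n) * (\<Sum>i=1..n. \<Sum>j=1..m i. (w i j)\<^sup>2)) \<longlonglongrightarrow> cw"
    and C_def: "\<And>i. C i = (\<integral>\<omega>. outer_prod (\<psi> (X i 1 \<omega>) \<theta>) (\<psi> (X i 2 \<omega>) \<theta>) \<partial>M)"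
    and cross_weight: "(\<lambda>n. (1 / total_size m n) *\<^sub>R
              (\<Sum>i=1..n. \<Sum>j=1..m i. \<Sum>j'\<in>{1..m i} - {j}. (w i j * w i j') *\<^sub>R C i)) \<longlonglongrightarrow> Cw"
    and eta: "\<eta> > 0"
    and psi_moment: "integrable M (\<lambda>\<omega>. norm (\<psi> (X 1 1 \<omega>) \<theta>) powr (2 + \<eta>))"
    and lyapunov_weight: "(\<lambda>n. (1 / total_size m n powr (1 + \<eta> / 2)) *
               (\<Sum>i=1..n. (\<Sum>j=1..m i. w i j) powr (2 + \<eta>))) \<longlonglongrightarrow> 0"
    and delta: "\<delta> > 0"
    and psi'_moment: "integrable M (\<lambda>\<omega>. norm (\<psi>' (X 1 1 \<omega>) \<theta>) powr (1 + \<delta>))"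
    and lam: "0 < lam"
    and k_meas: "k \<in> borel_measurable borel"
    and k_nonneg: "\<And>x. k x \<ge> 0"
    and hoelder: "\<And>x a1 a2. a1 \<in> U \<Longrightarrow> a2 \<in> U \<Longrightarrow>
               norm (\<psi>' x a2 - \<psi>' x a1) \<le> k x * norm (a2 - a1) powr lam"
    and k_moment: "integrable M (\<lambda>\<omega>. k (X 1 1 \<omega>) powr (1 + \<delta>))"
    and negligible_weight: "(\<lambda>n. \<Sum>i=1..n. ((\<Sum>j=1..m i. w i j) / total_size m n) powr (1 + \<delta>)) \<longlonglongrightarrow> 0"
    and V_def: "V = (\<integral>\<omega>. \<psi>' (X 1 1 \<omega>) \<theta> \<partial>M)"
    and V_inv: "invertible V"
    and B_def: "B = (\<integral>\<omega>. outer_prod (\<psi> (X 1 1 \<omega>) \<theta>) (\<psi> (X 1 1 \<omega>) \<theta>) \<partial>M)"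
begin

abbreviation N :: "nat \<Rightarrow> real" where "N \<equiv> total_size m"

text \<open>The limit covariance of the score.\<close>

definition score_covariance :: "real^'d^'d" where "score_covariance = cw *\<^sub>R B + Cw"

definition score :: "nat \<Rightarrow> 'w \<Rightarrow> real^'d" where
  "score n \<omega> = (1 / sqrt (N n)) *\<^sub>R (\<Sum>i=1..n. \<Sum>j=1..m i. w i j *\<^sub>R \<psi> (X i j \<omega>) \<theta>)"

definition curvature :: "nat \<Rightarrow> 'w \<Rightarrow> real^'d^'d" where
  "curvature n \<omega> = (1 / N n) *\<^sub>R (\<Sum>i=1..n. \<Sum>j=1..m i. w i j *\<^sub>R \<psi>' (X i j \<omega>) \<theta>)"

definition hoelder_const :: "nat \<Rightarrow> 'w \<Rightarrow> real" where
  "hoelder_const n \<omega> = (1 / N n) * (\<Sum>i=1..n. \<Sum>j=1..m i. w i j * k (X i j \<omega>))"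

lemma N_pos:
  assumes "n \<ge> 1"
  shows "0 < N n"
proof -
  have "m 1 \<le> (\<Sum>i=1..n. m i)" by (rule member_le_sum) (use assms in auto)
  moreover have "1 \<le> m 1" using m_pos[of 1] by simp
  ultimately have "0 < (\<Sum>i=1..n. m i)" by linarith
  then show ?thesis unfolding total_size_def by (simp only: of_nat_0_less_iff)
qed

lemma psi_rv: "i \<ge> 1 \<Longrightarrow> j \<in> {1..m i} \<Longrightarrow> (\<lambda>\<omega>. \<psi> (X i j \<omega>) \<theta>) \<in> borel_measurable M"
  by (rule measurable_compose[OF X_rv psi_meas])

lemma psi'_rv: "i \<ge> 1 \<Longrightarrow> j \<in> {1..m i} \<Longrightarrow> (\<lambda>\<omega>. \<psi>' (X i j \<omega>) \<theta>) \<in> borel_measurable M"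
  by (rule measurable_compose[OF X_rv psi'_meas])

lemma k_rv: "i \<ge> 1 \<Longrightarrow> j \<in> {1..m i} \<Longrightarrow> (\<lambda>\<omega>. k (X i j \<omega>)) \<in> borel_measurable M"
  by (rule measurable_compose[OF X_rv k_meas])

lemma score_rv [measurable]: "score n \<in> borel_measurable M"
  unfolding score_def[abs_def]
  by (intro borel_measurable_scaleR borel_measurable_const borel_measurable_sum psi_rv) auto

lemma curvature_rv [measurable]: "curvature n \<in> borel_measurable M"
  unfolding curvature_def[abs_def]
  by (intro borel_measurable_scaleR borel_measurable_const borel_measurable_sum psi'_rv) auto

lemma hoelder_const_rv [measurable]: "hoelder_const n \<in> borel_measurable M"
  unfolding hoelder_const_def[abs_def]
  by (intro borel_measurable_times borel_measurable_const borel_measurable_sum k_rv) auto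

lemma one_in: "(1::nat) \<in> {1..m 1}"
  using m_pos[of 1] by simp

lemma integrable_psi: "integrable M (\<lambda>\<omega>. \<psi> (X 1 1 \<omega>) \<theta>)"
  by (rule integrable_if_powr_integrable[OF psi_rv[OF order_refl one_in] psi_moment]) (use eta in simp)

lemma square_integrable_psi:
  assumes "i \<ge> 1" "j \<in> {1..m i}"
  shows "integrable M (\<lambda>\<omega>. (norm (\<psi> (X i j \<omega>) \<theta>))\<^sup>2)"
proof -
  have [measurable]: "(\<lambda>\<omega>. \<psi> (X 1 1 \<omega>) \<theta>) \<in> borel_measurable M" by (rule psi_rv[OF order_refl one_in])
  note [measurable] = psi_meas
  have "integrable M (\<lambda>\<omega>. (norm (\<psi> (X 1 1 \<omega>) \<theta>))\<^sup>2)"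
  proof (rule integrable_if_powr_integrable[where p = "1 + \<eta> / 2"])
    have "norm ((norm y)\<^sup>2) powr (1 + \<eta> / 2) = norm y powr (2 + \<eta>)" for y :: "real^'d"
    proof -
      have "norm ((norm y)\<^sup>2) = norm y powr 2" by (cases "y = 0") simp_all
      then show ?thesis by (simp only: powr_powr) (simp add: distrib_left)
    qed
    then show "integrable M (\<lambda>\<omega>. norm ((norm (\<psi> (X 1 1 \<omega>) \<theta>))\<^sup>2) powr (1 + \<eta> / 2))"
      using psi_moment by simp
  qed (use eta in auto)
  then show ?thesis
    using integrable_X[of "\<lambda>x. (norm (\<psi> x \<theta>))\<^sup>2", OF _ _ assms] by simp
qed

lemma integrable_psi_outer_prod:
  assumes "i \<ge> 1" "j \<in> {1..m i}" "j' \<in> {1..m i}"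
  shows "integrable M (\<lambda>\<omega>. outer_prod (\<psi> (X i j \<omega>) \<theta>) (\<psi> (X i j' \<omega>) \<theta>))"
  by (intro integrable_outer_prod psi_rv square_integrable_psi assms)

lemma expectation_psi_product:
  assumes "i \<ge> 1" "j \<in> {1..m i}" "j' \<in> {1..m i}"
  shows "(\<integral>\<omega>. (u \<bullet> \<psi> (X i j \<omega>) \<theta>) * (u \<bullet> \<psi> (X i j' \<omega>) \<theta>) \<partial>M) =
    u \<bullet> ((\<integral>\<omega>. outer_prod (\<psi> (X i j \<omega>) \<theta>) (\<psi> (X i j' \<omega>) \<theta>) \<partial>M) *v u)"
  using integral_bounded_linear[OF bounded_linear_quadratic_form integrable_psi_outer_prod[OF assms], of u]
  by (simp add: outer_prod_quadratic_form)

text \<open>The quadratic form of a matrix is linear in the matrix, so limits and integrals may be taken on the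
  matrices \<open>B\<close>, \<open>C i\<close> and \<open>Cw\<close> first.\<close>

lemma score_variance_limit:
  "(\<lambda>n. (1 / N n) * (\<Sum>i=1..n. \<Sum>j=1..m i. (w i j)\<^sup>2) * (\<integral>\<omega>. (u \<bullet> \<psi> (X 1 1 \<omega>) \<theta>)\<^sup>2 \<partial>M) +
      (1 / N n) * (\<Sum>i=1..n. \<Sum>j=1..m i. \<Sum>j'\<in>{1..m i} - {j}.
        w i j * w i j' * (\<integral>\<omega>. (u \<bullet> \<psi> (X i 1 \<omega>) \<theta>) * (u \<bullet> \<psi> (X i 2 \<omega>) \<theta>) \<partial>M))) \<longlonglongrightarrow> u \<bullet> (score_covariance *v u)"
proof -
  define q where "q A = u \<bullet> (A *v u)" for A :: "real^'d^'d"
  interpret q: bounded_linear q unfolding q_def[abs_def] by (rule bounded_linear_quadratic_form)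
  have qB: "(\<integral>\<omega>. (u \<bullet> \<psi> (X 1 1 \<omega>) \<theta>)\<^sup>2 \<partial>M) = q B"
    using expectation_psi_product[OF order_refl one_in one_in, of u]
    by (simp add: q_def B_def power2_eq_square)
  have "w i j * w i j' * (\<integral>\<omega>. (u \<bullet> \<psi> (X i 1 \<omega>) \<theta>) * (u \<bullet> \<psi> (X i 2 \<omega>) \<theta>) \<partial>M) = q ((w i j * w i j') *\<^sub>R C i)"
    if "i \<in> {1..n}" "j \<in> {1..m i}" "j' \<in> {1..m i} - {j}" for n i j j'
  proof -
    have "i \<ge> 1" "1 \<in> {1..m i}" "2 \<in> {1..m i}" using that by auto
    then have "(\<integral>\<omega>. (u \<bullet> \<psi> (X i 1 \<omega>) \<theta>) * (u \<bullet> \<psi> (X i 2 \<omega>) \<theta>) \<partial>M) = q (C i)"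
      unfolding q_def C_def by (rule expectation_psi_product)
    then show ?thesis by (simp only: q.scaleR real_scaleR_def)
  qed
  then have cross: "(\<Sum>i=1..n. \<Sum>j=1..m i. \<Sum>j'\<in>{1..m i} - {j}.
        w i j * w i j' * (\<integral>\<omega>. (u \<bullet> \<psi> (X i 1 \<omega>) \<theta>) * (u \<bullet> \<psi> (X i 2 \<omega>) \<theta>) \<partial>M)) =
      q (\<Sum>i=1..n. \<Sum>j=1..m i. \<Sum>j'\<in>{1..m i} - {j}. (w i j * w i j') *\<^sub>R C i)" for n
    unfolding q.sum by (intro sum.cong refl)
  have "(\<lambda>n. (1 / N n) * (\<Sum>i=1..n. \<Sum>j=1..m i. (w i j)\<^sup>2) * q B +
      q ((1 / N n) *\<^sub>R (\<Sum>i=1..n. \<Sum>j=1..m i. \<Sum>j'\<in>{1..m i} - {j}. (w i j * w i j') *\<^sub>R C i))) \<longlonglongrightarrow> cw * q B + q Cw"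
    by (intro tendsto_add tendsto_mult_right square_weight q.tendsto cross_weight)
  moreover have "cw * q B + q Cw = u \<bullet> (score_covariance *v u)"
    by (simp add: score_covariance_def q.add q.scaleR flip: q_def)
  ultimately show ?thesis unfolding qB cross by (simp add: q.scaleR)
qed

lemma inner_score:
  "u \<bullet> score n \<omega> = (1 / sqrt (N n)) * (\<Sum>i=1..n. cluster_sum w (\<lambda>x. u \<bullet> \<psi> x \<theta>) i \<omega>)"
  by (simp add: score_def cluster_sum_def inner_sum_right)

lemma score_limit:
  shows score_clt: "(\<lambda>n. CLINT \<omega>|M. iexp (u \<bullet> score n \<omega>)) \<longlonglongrightarrow> exp (- (u \<bullet> (score_covariance *v u)) / 2)"
    and integrable_inner_score_square: "integrable M (\<lambda>\<omega>. (u \<bullet> score n \<omega>)\<^sup>2)"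
    and score_second_moment: "(\<lambda>n. expectation (\<lambda>\<omega>. (u \<bullet> score n \<omega>)\<^sup>2)) \<longlonglongrightarrow> u \<bullet> (score_covariance *v u)"
proof -
  note [measurable] = psi_meas psi_rv[OF order_refl one_in]
  have h: "(\<lambda>x. u \<bullet> \<psi> x \<theta>) \<in> borel_measurable borel" by measurable
  have mean: "(\<integral>\<omega>. u \<bullet> \<psi> (X 1 1 \<omega>) \<theta> \<partial>M) = 0"
    using integrable_psi psi_centered by simp
  have mom: "integrable M (\<lambda>\<omega>. \<bar>u \<bullet> \<psi> (X 1 1 \<omega>) \<theta>\<bar> powr (2 + \<eta>))"
  proof (rule Bochner_Integration.integrable_bound[OF integrable_mult_right[OF psi_moment, of "norm u powr (2 + \<eta>)"]])
    have "\<bar>u \<bullet> y\<bar> powr (2 + \<eta>) \<le> norm u powr (2 + \<eta>) * norm y powr (2 + \<eta>)" for y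
      unfolding powr_mult[symmetric]
      using eta by (intro powr_mono2 Cauchy_Schwarz_ineq2) auto
    then show "AE \<omega> in M. norm (\<bar>u \<bullet> \<psi> (X 1 1 \<omega>) \<theta>\<bar> powr (2 + \<eta>)) \<le>
      norm (norm u powr (2 + \<eta>) * norm (\<psi> (X 1 1 \<omega>) \<theta>) powr (2 + \<eta>))" by simp
  qed measurable
  note clt = cluster_central_limit[OF h mean eta mom w_pos N_pos score_variance_limit lyapunov_weight]
  show "(\<lambda>n. CLINT \<omega>|M. iexp (u \<bullet> score n \<omega>)) \<longlonglongrightarrow> exp (- (u \<bullet> (score_covariance *v u)) / 2)"
    unfolding inner_score by (rule clt(1))
  show "integrable M (\<lambda>\<omega>. (u \<bullet> score n \<omega>)\<^sup>2)"
    unfolding inner_score by (rule clt(2))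
  show "(\<lambda>n. expectation (\<lambda>\<omega>. (u \<bullet> score n \<omega>)\<^sup>2)) \<longlonglongrightarrow> u \<bullet> (score_covariance *v u)"
    unfolding inner_score by (rule clt(3))
qed

text \<open>A limit of second moments.\<close>

lemma score_covariance_psd: "0 \<le> u \<bullet> (score_covariance *v u)"
  by (rule LIMSEQ_le_const[OF score_second_moment[of u]]) auto

text \<open>Each \<open>C i\<close> that occurs in the sums is symmetric because the two members of the pair may
  be exchanged; \<open>Cw\<close> is a limit of combinations of these.\<close>

lemma transpose_score_covariance: "transpose score_covariance = score_covariance"
proof -
  have entry: "(\<integral>\<omega>. outer_prod (\<psi> (X i j \<omega>) \<theta>) (\<psi> (X i j' \<omega>) \<theta>) \<partial>M) $ p $ q =
      (\<integral>\<omega>. \<psi> (X i j \<omega>) \<theta> $ p * \<psi> (X i j' \<omega>) \<theta> $ q \<partial>M)"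
    if "i \<ge> 1" "j \<in> {1..m i}" "j' \<in> {1..m i}" for i j j' p q
    using integral_bounded_linear[OF bounded_linear_matrix_entry integrable_psi_outer_prod[OF that], of p q]
    by (simp add: outer_prod_def)
  have B: "B $ p $ q = B $ q $ p" for p q
    unfolding B_def entry[OF order_refl one_in one_in] by (simp add: mult.commute)
  have meas: "(\<lambda>x. \<psi> x \<theta> $ p) \<in> borel_measurable borel" for p
    by (rule measurable_compose[OF psi_meas borel_measurable_continuous_onI]) (intro continuous_intros)
  have C: "C i $ p $ q = C i $ q $ p" if "i \<ge> 1" "2 \<le> m i" for i p q
  proof -
    have 12: "1 \<in> {1..m i}" "2 \<in> {1..m i}" using that by auto
    have "C i $ p $ q = (\<integral>\<omega>. \<psi> (X i 2 \<omega>) \<theta> $ p * \<psi> (X i 1 \<omega>) \<theta> $ q \<partial>M)"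
      unfolding C_def entry[OF that(1) 12]
      by (rule expectation_X_pair[OF meas meas that(1) 12(2,1), symmetric]) simp
    also have "\<dots> = C i $ q $ p"
      unfolding C_def entry[OF that(1) 12] by (simp add: mult.commute)
    finally show ?thesis .
  qed
  have Cw: "Cw $ p $ q = Cw $ q $ p" for p q
  proof (rule LIMSEQ_unique)
    let ?S = "\<lambda>n. (1 / N n) *\<^sub>R (\<Sum>i=1..n. \<Sum>j=1..m i. \<Sum>j'\<in>{1..m i} - {j}. (w i j * w i j') *\<^sub>R C i)"
    have S: "?S n $ p $ q = (1 / N n) * (\<Sum>i=1..n. \<Sum>j=1..m i. \<Sum>j'\<in>{1..m i} - {j}. (w i j * w i j') * C i $ p $ q)" for n p q
      by simp
    have "?S n $ p $ q = ?S n $ q $ p" for n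
      unfolding S by (intro arg_cong2[of _ _ _ _ "(*)"] sum.cong refl C) auto
    then have eq: "(\<lambda>n. ?S n $ q $ p) = (\<lambda>n. ?S n $ p $ q)" by (intro ext) (rule sym)
    show "(\<lambda>n. ?S n $ q $ p) \<longlonglongrightarrow> Cw $ p $ q"
      unfolding eq by (intro tendsto_vec_nth cross_weight)
    show "(\<lambda>n. ?S n $ q $ p) \<longlonglongrightarrow> Cw $ q $ p"
      by (intro tendsto_vec_nth cross_weight)
  qed
  show ?thesis using B Cw by (simp add: score_covariance_def vec_eq_iff transpose_def)
qed

lemma V_entry: "V $ p $ q = (\<integral>\<omega>. \<psi>' (X 1 1 \<omega>) \<theta> $ p $ q \<partial>M)"
  and integrable_psi'_entry: "integrable M (\<lambda>\<omega>. \<psi>' (X 1 1 \<omega>) \<theta> $ p $ q)"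
proof -
  have int: "integrable M (\<lambda>\<omega>. \<psi>' (X 1 1 \<omega>) \<theta>)"
    by (rule integrable_if_powr_integrable[OF psi'_rv[OF order_refl one_in] psi'_moment]) (use delta in simp)
  show "V $ p $ q = (\<integral>\<omega>. \<psi>' (X 1 1 \<omega>) \<theta> $ p $ q \<partial>M)"
    unfolding V_def using integral_bounded_linear[OF bounded_linear_matrix_entry int, of p q] by simp
  show "integrable M (\<lambda>\<omega>. \<psi>' (X 1 1 \<omega>) \<theta> $ p $ q)"
    by (rule integrable_bounded_linear[OF bounded_linear_matrix_entry int])
qed

lemma transpose_V: "transpose V = V"
proof -
  have "\<psi>' x \<theta> $ p $ q = \<psi>' x \<theta> $ q $ p" for x p q
    using psi'_sym[of x] by (metis transpose_def vec_lambda_beta)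
  then show ?thesis by (simp add: vec_eq_iff transpose_def V_entry)
qed

lemma normalised_weights:
  shows normalised_weight_pos: "n \<ge> 1 \<Longrightarrow> i \<ge> 1 \<Longrightarrow> j \<in> {1..m i} \<Longrightarrow> 0 < w i j / N n"
    and normalised_weight_total: "(\<lambda>n. \<Sum>i=1..n. \<Sum>j=1..m i. w i j / N n) \<longlonglongrightarrow> 1"
    and normalised_weight_negligible: "(\<lambda>n. \<Sum>i=1..n. (\<Sum>j=1..m i. w i j / N n)\<^sup>2) \<longlonglongrightarrow> 0"
proof -
  show "n \<ge> 1 \<Longrightarrow> i \<ge> 1 \<Longrightarrow> j \<in> {1..m i} \<Longrightarrow> 0 < w i j / N n" by (intro divide_pos_pos w_pos N_pos)
  show "(\<lambda>n. \<Sum>i=1..n. \<Sum>j=1..m i. w i j / N n) \<longlonglongrightarrow> 1"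
    using total_weight by (simp add: sum_divide_distrib)
  have "(\<lambda>n. \<Sum>i=1..n. ((\<Sum>j=1..m i. w i j) / N n)\<^sup>2) \<longlonglongrightarrow> 0"
  proof (rule sum_squares_tendsto_zero[OF _ delta total_weight negligible_weight])
    fix n i :: nat assume "i \<in> {1..n}"
    then show "0 \<le> (\<Sum>j=1..m i. w i j) / N n"
      using w_pos[of i] N_pos[of n] by (intro divide_nonneg_nonneg sum_nonneg less_imp_le) auto
  qed
  then show "(\<lambda>n. \<Sum>i=1..n. (\<Sum>j=1..m i. w i j / N n)\<^sup>2) \<longlonglongrightarrow> 0"
    by (simp add: sum_divide_distrib)
qed

lemma curvature_entry:
  "curvature n \<omega> $ p $ q = (\<Sum>i=1..n. cluster_sum (\<lambda>i j. w i j / N n) (\<lambda>x. \<psi>' x \<theta> $ p $ q) i \<omega>)"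
  by (simp add: curvature_def cluster_sum_def sum_divide_distrib)

lemma hoelder_const_eq: "hoelder_const n \<omega> = (\<Sum>i=1..n. cluster_sum (\<lambda>i j. w i j / N n) k i \<omega>)"
  by (simp add: hoelder_const_def cluster_sum_def sum_divide_distrib)

lemma curvature_consistent: "converges_in_probability M (\<lambda>n \<omega>. norm (curvature n \<omega> - V)) 0"
proof (rule converges_in_probability_zero_if_mean)
  let ?e = "\<lambda>p q n \<omega>. \<bar>curvature n \<omega> $ p $ q - V $ p $ q\<bar>"
  have meas: "(\<lambda>x. \<psi>' x \<theta> $ p $ q) \<in> borel_measurable borel" for p q
    by (rule measurable_compose[OF psi'_meas borel_measurable_continuous_onI]) (intro continuous_intros)
  have int: "integrable M (?e p q n)" for p q n
    unfolding curvature_entry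
    by (intro integrable_abs Bochner_Integration.integrable_diff integrable_const Bochner_Integration.integrable_sum
        integrable_cluster_sum meas integrable_psi'_entry) auto
  have lim: "(\<lambda>n. expectation (?e p q n)) \<longlonglongrightarrow> 0" for p q
    unfolding curvature_entry V_entry
    by (rule weighted_law_of_large_numbers[OF meas integrable_psi'_entry normalised_weight_pos
          normalised_weight_total normalised_weight_negligible])
  show "integrable M (\<lambda>\<omega>. \<Sum>p\<in>UNIV. \<Sum>q\<in>UNIV. ?e p q n \<omega>)" for n
    by (intro Bochner_Integration.integrable_sum int)
  have "expectation (\<lambda>\<omega>. \<Sum>p\<in>UNIV. \<Sum>q\<in>UNIV. ?e p q n \<omega>) = (\<Sum>p\<in>UNIV. \<Sum>q\<in>UNIV. expectation (?e p q n))" for n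
    using int by (simp add: Bochner_Integration.integral_sum)
  moreover have "(\<lambda>n. \<Sum>p\<in>UNIV. \<Sum>q\<in>UNIV. expectation (?e p q n)) \<longlonglongrightarrow> 0"
    by (intro tendsto_null_sum lim)
  ultimately show "(\<lambda>n. expectation (\<lambda>\<omega>. \<Sum>p\<in>UNIV. \<Sum>q\<in>UNIV. ?e p q n \<omega>)) \<longlonglongrightarrow> 0" by simp
  show "norm (norm (curvature n \<omega> - V)) \<le> (\<Sum>p\<in>UNIV. \<Sum>q\<in>UNIV. ?e p q n \<omega>)" for n \<omega>
    using norm_matrix_le_entries[of "curvature n \<omega> - V"] by simp
qed measurable

lemma hoelder_const_nonneg: "0 \<le> hoelder_const n \<omega>"
proof (unfold hoelder_const_def, intro mult_nonneg_nonneg sum_nonneg k_nonneg)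
  show "0 \<le> 1 / N n" unfolding total_size_def by (intro divide_nonneg_nonneg of_nat_0_le_iff) simp
  show "0 \<le> w i j" if "i \<in> {1..n}" "j \<in> {1..m i}" for i j using w_pos[of i j] that by simp
qed

lemma hoelder_const_bounded: "stochastically_bounded M hoelder_const"
proof (rule stochastically_bounded_if_mean)
  have intk: "integrable M (\<lambda>\<omega>. k (X 1 1 \<omega>))"
    by (rule integrable_if_powr_integrable[OF k_rv[OF order_refl one_in], where p = "1 + \<delta>"])
       (use k_moment k_nonneg delta in auto)
  show int: "integrable M (hoelder_const n)" for n
    unfolding hoelder_const_eq[abs_def]
    by (intro Bochner_Integration.integrable_sum integrable_cluster_sum k_meas intk) auto
  have E: "expectation (hoelder_const n) = (\<Sum>i=1..n. \<Sum>j=1..m i. w i j / N n) * (\<integral>\<omega>. k (X 1 1 \<omega>) \<partial>M)" for n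
  proof -
    have "expectation (hoelder_const n) = (\<Sum>i=1..n. expectation (cluster_sum (\<lambda>i j. w i j / N n) k i))"
      unfolding hoelder_const_eq[abs_def]
      by (rule Bochner_Integration.integral_sum) (auto intro!: integrable_cluster_sum k_meas intk[unfolded One_nat_def])
    also have "\<dots> = (\<Sum>i=1..n. (\<Sum>j=1..m i. w i j / N n) * (\<integral>\<omega>. k (X 1 1 \<omega>) \<partial>M))"
      by (intro sum.cong refl expectation_cluster_sum k_meas intk) auto
    finally show ?thesis by (simp add: sum_distrib_right)
  qed
  show "(\<lambda>n. expectation (hoelder_const n)) \<longlonglongrightarrow> 1 * (\<integral>\<omega>. k (X 1 1 \<omega>) \<partial>M)"
    unfolding E by (intro tendsto_mult_right normalised_weight_total)
  show "norm (hoelder_const n \<omega>) \<le> hoelder_const n \<omega>" for n \<omega>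
    using hoelder_const_nonneg[of n \<omega>] by simp
qed measurable

text \<open>The second moments of the coordinates converge, and \<open>\<bar>x\<bar> \<le> 1 +
  x\<^sup>2\<close>.\<close>

lemma score_bounded: "stochastically_bounded M score"
proof (rule stochastically_bounded_if_mean)
  let ?g = "\<lambda>n \<omega>. \<Sum>p\<in>UNIV. 1 + (axis p 1 \<bullet> score n \<omega>)\<^sup>2"
  have int: "integrable M (\<lambda>\<omega>. 1 + (axis p 1 \<bullet> score n \<omega>)\<^sup>2)" for p :: 'd and n
    by (intro Bochner_Integration.integrable_add integrable_const integrable_inner_score_square)
  show "integrable M (?g n)" for n by (intro Bochner_Integration.integrable_sum int)
  have "expectation (?g n) = (\<Sum>p\<in>UNIV. expectation (\<lambda>\<omega>. 1 + (axis p 1 \<bullet> score n \<omega>)\<^sup>2))" for n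
    by (rule Bochner_Integration.integral_sum) (rule int)
  also have "\<dots> n = (\<Sum>p\<in>UNIV. 1 + expectation (\<lambda>\<omega>. (axis p 1 \<bullet> score n \<omega>)\<^sup>2))" for n
    by (intro sum.cong refl) (simp add: integrable_inner_score_square prob_space)
  finally have E: "expectation (?g n) = (\<Sum>p\<in>UNIV. 1 + expectation (\<lambda>\<omega>. (axis p 1 \<bullet> score n \<omega>)\<^sup>2))" for n .
  show "(\<lambda>n. expectation (?g n)) \<longlonglongrightarrow> (\<Sum>p\<in>UNIV. 1 + axis p 1 \<bullet> (score_covariance *v axis p 1))"
    unfolding E by (intro tendsto_sum tendsto_add tendsto_const score_second_moment)
  show "norm (score n \<omega>) \<le> ?g n \<omega>" for n \<omega>
  proof -
    have "\<bar>x\<bar> \<le> 1 + x\<^sup>2" for x :: real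
    proof -
      have "2 * \<bar>x\<bar> \<le> 1 + x\<^sup>2" using sum_squares_bound[of "\<bar>x\<bar>" 1] by simp
      then show ?thesis by linarith
    qed
    then have "(\<Sum>p\<in>UNIV. \<bar>score n \<omega> $ p\<bar>) \<le> ?g n \<omega>"
      by (intro sum_mono) (simp add: inner_axis inner_commute[of "axis _ _"])
    with norm_le_l1_cart[of "score n \<omega>"] show ?thesis by linarith
  qed
qed measurable

text \<open>No measurability is known for \<open>est 0\<close>; replacing it by a constant makes the whole
  sequence measurable without affecting limits or \<open>standardised\<close>, which vanishes at
  \<open>0\<close>.\<close>

definition est0 :: "nat \<Rightarrow> 'w \<Rightarrow> real^'d" where
  "est0 n = (if n = 0 then (\<lambda>_. \<theta>) else est n)"

lemma est0_rv [measurable]: "est0 n \<in> borel_measurable M"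
  using est_rv[of n] by (simp add: est0_def)

lemma est0_consistent: "converges_in_probability M (\<lambda>n \<omega>. est0 n \<omega> - \<theta>) 0"
  unfolding converges_in_probability_zero_iff
proof (intro allI impI)
  fix \<epsilon> :: real assume "0 < \<epsilon>"
  then have "(\<lambda>n. measure M {\<omega> \<in> space M. dist (est n \<omega>) \<theta> > \<epsilon>}) \<longlonglongrightarrow> 0"
    using consistent by (simp add: converges_in_probability_def)
  then show "(\<lambda>n. measure M {\<omega> \<in> space M. norm (est0 n \<omega> - \<theta>) > \<epsilon>}) \<longlonglongrightarrow> 0"
  proof (rule Lim_transform_eventually)
    show "\<forall>\<^sub>F n in sequentially. measure M {\<omega> \<in> space M. dist (est n \<omega>) \<theta> > \<epsilon>} =
        measure M {\<omega> \<in> space M. norm (est0 n \<omega> - \<theta>) > \<epsilon>}"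
      using eventually_gt_at_top[of 0] by eventually_elim (simp add: est0_def dist_norm)
  qed
qed

definition standardised :: "nat \<Rightarrow> 'w \<Rightarrow> real^'d" where
  "standardised n \<omega> = sqrt (N n) *\<^sub>R (est n \<omega> - \<theta>)"

lemma standardised_eq: "standardised n \<omega> = sqrt (N n) *\<^sub>R (est0 n \<omega> - \<theta>)"
  by (simp add: standardised_def est0_def total_size_def)

lemma standardised_rv [measurable]: "standardised n \<in> borel_measurable M"
  unfolding standardised_eq[abs_def] by measurable

text \<open>The factor of \<open>norm (standardised n \<omega>)\<close> in the bound for everything in the
  expanded estimating equation besides the score and the linear term in \<open>V\<close>.\<close>

definition curvature_error :: "nat \<Rightarrow> 'w \<Rightarrow> real" where
  "curvature_error n \<omega> = norm (curvature n \<omega> - V) + hoelder_const n \<omega> * norm (est0 n \<omega> - \<theta>) powr lam"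

lemma curvature_error_rv [measurable]: "curvature_error n \<in> borel_measurable M"
  unfolding curvature_error_def[abs_def] by measurable

lemma curvature_error_vanishes: "converges_in_probability M curvature_error 0"
  unfolding curvature_error_def[abs_def]
proof (rule converges_in_probability_zero_add[OF _ _ curvature_consistent])
  show "converges_in_probability M (\<lambda>n \<omega>. hoelder_const n \<omega> * norm (est0 n \<omega> - \<theta>) powr lam) 0"
    by (rule converges_in_probability_zero_mult[OF _ _ hoelder_const_bounded
          converges_in_probability_zero_powr[OF est0_consistent lam]]) measurable
qed measurable

lemma curvature_error_times_score_vanishes:
  "converges_in_probability M (\<lambda>n \<omega>. norm (score n \<omega>) * curvature_error n \<omega>) 0"
proof (rule converges_in_probability_zero_mult[OF _ _ _ curvature_error_vanishes])
  show "stochastically_bounded M (\<lambda>n \<omega>. norm (score n \<omega>))"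
    by (rule stochastically_bounded_dominated[OF _ score_bounded, where c = 1]) auto
qed measurable

text \<open>The Taylor expansion around \<open>\<theta>\<close>. One of the two factors \<open>|est -
  \<theta>|\<close> in the remainder supplies the norm of \<open>standardised n \<omega>\<close>,
  since \<open>(1 / N n) * sqrt (N n) = 1 / sqrt (N n)\<close>.\<close>

lemma linearised_estimating_equation:
  assumes n: "n \<ge> 1" and \<omega>: "\<omega> \<in> space M" and U_est: "est n \<omega> \<in> U"
  obtains r where "score n \<omega> + curvature n \<omega> *v standardised n \<omega> + r = 0"
    "norm r \<le> (hoelder_const n \<omega> * norm (est0 n \<omega> - \<theta>) powr lam) * norm (standardised n \<omega>)"
proof -
  define h where "h = est n \<omega> - \<theta>"
  have h0: "est0 n \<omega> - \<theta> = h" using n by (simp add: est0_def h_def)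
  have Np: "0 < N n" by (rule N_pos[OF n])
  define \<rho> where "\<rho> i j = \<psi> (X i j \<omega>) (est n \<omega>) - \<psi> (X i j \<omega>) \<theta> - \<psi>' (X i j \<omega>) \<theta> *v h" for i j
  have \<rho>: "norm (\<rho> i j) \<le> k (X i j \<omega>) * norm h powr lam * norm h" for i j
    unfolding \<rho>_def h_def
    by (rule hoelder_taylor_remainder[OF U(2,3) U_est psi' hoelder[OF U(3)] k_nonneg lam])
  define r where "r = (1 / sqrt (N n)) *\<^sub>R (\<Sum>i=1..n. \<Sum>j=1..m i. w i j *\<^sub>R \<rho> i j)"
  have lin: "linear (\<lambda>A :: real^'d^'d. A *v h)"
    by (simp add: linear_iff matrix_vector_mult_add_rdistrib scaleR_matrix_vector_assoc[symmetric])
  have sqrt: "(1 / N n) * sqrt (N n) = 1 / sqrt (N n)"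
    using Np by (simp add: field_simps)
  have "curvature n \<omega> *v standardised n \<omega> = ((1 / N n) * sqrt (N n)) *\<^sub>R
      ((\<Sum>i=1..n. \<Sum>j=1..m i. w i j *\<^sub>R \<psi>' (X i j \<omega>) \<theta>) *v h)"
    by (simp add: curvature_def standardised_def h_def[symmetric] matrix_vector_mult_scaleR
        scaleR_matrix_vector_assoc[symmetric] del: divide_divide_eq_left)
  also have "\<dots> = (1 / sqrt (N n)) *\<^sub>R (\<Sum>i=1..n. \<Sum>j=1..m i. w i j *\<^sub>R (\<psi>' (X i j \<omega>) \<theta> *v h))"
    unfolding sqrt linear_sum[OF lin] by (simp add: scaleR_matrix_vector_assoc[symmetric])
  finally have cT: "curvature n \<omega> *v standardised n \<omega> =
      (1 / sqrt (N n)) *\<^sub>R (\<Sum>i=1..n. \<Sum>j=1..m i. w i j *\<^sub>R (\<psi>' (X i j \<omega>) \<theta> *v h))" .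
  have "score n \<omega> + curvature n \<omega> *v standardised n \<omega> + r =
      (1 / sqrt (N n)) *\<^sub>R (\<Sum>i=1..n. \<Sum>j=1..m i. w i j *\<^sub>R \<psi> (X i j \<omega>) (est n \<omega>))"
    unfolding cT score_def r_def \<rho>_def scaleR_add_right[symmetric] sum.distrib[symmetric] by simp
  then have "score n \<omega> + curvature n \<omega> *v standardised n \<omega> + r = 0"
    unfolding est_eq[OF n \<omega> U_est] by simp
  moreover have "norm r \<le> (hoelder_const n \<omega> * norm (est0 n \<omega> - \<theta>) powr lam) * norm (standardised n \<omega>)"
  proof -
    have "norm (\<Sum>i=1..n. \<Sum>j=1..m i. w i j *\<^sub>R \<rho> i j) \<le>
        (\<Sum>i=1..n. \<Sum>j=1..m i. w i j * k (X i j \<omega>) * (norm h powr lam * norm h))"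
    proof (intro order_trans[OF norm_sum] sum_mono)
      fix i j assume ij: "i \<in> {1..n}" "j \<in> {1..m i}"
      then have "0 < w i j" by (intro w_pos) auto
      then show "norm (w i j *\<^sub>R \<rho> i j) \<le> w i j * k (X i j \<omega>) * (norm h powr lam * norm h)"
        using mult_left_mono[OF \<rho>[of i j], of "w i j"] by (simp add: mult.assoc)
    qed
    also have "\<dots> = (\<Sum>i=1..n. \<Sum>j=1..m i. w i j * k (X i j \<omega>)) * (norm h powr lam * norm h)"
      by (simp only: sum_distrib_right)
    finally have "norm r \<le> (1 / sqrt (N n)) * ((\<Sum>i=1..n. \<Sum>j=1..m i. w i j * k (X i j \<omega>)) * (norm h powr lam * norm h))"
      using Np by (simp add: r_def divide_right_mono)
    also have "\<dots> = (hoelder_const n \<omega> * norm h powr lam) * (sqrt (N n) * norm h)"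
      unfolding hoelder_const_def sqrt[symmetric] by (simp add: mult_ac)
    also have "sqrt (N n) * norm h = norm (standardised n \<omega>)"
      using Np by (simp add: standardised_def h_def)
    finally show ?thesis unfolding h0 .
  qed
  ultimately show ?thesis by (rule that)
qed

text \<open>The error is large only if the estimator is not close to \<open>\<theta>\<close>, so that the
  estimating equation may fail, or if the curvature error is too large to be absorbed, or if its
  product with the score is large.\<close>

theorem asymptotic_linearity:
  "converges_in_probability M (\<lambda>n \<omega>. standardised n \<omega> + matrix_inv V *v score n \<omega>) 0"
  unfolding converges_in_probability_zero_iff
proof (intro allI impI)
  fix \<epsilon> :: real assume \<epsilon>: "0 < \<epsilon>"
  let ?W = "matrix_inv V"
  \<comment> \<open>Adding one avoids dividing by zero below.\<close>
  define c where "c = norm ?W + 1"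
  have c: "0 < c" "norm ?W \<le> c" by (auto simp: c_def add_nonneg_pos)
  obtain r where r: "0 < r" "ball \<theta> r \<subseteq> U" using U openE by blast
  let ?B = "\<lambda>n. {\<omega> \<in> space M. norm (est0 n \<omega> - \<theta>) > r / 2}"
  let ?C1 = "\<lambda>n. {\<omega> \<in> space M. norm (curvature_error n \<omega>) > 1 / (2 * c)}"
  let ?C2 = "\<lambda>n. {\<omega> \<in> space M. norm (norm (score n \<omega>) * curvature_error n \<omega>) > \<epsilon> / (2 * c\<^sup>2)}"
  have C: "(\<lambda>n. measure M (?C1 n \<union> ?C2 n)) \<longlonglongrightarrow> 0"
  proof (rule measure_tendsto_zero_by_cover[OF _ _ order_refl])
    show "(\<lambda>n. measure M (?C1 n)) \<longlonglongrightarrow> 0"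
      using curvature_error_vanishes c(1) unfolding converges_in_probability_zero_iff by simp
    show "(\<lambda>n. measure M (?C2 n)) \<longlonglongrightarrow> 0"
      using curvature_error_times_score_vanishes c(1) \<epsilon> unfolding converges_in_probability_zero_iff by simp
  qed measurable
  have B: "(\<lambda>n. measure M (?B n)) \<longlonglongrightarrow> 0"
    using est0_consistent half_gt_zero[OF r(1)] unfolding converges_in_probability_zero_iff by blast
  show "(\<lambda>n. measure M {\<omega> \<in> space M. norm (standardised n \<omega> + ?W *v score n \<omega>) > \<epsilon>}) \<longlonglongrightarrow> 0"
  proof (rule measure_tendsto_zero_by_cover[OF _ _ _ B C])
    fix n
    show "{\<omega> \<in> space M. norm (standardised n \<omega> + ?W *v score n \<omega>) > \<epsilon>} \<subseteq> ?B n \<union> (?C1 n \<union> ?C2 n)"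
    proof (rule subsetI, rule ccontr)
      fix \<omega> assume "\<omega> \<in> {\<omega> \<in> space M. norm (standardised n \<omega> + ?W *v score n \<omega>) > \<epsilon>}"
      then have \<omega>: "\<omega> \<in> space M" and big: "norm (standardised n \<omega> + ?W *v score n \<omega>) > \<epsilon>" by auto
      assume "\<omega> \<notin> ?B n \<union> (?C1 n \<union> ?C2 n)"
      then have near: "norm (est0 n \<omega> - \<theta>) \<le> r / 2" and e1: "norm (curvature_error n \<omega>) \<le> 1 / (2 * c)"
        and e2: "norm (norm (score n \<omega>) * curvature_error n \<omega>) \<le> \<epsilon> / (2 * c\<^sup>2)"
        using \<omega> by auto
      have n: "n \<ge> 1"
      proof (rule ccontr)
        assume "\<not> n \<ge> 1"
        then have "n = 0" by simp
        then have "standardised n \<omega> + ?W *v score n \<omega> = 0" by (simp add: standardised_def score_def total_size_def)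
        then show False using big \<epsilon> by simp
      qed
      have "est n \<omega> \<in> ball \<theta> r"
        using near r(1) n by (simp add: est0_def dist_norm norm_minus_commute)
      then have "est n \<omega> \<in> U" using r(2) by blast
      then obtain \<rho> where \<rho>: "score n \<omega> + curvature n \<omega> *v standardised n \<omega> + \<rho> = 0"
        "norm \<rho> \<le> (hoelder_const n \<omega> * norm (est0 n \<omega> - \<theta>) powr lam) * norm (standardised n \<omega>)"
        by (rule linearised_estimating_equation[OF n \<omega>])
      have q: "0 \<le> hoelder_const n \<omega> * norm (est0 n \<omega> - \<theta>) powr lam"
        using hoelder_const_nonneg by simp
      have ce0: "0 \<le> curvature_error n \<omega>" using q by (simp add: curvature_error_def)
      have "norm ?W * curvature_error n \<omega> \<le> c * (1 / (2 * c))"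
        using e1 c ce0 by (intro mult_mono) auto
      then have small: "norm ?W * curvature_error n \<omega> \<le> 1 / 2" using c by simp
      have "norm (standardised n \<omega> + ?W *v score n \<omega>) \<le> 2 * (norm ?W)\<^sup>2 * (curvature_error n \<omega> * norm (score n \<omega>))"
        using linearised_equation_error[OF V_inv \<rho> q] small by (simp add: curvature_error_def)
      also have "\<dots> \<le> 2 * c\<^sup>2 * (curvature_error n \<omega> * norm (score n \<omega>))"
        using c ce0 by (intro mult_right_mono mult_left_mono power_mono) auto
      also have "\<dots> \<le> 2 * c\<^sup>2 * (\<epsilon> / (2 * c\<^sup>2))"
        using e2 ce0 by (intro mult_left_mono) (auto simp: abs_mult mult.commute)
      also have "\<dots> = \<epsilon>" using c by simp
      finally show False using big by simp
    qed
  qed measurable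
qed

text \<open>By asymptotic linearity the cosine expectations have the same limits as those of minus the inverse
  of \<open>V\<close> applied to the score, and tightness carries over as well. Since the inverse is
  symmetric, it can be moved onto the frequency \<open>t\<close>.\<close>

theorem asymptotic_normality:
  "\<exists>\<mu>. multivariate_normal \<mu> 0 (matrix_inv V ** score_covariance ** matrix_inv V) \<and>
     converges_in_distribution M standardised \<mu>"
proof -
  let ?W = "matrix_inv V"
  let ?S = "?W ** score_covariance ** ?W"
  have W: "transpose ?W = ?W" by (rule transpose_matrix_inv[OF V_inv transpose_V])
  have quad: "t \<bullet> (?S *v t) = (?W *v t) \<bullet> (score_covariance *v (?W *v t))" for t
    by (simp add: inner_matrix_symmetric[OF W, of t] flip: matrix_vector_mul_assoc)
  have "transpose ?S = ?S" by (simp add: matrix_transpose_mul W transpose_score_covariance matrix_mul_assoc)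
  moreover have "0 \<le> t \<bullet> (?S *v t)" for t unfolding quad by (rule score_covariance_psd)
  ultimately obtain \<mu> where \<mu>: "multivariate_normal \<mu> 0 ?S"
    "\<And>t b. (\<integral>x. cos (t \<bullet> x + b) \<partial>\<mu>) = exp (- (t \<bullet> (?S *v t)) / 2) * cos b"
    using ex_multivariate_normal[of ?S] by blast
  define Z where "Z n \<omega> = - (?W *v score n \<omega>)" for n \<omega>
  have Z_rv[measurable]: "Z n \<in> borel_measurable M" for n
    unfolding Z_def[abs_def]
    by (intro borel_measurable_uminus measurable_compose[OF score_rv borel_measurable_continuous_onI] linear_continuous_on
        matrix_vector_mul_bounded_linear)
  define R where "R n \<omega> = standardised n \<omega> + ?W *v score n \<omega>" for n \<omega>
  have R_eq: "R n \<omega> = standardised n \<omega> - Z n \<omega>" for n \<omega> by (simp add: R_def Z_def)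
  have R_rv[measurable]: "R n \<in> borel_measurable M" for n unfolding R_eq[abs_def] by measurable
  have R: "converges_in_probability M R 0" unfolding R_def[abs_def] by (rule asymptotic_linearity)
  have split: "standardised = (\<lambda>n \<omega>. Z n \<omega> + R n \<omega>)" by (simp add: R_eq fun_eq_iff)
  have Z_bounded: "stochastically_bounded M Z"
    by (rule stochastically_bounded_dominated[OF score_rv score_bounded, where c = "norm ?W"])
       (auto simp: Z_def norm_matrix_vector_mult_le)
  have "(\<lambda>n. \<integral>\<omega>. cos (t \<bullet> Z n \<omega> + b) \<partial>M) \<longlonglongrightarrow> (\<integral>x. cos (t \<bullet> x + b) \<partial>\<mu>)" for t b
  proof -
    define u where "u = - (?W *v t)"
    have u: "t \<bullet> Z n \<omega> = u \<bullet> score n \<omega>" for n \<omega>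
      by (simp add: Z_def u_def inner_matrix_symmetric[OF W])
    have uD: "u \<bullet> (score_covariance *v u) = t \<bullet> (?S *v t)"
      unfolding quad u_def by (simp add: linear_neg[OF matrix_vector_mul_linear])
    have "(\<integral>\<omega>. cos (t \<bullet> Z n \<omega> + b) \<partial>M) = Re (iexp b * (CLINT \<omega>|M. iexp (u \<bullet> score n \<omega>)))" for n
      unfolding u by (rule expectation_cos_shift) measurable
    moreover have "(\<lambda>n. Re (iexp b * (CLINT \<omega>|M. iexp (u \<bullet> score n \<omega>)))) \<longlonglongrightarrow> Re (iexp b * exp (- (u \<bullet> (score_covariance *v u)) / 2))"
      by (intro tendsto_Re tendsto_mult tendsto_const score_clt)
    moreover have "Re (iexp b * exp (- (u \<bullet> (score_covariance *v u)) / 2)) = (\<integral>x. cos (t \<bullet> x + b) \<partial>\<mu>)"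
      unfolding \<mu>(2) uD by (simp add: Re_exp)
    ultimately show ?thesis by simp
  qed
  then have cosines: "(\<lambda>n. \<integral>\<omega>. cos (t \<bullet> standardised n \<omega> + b) \<partial>M) \<longlonglongrightarrow> (\<integral>x. cos (t \<bullet> x + b) \<partial>\<mu>)" for t b
    unfolding split by (rule expectation_cos_slutsky[OF Z_rv R_rv R])
  have "stochastically_bounded M standardised"
    unfolding split by (rule stochastically_bounded_add[OF Z_rv R_rv Z_bounded R])
  then have "converges_in_distribution M standardised \<mu>"
    using \<mu>(1) cosines unfolding multivariate_normal_def
    by (intro converges_in_distribution_if_cosines_converge standardised_rv) auto
  with \<mu>(1) show ?thesis by blast
qed

end

section \<open>Asymptotic normality of the weighted M-estimator\<close>

theorem theorem3p2:
  fixes M :: "'w measure"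
    and m :: "nat \<Rightarrow> nat"
    and X :: "nat \<Rightarrow> nat \<Rightarrow> 'w \<Rightarrow> real^'d"
    and P :: "real^'d \<Rightarrow> (real^'d) measure"
    and \<Theta> U :: "(real^'d) set"
    and \<theta> :: "real^'d"
    and \<rho> :: "real^'d \<Rightarrow> real^'d \<Rightarrow> real"
    and \<psi> :: "real^'d \<Rightarrow> real^'d \<Rightarrow> real^'d"
    and \<psi>' :: "real^'d \<Rightarrow> real^'d \<Rightarrow> real^'d^'d"
    and w :: "nat \<Rightarrow> nat \<Rightarrow> real"
    and est :: "nat \<Rightarrow> 'w \<Rightarrow> real^'d"
    and k :: "real^'d \<Rightarrow> real"
    and C :: "nat \<Rightarrow> real^'d^'d"
    and Cw B V :: "real^'d^'d"
    and cw \<eta> \<delta> lam l :: real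
  \<comment> \<open>clustered sample\<close>
  assumes prob: "prob_space M"
    and m_pos: "\<And>i. i \<ge> 1 \<Longrightarrow> m i \<ge> 1"
    and X_rv: "\<And>i j. i \<ge> 1 \<Longrightarrow> j \<in> {1..m i} \<Longrightarrow> X i j \<in> borel_measurable M"
    and X_indep: "prob_space.indep_vars M (\<lambda>i. Pi\<^sub>M {1..m i} (\<lambda>_. borel))
                    (\<lambda>i \<omega>. \<lambda>j\<in>{1..m i}. X i j \<omega>) {1..}"
    and X_law: "\<And>i j. i \<ge> 1 \<Longrightarrow> j \<in> {1..m i} \<Longrightarrow> distr M borel (X i j) = P \<theta>"
    and X_pairs: "\<And>i j j'. i \<ge> 1 \<Longrightarrow> j \<in> {1..m i} \<Longrightarrow> j' \<in> {1..m i} \<Longrightarrow> j \<noteq> j' \<Longrightarrow>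
                    distr M (borel \<Otimes>\<^sub>M borel) (\<lambda>\<omega>. (X i j \<omega>, X i j' \<omega>)) =
                    distr M (borel \<Otimes>\<^sub>M borel) (\<lambda>\<omega>. (X i 1 \<omega>, X i 2 \<omega>))"
    and size_lim: "(\<lambda>n. total_size m n / real n) \<longlonglongrightarrow> l" "l \<ge> 1"
  \<comment> \<open>parameter set and loss function\<close>
    and Theta: "convex \<Theta>" "bounded \<Theta>" "interior \<Theta> \<noteq> {}"
    and rho_meas: "\<And>a. (\<lambda>x. \<rho> x a) \<in> borel_measurable borel"
    and rho_int: "\<And>a. a \<in> \<Theta> \<Longrightarrow> integrable M (\<lambda>\<omega>. \<rho> (X 1 1 \<omega>) a)"
    and theta_argmin: "is_arg_min (\<lambda>a. \<integral>\<omega>. \<rho> (X 1 1 \<omega>) a \<partial>M) (\<lambda>a. a \<in> \<Theta>) \<theta>"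
    and U: "open U" "convex U" "\<theta> \<in> U"
    and psi: "\<And>x a. a \<in> U \<Longrightarrow> GDERIV (\<rho> x) a :> \<psi> x a"
    and psi': "\<And>x a. a \<in> U \<Longrightarrow> (\<psi> x has_derivative (\<lambda>h. \<psi>' x a *v h)) (at a)"
    and psi_centered: "(\<integral>\<omega>. \<psi> (X 1 1 \<omega>) \<theta> \<partial>M) = 0"
  \<comment> \<open>weights and weighted M-estimator\<close>
    and w_pos: "\<And>i j. i \<ge> 1 \<Longrightarrow> j \<in> {1..m i} \<Longrightarrow> w i j > 0"
    and est_rv: "\<And>n. n \<ge> 1 \<Longrightarrow> est n \<in> borel_measurable M"
    and est_argmin: "\<And>n \<omega>. n \<ge> 1 \<Longrightarrow> \<omega> \<in> space M \<Longrightarrow>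
          is_arg_min (\<lambda>a. (1 / total_size m n) * (\<Sum>i=1..n. \<Sum>j=1..m i. w i j * \<rho> (X i j \<omega>) a))
            (\<lambda>a. a \<in> \<Theta>) (est n \<omega>)"
    and est_eq: "\<And>n \<omega>. n \<ge> 1 \<Longrightarrow> \<omega> \<in> space M \<Longrightarrow> est n \<omega> \<in> U \<Longrightarrow>
          (\<Sum>i=1..n. \<Sum>j=1..m i. w i j *\<^sub>R \<psi> (X i j \<omega>) (est n \<omega>)) = 0"
    and consistent: "converges_in_probability M est \<theta>"
  \<comment> \<open>(a)\<close>
    and a1: "(\<lambda>n. \<Sum>i=1..n. (\<Sum>j=1..m i. w i j) / total_size m n) \<longlonglongrightarrow> 1"
    and a2: "(\<lambda>n. (1 / total_size m n) * (\<Sum>i=1..n. \<Sum>j=1..m i. (w i j)\<^sup>2)) \<longlonglongrightarrow> cw"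
  \<comment> \<open>(b)\<close>
    and C_def: "\<And>i. C i = (\<integral>\<omega>. outer_prod (\<psi> (X i 1 \<omega>) \<theta>) (\<psi> (X i 2 \<omega>) \<theta>) \<partial>M)"
    and b: "(\<lambda>n. (1 / total_size m n) *\<^sub>R
              (\<Sum>i=1..n. \<Sum>j=1..m i. \<Sum>j'\<in>{1..m i} - {j}. (w i j * w i j') *\<^sub>R C i)) \<longlonglongrightarrow> Cw"
  \<comment> \<open>(c)\<close>
    and eta: "\<eta> > 0"
    and c1: "integrable M (\<lambda>\<omega>. norm (\<psi> (X 1 1 \<omega>) \<theta>) powr (2 + \<eta>))"
    and c2: "(\<lambda>n. (1 / total_size m n powr (1 + \<eta> / 2)) *
               (\<Sum>i=1..n. (\<Sum>j=1..m i. w i j) powr (2 + \<eta>))) \<longlonglongrightarrow> 0"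
  \<comment> \<open>(d)\<close>
    and delta: "\<delta> > 0"
    and d1: "integrable M (\<lambda>\<omega>. norm (\<psi>' (X 1 1 \<omega>) \<theta>) powr (1 + \<delta>))"
    and lam: "0 < lam" "lam \<le> 1"
    and k_meas: "k \<in> borel_measurable borel"
    and k_nonneg: "\<And>x. k x \<ge> 0"
    and d2: "\<And>x a1 a2. a1 \<in> U \<Longrightarrow> a2 \<in> U \<Longrightarrow>
               norm (\<psi>' x a2 - \<psi>' x a1) \<le> k x * norm (a2 - a1) powr lam"
    and d3: "integrable M (\<lambda>\<omega>. k (X 1 1 \<omega>) powr (1 + \<delta>))"
    and d4: "(\<lambda>n. \<Sum>i=1..n. ((\<Sum>j=1..m i. w i j) / total_size m n) powr (1 + \<delta>)) \<longlonglongrightarrow> 0"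
  \<comment> \<open>limiting matrices\<close>
    and V_def: "V = (\<integral>\<omega>. \<psi>' (X 1 1 \<omega>) \<theta> \<partial>M)"
    and V_inv: "invertible V"
    and B_def: "B = (\<integral>\<omega>. outer_prod (\<psi> (X 1 1 \<omega>) \<theta>) (\<psi> (X 1 1 \<omega>) \<theta>) \<partial>M)"
  shows "\<exists>\<mu>. multivariate_normal \<mu> 0 (matrix_inv V ** (cw *\<^sub>R B + Cw) ** matrix_inv V) \<and>
           converges_in_distribution M (\<lambda>n \<omega>. sqrt (total_size m n) *\<^sub>R (est n \<omega> - \<theta>)) \<mu>"
proof -
  interpret prob_space M by (rule prob)
  have one: "(1::nat) \<in> {1..m 1}" using m_pos[of 1] by simp
  have psi_meas: "(\<lambda>x. \<psi> x a) \<in> borel_measurable borel" if "a \<in> U" for a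
  proof (rule borel_measurable_if_inner)
    fix v
    show "(\<lambda>x. v \<bullet> \<psi> x a) \<in> borel_measurable borel"
      by (rule borel_measurable_directional_derivative[OF U(1) that rho_meas psi[OF that, unfolded gderiv_def]])
  qed
  have psi'_meas: "(\<lambda>x. \<psi>' x \<theta>) \<in> borel_measurable borel"
  proof (rule borel_measurable_if_matrix_vector)
    fix v
    show "(\<lambda>x. \<psi>' x \<theta> *v v) \<in> borel_measurable borel"
      by (rule borel_measurable_directional_derivative[OF U(1,3) psi_meas psi'[OF U(3)]])
  qed
  have psi'_sym: "transpose (\<psi>' x \<theta>) = \<psi>' x \<theta>" for x
    by (rule transpose_eq_if_symmetric_form, rule symmetric_second_derivative[OF U(1,3) psi psi'[OF U(3)]])
  interpret weighted_z_estimator M m X U \<theta> \<psi> \<psi>' w est k C Cw B V cw \<eta> \<delta> lam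
  proof
    show "distr M borel (X i j) = distr M borel (X 1 1)" if "i \<ge> 1" "j \<in> {1..m i}" for i j
      using X_law[OF that] X_law[OF order_refl one] by simp
    show "norm (\<psi>' x a2 - \<psi>' x a1) \<le> k x * norm (a2 - a1) powr lam" if "a1 \<in> U" "a2 \<in> U" for x a1 a2
      by (rule d2[OF that])
  qed (fact m_pos X_rv X_indep X_pairs U psi_meas[OF U(3)] psi'_meas psi' psi'_sym psi_centered w_pos est_rv est_eq
      consistent a1 a2 C_def b eta c1 c2 delta d1 lam(1) k_meas k_nonneg d3 d4 V_def V_inv B_def)+
  show ?thesis
    using asymptotic_normality by (simp add: score_covariance_def standardised_def[abs_def])
qed

end
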